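(* Suppose that $V(x)=\|x\|^\delta$ on $\mathbb R^d$ with $\delta>0$, $\theta_j=j^\gamma$ with $\gamma>0$, and that $(1+\gamma)\bigl(1+\frac12\gamma\bigr)<\frac d\delta<\gamma+2$. If $\rho>\rho_{\rm c}$, then as $n,L\to\infty$ with $n=\rho L^d$, under $\mathbb P_{L,n}$, $$\frac{H_0-(\rho-\rho_{\rm c}^L)L^d}{L^{\delta(1+\gamma/2)}}\longrightarrow\Bigl(\Gamma(\gamma+2)\sum_{x\in\mathbb Z^d\setminus\{0\}}\frac1{\|x\|^{\delta(\gamma+2)}}\Bigr)^{1/2}\mathcal N(0,1)\quad\text{in distribution}.$$
   Context: A spatial partition of $n$ is a family $\boldsymbol\lambda=(\lambda_x)_{x\in\mathbb Z^d}$ of integer partitions (possibly empty) whose parts sum in total to $n$; $\Lambda_n$ is the set of these. $r_{xj}(\boldsymbol\lambda)$ is the number of parts of $\lambda_x$ equal to $j$; $H_x=\sum_jj\,r_{xj}$, so $H_0$ is the occupation of the origin. The probability measure on $\Lambda_n$ is $$\mathbb P_{L,n}(\boldsymbol\lambda)=\frac1{Z_{L,n}}\prod_{x\in\mathbb Z^d}\prod_{j\ge1}\frac1{r_{xj}(\boldsymbol\lambda)!}\Bigl(\frac{\theta_j}{j}e^{-jV(x/L)}\Bigr)^{r_{xj}(\boldsymbol\lambda)},$$ with $Z_{L,n}$ the normalization. Further $$\rho_{\rm c}=\sum_{j\ge1}\theta_j\int_{\mathbb R^d}e^{-jV(x)}dx,\qquad\rho_{\rm c}^L=\frac1{L^d}\sum_{j\ge1}\sum_{x\in\mathbb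 Z^d\setminus\{0\}}\theta_je^{-jV(x/L)}.$$ $\|\cdot\|$ is the Euclidean norm and $\mathcal N(0,1)$ a standard normal random variable. *)

theory Defs
  imports "HOL-Probability.Probability" "HOL-Library.Multiset"
begin

text \<open>An integer partition is the multiset of its (positive) parts. A family of partitions
  indexed by the lattice has finite total size only if all but finitely many members are empty.\<close>

type_synonym 'd spatial_family = "int ^ 'd \<Rightarrow> nat multiset"

definition occupied :: "'d::finite spatial_family \<Rightarrow> (int ^ 'd) set" where
  "occupied l = {x. l x \<noteq> {#}}"

definition part_mult :: "int ^ 'd \<Rightarrow> nat \<Rightarrow> 'd::finite spatial_family \<Rightarrow> nat" where
  "part_mult x j l = count (l x) j"

text \<open>Sums and products over all \<open>j \<ge> 1\<close> and all sites are restricted here and below to the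
  finitely many indices with \<open>part_mult x j l > 0\<close>; the other terms are \<open>0\<close> in the
  sums and \<open>1\<close> in the products.\<close>

definition occupation :: "int ^ 'd \<Rightarrow> 'd::finite spatial_family \<Rightarrow> nat" where
  "occupation x l = (\<Sum>j\<in>set_mset (l x). j * part_mult x j l)"

definition spatial_partitions :: "nat \<Rightarrow> 'd::finite spatial_family set" where
  "spatial_partitions n =
     {l. (\<forall>x. 0 \<notin># l x) \<and> finite (occupied l) \<and> (\<Sum>x\<in>occupied l. occupation x l) = n}"

definition lattice_point :: "int ^ 'd \<Rightarrow> real ^ 'd" where
  "lattice_point x = (\<chi> i. real_of_int (x $ i))"

definition weight ::
  "(nat \<Rightarrow> real) \<Rightarrow> (real ^ 'd \<Rightarrow> real) \<Rightarrow> real \<Rightarrow> 'd::finite spatial_family \<Rightarrow> real" where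
  "weight \<theta> V L l =
     (\<Prod>x\<in>occupied l. \<Prod>j\<in>set_mset (l x).
        1 / fact (part_mult x j l) *
        (\<theta> j / real j * exp (- real j * V (lattice_point x /\<^sub>R L))) ^ part_mult x j l)"

definition partition_function ::
  "(nat \<Rightarrow> real) \<Rightarrow> (real ^ 'd::finite \<Rightarrow> real) \<Rightarrow> real \<Rightarrow> nat \<Rightarrow> real" where
  "partition_function \<theta> V L n = (\<Sum>\<^sub>\<infinity>l\<in>spatial_partitions n. weight \<theta> V L l)"

definition partition_measure ::
  "(nat \<Rightarrow> real) \<Rightarrow> (real ^ 'd::finite \<Rightarrow> real) \<Rightarrow> real \<Rightarrow> nat \<Rightarrow> 'd spatial_family measure" where
  "partition_measure \<theta> V L n =
     point_measure (spatial_partitions n)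
       (\<lambda>l. ennreal (weight \<theta> V L l / partition_function \<theta> V L n))"

text \<open>The critical density may be infinite for general \<open>\<theta>\<close> and \<open>V\<close>.\<close>

definition critical_density :: "(nat \<Rightarrow> real) \<Rightarrow> (real ^ 'd::finite \<Rightarrow> real) \<Rightarrow> ennreal" where
  "critical_density \<theta> V =
     (\<Sum>\<^sub>\<infinity>j\<in>{1..}. ennreal (\<theta> j) * (\<integral>\<^sup>+x. ennreal (exp (- real j * V x)) \<partial>lborel))"

definition critical_density_L ::
  "(nat \<Rightarrow> real) \<Rightarrow> (real ^ 'd::finite \<Rightarrow> real) \<Rightarrow> real \<Rightarrow> real" where
  "critical_density_L \<theta> V L =
     1 / L ^ CARD('d) *
     (\<Sum>\<^sub>\<infinity>j\<in>{1..}. \<Sum>\<^sub>\<infinity>x\<in>-{0}. \<theta> j * exp (- real j * V (lattice_point x /\<^sub>R L)))"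

end

theory Submission
  imports Defs "HOL-Computational_Algebra.Formal_Power_Series"
begin

text \<open>
  The weight of a spatial partition is a product over the sites and \<open>V\<close> vanishes at the
  origin. Hence the partitions of \<open>n\<close> with \<open>H\<^sub>0 = m\<close> have total weight \<open>h m * A (n - m)\<close>, where
  \<open>h m\<close> is the total weight of the integer partitions of \<open>m\<close> and \<open>A r\<close> that of the families of
  size \<open>r\<close> which avoid the origin (\<open>total_weight_at_origin\<close>). Removing one part from a family
  gives a recurrence (\<open>total_weight_recurrence\<close>) which says that \<open>\<Sum>r. A r z\<^sup>r\<close> is the exponential
  of \<open>\<Sum>j. b j z\<^sup>j\<close> with \<open>b j = j\<^sup>\<gamma>\<^sup>-\<^sup>1 \<Sum>x\<noteq>0. exp (- j V (x / L))\<close>. So, up to normalization, \<open>A\<close> is the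
  law of a compound Poisson variable \<open>R = \<Sum>j. j N\<^sub>j\<close> whose \<open>N\<^sub>j\<close> are independent Poisson variables of
  mean \<open>b j\<close>, and \<open>n - H\<^sub>0\<close> has the law of \<open>R\<close> tilted by the density \<open>h (n - R)\<close>.

  Without the tilt there is a central limit theorem for \<open>R\<close>. Its mean \<open>\<Sum>j. j b j\<close> is exactly
  \<open>\<rho>\<^sub>c\<^sup>L L\<^sup>d\<close>. Its variance is \<open>\<Sum>j. j\<^sup>2 b j = \<Sum>x\<noteq>0. \<Sum>j. j\<^sup>\<gamma>\<^sup>+\<^sup>1 exp (- j V (x / L))\<close>; as the inner sum is
  asymptotic to \<open>\<Gamma>(\<gamma> + 2) V (x / L)\<^sup>-\<^sup>\<gamma>\<^sup>-\<^sup>2\<close> and \<open>d < \<delta> (\<gamma> + 2)\<close> makes the sum over the sites converge,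
  the variance is \<open>L\<^sup>\<delta>\<^sup>(\<^sup>\<gamma>\<^sup>+\<^sup>2\<^sup>)\<close> times the constant of the theorem, in the limit
  (\<open>lattice_moment_lim\<close>). The third cumulant has order \<open>L\<^sup>\<delta>\<^sup>(\<^sup>\<gamma>\<^sup>+\<^sup>3\<^sup>)\<close>, which is negligible against the
  third power of the standard deviation because \<open>\<gamma> > 0\<close>.

  The tilt is asymptotically constant. The recurrence for \<open>h\<close> shows that \<open>h\<close> increases, and slowly:
  \<open>h (m + 1) / h m \<le> 1 + C m\<^sup>-\<^sup>\<beta>\<close> with \<open>\<beta> = 1 / (1 + \<gamma>)\<close> (\<open>weight_increment_le\<close>). Since \<open>\<rho> > \<rho>\<^sub>c\<close>, the typical
  argument of \<open>h\<close> has order \<open>L\<^sup>d\<close> (\<open>eventually_mass_below_density\<close>), so a deviation \<open>Y\<close> of \<open>R\<close> from its mean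
  changes the density by a factor of at most \<open>exp (\<alpha> \<bar>Y\<bar>)\<close> with \<open>\<alpha>\<close> of order \<open>L\<^sup>-\<^sup>d\<^sup>\<beta>\<close>. The lower bound
  on \<open>d / \<delta>\<close> says precisely that \<open>\<alpha>\<close> times the standard deviation of \<open>R\<close> tends to \<open>0\<close>. Large
  deviations cause no trouble: for large \<open>R\<close> the density is at most \<open>1\<close> after normalization, and for small \<open>R\<close>
  the exponential moments \<open>E exp (\<alpha> (E R - R))\<close> are at most \<open>exp (\<alpha>\<^sup>2 Var R / 2)\<close> because all jumps of \<open>R\<close>
  are positive. Thus the normalized density tends to \<open>1\<close> in mean
  (\<open>density_ratio_bound\<close>, \<open>law_exp_deviation\<close>), the characteristic functions with and without tilt have the
  same limit, and the continuity theorem of Levy concludes.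
\<close>

section \<open>Weights of families and the removal of a part\<close>

definition families :: "(int ^ 'd) set \<Rightarrow> nat \<Rightarrow> 'd::finite spatial_family set" where
  "families S n = {l \<in> spatial_partitions n. occupied l \<subseteq> S}"

text \<open>
  The weight of a family for arbitrary rates \<open>u x j\<close>: up to the factor \<open>exp (- \<Sum> u)\<close>, the probability
  that independent Poisson variables of mean \<open>u x j\<close> take the values \<open>part_mult x j l\<close>.
\<close>
definition poisson_weight :: "(int ^ 'd \<Rightarrow> nat \<Rightarrow> real) \<Rightarrow> 'd::finite spatial_family \<Rightarrow> real" where
  "poisson_weight u l = (\<Prod>x\<in>occupied l. \<Prod>j\<in>set_mset (l x).
     1 / fact (part_mult x j l) * u x j ^ part_mult x j l)"

text \<open>
  The value is an extended nonnegative real, so that sums over families, sites and parts may be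
  exchanged before any of them is known to be finite.
\<close>
definition total_weight :: "(int ^ 'd \<Rightarrow> nat \<Rightarrow> real) \<Rightarrow> (int ^ 'd::finite) set \<Rightarrow> nat \<Rightarrow> ennreal" where
  "total_weight u S n = (\<integral>\<^sup>+l. ennreal (poisson_weight u l) \<partial>count_space (families S n))"

definition add_part :: "int ^ 'd \<Rightarrow> nat \<Rightarrow> 'd::finite spatial_family \<Rightarrow> 'd spatial_family" where
  "add_part x j l = l(x := add_mset j (l x))"

lemma occupied_iff: "x \<in> occupied l \<longleftrightarrow> l x \<noteq> {#}"
  by (simp add: occupied_def)

text \<open>
  Weights and sizes of two families with different supports can be compared factor by factor once both are
  written over one common finite index set; indices outside the support contribute \<open>1\<close> and \<open>0\<close>.
\<close>
lemma poisson_weight_superset: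
  assumes "finite X" "finite J" "occupied l \<subseteq> X" "\<And>x. set_mset (l x) \<subseteq> J"
  shows "poisson_weight u l = (\<Prod>(x,j)\<in>X \<times> J. u x j ^ count (l x) j / fact (count (l x) j))"
proof -
  have "poisson_weight u l = (\<Prod>x\<in>occupied l. \<Prod>j\<in>J. u x j ^ count (l x) j / fact (count (l x) j))"
    unfolding poisson_weight_def part_mult_def
    by (intro prod.cong refl prod.mono_neutral_cong_left)
       (use assms in \<open>auto simp: not_in_iff\<close>)
  also have "\<dots> = (\<Prod>x\<in>X. \<Prod>j\<in>J. u x j ^ count (l x) j / fact (count (l x) j))"
    by (intro prod.mono_neutral_left) (use assms in \<open>auto simp: occupied_iff\<close>)
  finally show ?thesis by (simp add: prod.cartesian_product)
qed

lemma size_superset: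
  assumes "finite X" "finite J" "occupied l \<subseteq> X" "\<And>x. set_mset (l x) \<subseteq> J"
  shows "(\<Sum>x\<in>occupied l. occupation x l) = (\<Sum>(x,j)\<in>X \<times> J. j * count (l x) j)"
proof -
  have "(\<Sum>x\<in>occupied l. occupation x l) = (\<Sum>x\<in>occupied l. \<Sum>j\<in>J. j * count (l x) j)"
    unfolding occupation_def part_mult_def
    by (intro sum.cong refl sum.mono_neutral_left)
       (use assms in \<open>auto simp: not_in_iff\<close>)
  also have "\<dots> = (\<Sum>x\<in>X. \<Sum>j\<in>J. j * count (l x) j)"
    by (intro sum.mono_neutral_left) (use assms in \<open>auto simp: occupied_iff\<close>)
  finally show ?thesis by (simp add: sum.cartesian_product)
qed

lemma finite_frame:
  assumes "finite (occupied l)"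
  obtains X J where "finite X" "finite J" "occupied l \<subseteq> X" "\<And>x. set_mset (l x) \<subseteq> J" "x0 \<in> X" "j0 \<in> J"
proof
  show "finite (insert x0 (occupied l))" "finite (insert j0 (\<Union>x\<in>occupied l. set_mset (l x)))"
    using assms by auto
  show "set_mset (l x) \<subseteq> insert j0 (\<Union>x\<in>occupied l. set_mset (l x))" for x
    by (cases "x \<in> occupied l") (auto simp: occupied_iff)
qed auto

lemma occupied_add_part: "occupied (add_part x j l) = insert x (occupied l)"
  by (auto simp: occupied_def add_part_def)

lemma add_part_frame:
  assumes "\<And>x. set_mset (l x) \<subseteq> J" "j0 \<in> J"
  shows "set_mset (add_part x0 j0 l x) \<subseteq> J"
  using assms by (auto simp: add_part_def)

lemma count_add_part: "count (add_part x j l y) i = (if y = x \<and> i = j then Suc (count (l y) i) else count (l y) i)"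
  by (auto simp: add_part_def)

text \<open>
  The Poisson weights satisfy \<open>(r + 1) u\<^sup>r\<^sup>+\<^sup>1 / (r + 1)! = u (u\<^sup>r / r!)\<close>, and adding a part changes
  one multiplicity only.
\<close>
lemma poisson_weight_add_part:
  assumes "finite (occupied l)"
  shows "real (Suc (count (l x) j)) * poisson_weight u (add_part x j l) = u x j * poisson_weight u l"
proof -
  obtain X J where XJ: "finite X" "finite J" "occupied l \<subseteq> X" "\<And>x. set_mset (l x) \<subseteq> J" "x \<in> X" "j \<in> J"
    using finite_frame[OF assms] by metis
  let ?R = "\<Prod>(y,i)\<in>X \<times> J - {(x,j)}. u y i ^ count (l y) i / fact (count (l y) i)"
  have "poisson_weight u (add_part x j l)
      = (\<Prod>(y,i)\<in>X \<times> J. u y i ^ count (add_part x j l y) i / fact (count (add_part x j l y) i))"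
    using XJ by (intro poisson_weight_superset) (auto simp: occupied_add_part add_part_frame)
  also have "\<dots> = u x j ^ Suc (count (l x) j) / fact (Suc (count (l x) j)) * ?R"
  proof -
    have "(\<Prod>(y,i)\<in>X \<times> J - {(x,j)}. u y i ^ count (add_part x j l y) i / fact (count (add_part x j l y) i)) = ?R"
      by (rule prod.cong[OF refl]) (auto simp: count_add_part split: if_splits)
    then show ?thesis using XJ
      by (subst prod.remove[of _ "(x,j)"]) (simp_all add: count_add_part)
  qed
  also have "real (Suc (count (l x) j)) * \<dots> = u x j * (u x j ^ count (l x) j / fact (count (l x) j) * ?R)"
  proof -
    have "real (Suc k) * (u x j ^ Suc k / fact (Suc k) * R) = u x j * (u x j ^ k / fact k * R)" for k R
      by (simp add: field_simps del: of_nat_Suc)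
    then show ?thesis .
  qed
  also have "u x j ^ count (l x) j / fact (count (l x) j) * ?R
      = (\<Prod>(y,i)\<in>X \<times> J. u y i ^ count (l y) i / fact (count (l y) i))"
    by (subst (2) prod.remove[of _ "(x,j)"]) (use XJ in auto)
  also have "\<dots> = poisson_weight u l"
    using XJ by (intro poisson_weight_superset[symmetric]) auto
  finally show ?thesis .
qed

lemma size_add_part:
  assumes "finite (occupied l)"
  shows "(\<Sum>y\<in>occupied (add_part x j l). occupation y (add_part x j l))
     = j + (\<Sum>y\<in>occupied l. occupation y l)"
proof -
  obtain X J where XJ: "finite X" "finite J" "occupied l \<subseteq> X" "\<And>x. set_mset (l x) \<subseteq> J" "x \<in> X" "j \<in> J"
    using finite_frame[OF assms] by metis
  have "(\<Sum>y\<in>occupied (add_part x j l). occupation y (add_part x j l))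
      = (\<Sum>(y,i)\<in>X \<times> J. i * count (add_part x j l y) i)"
    using XJ by (intro size_superset) (auto simp: occupied_add_part add_part_frame)
  also have "\<dots> = j * Suc (count (l x) j) + (\<Sum>(y,i)\<in>X \<times> J - {(x,j)}. i * count (l y) i)"
  proof -
    have "(\<Sum>(y,i)\<in>X \<times> J - {(x,j)}. i * count (add_part x j l y) i) = (\<Sum>(y,i)\<in>X \<times> J - {(x,j)}. i * count (l y) i)"
      by (rule sum.cong[OF refl]) (auto simp: count_add_part split: if_splits)
    then show ?thesis using XJ
      by (subst sum.remove[of _ "(x,j)"]) (simp_all add: count_add_part)
  qed
  also have "\<dots> = j + (\<Sum>(y,i)\<in>X \<times> J. i * count (l y) i)"
    by (subst (2) sum.remove[of _ "(x,j)"]) (use XJ in auto)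
  also have "(\<Sum>(y,i)\<in>X \<times> J. i * count (l y) i) = (\<Sum>y\<in>occupied l. occupation y l)"
    using XJ by (intro size_superset[symmetric]) auto
  finally show ?thesis .
qed

lemma bij_betw_add_part:
  assumes "x \<in> S" "j \<ge> 1"
  shows "bij_betw (add_part x j) (families S n) {l \<in> families S (n + j). j \<in># l x}"
proof (rule bij_betw_byWitness[where f' = "\<lambda>l. l(x := l x - {#j#})"])
  show "\<forall>l\<in>families S n. (add_part x j l)(x := add_part x j l x - {#j#}) = l"
    by (auto simp: add_part_def)
  show "\<forall>l\<in>{l \<in> families S (n + j). j \<in># l x}. add_part x j (l(x := l x - {#j#})) = l"
    by (auto simp: add_part_def)
  show "add_part x j ` families S n \<subseteq> {l \<in> families S (n + j). j \<in># l x}"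
  proof safe
    fix l :: "'a spatial_family" assume l: "l \<in> families S n"
    then have "finite (occupied l)" by (auto simp: families_def spatial_partitions_def)
    from size_add_part[OF this] l assms
    show "add_part x j l \<in> families S (n + j)"
      by (auto simp: families_def spatial_partitions_def occupied_add_part) (auto simp: add_part_def split: if_splits)
    show "j \<in># add_part x j l x" by (simp add: add_part_def)
  qed
  show "(\<lambda>l. l(x := l x - {#j#})) ` {l \<in> families S (n + j). j \<in># l x} \<subseteq> families S n"
  proof safe
    fix l :: "'a spatial_family" assume l: "l \<in> families S (n + j)" "j \<in># l x"
    let ?l = "l(x := l x - {#j#})"
    have eq: "add_part x j ?l = l" using l by (auto simp: add_part_def)
    have sub: "occupied ?l \<subseteq> occupied l" by (auto simp: occupied_def)
    then have fin: "finite (occupied ?l)" using l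
      by (auto simp: families_def spatial_partitions_def intro: finite_subset)
    have "0 \<notin># ?l y" for y using l by (auto simp: families_def spatial_partitions_def dest: in_diffD)
    moreover have "(\<Sum>y\<in>occupied ?l. occupation y ?l) = n"
      using size_add_part[OF fin, of x j] l unfolding eq by (auto simp: families_def spatial_partitions_def)
    ultimately show "?l \<in> families S n" using fin sub l
      by (auto simp: families_def spatial_partitions_def)
  qed
qed

lemma nn_integral_count_space_UNIV:
  "(\<integral>\<^sup>+x. h x \<partial>count_space C) = (\<integral>\<^sup>+x. h x * indicator C x \<partial>count_space UNIV)"
  by (simp add: nn_integral_restrict_space[symmetric] restrict_count_space)

lemma nn_integral_count_space_swap:
  "(\<integral>\<^sup>+x. \<integral>\<^sup>+y. f x y \<partial>count_space B \<partial>count_space A) = (\<integral>\<^sup>+y. \<integral>\<^sup>+x. f x y \<partial>count_space A \<partial>count_space B)"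
proof -
  define g where "g p = f (fst p) (snd p) * indicator A (fst p) * indicator B (snd p)" for p
  have "(\<integral>\<^sup>+x. \<integral>\<^sup>+y. f x y \<partial>count_space B \<partial>count_space A)
      = (\<integral>\<^sup>+x. (\<integral>\<^sup>+y. f x y * indicator B y \<partial>count_space UNIV) * indicator A x \<partial>count_space UNIV)"
    by (simp only: nn_integral_count_space_UNIV[where C=A] nn_integral_count_space_UNIV[where C=B])
  also have "\<dots> = (\<integral>\<^sup>+x. \<integral>\<^sup>+y. g (x,y) \<partial>count_space UNIV \<partial>count_space UNIV)"
    unfolding g_def
    by (subst nn_integral_multc[symmetric]) (simp_all only: fst_conv snd_conv mult.assoc mult.commute[of "indicator A _" "indicator B _"] borel_measurable_count_space)
  finally have 1: "(\<integral>\<^sup>+x. \<integral>\<^sup>+y. f x y \<partial>count_space B \<partial>count_space A) = \<dots>" .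
  have "(\<integral>\<^sup>+y. \<integral>\<^sup>+x. f x y \<partial>count_space A \<partial>count_space B)
      = (\<integral>\<^sup>+y. (\<integral>\<^sup>+x. f x y * indicator A x \<partial>count_space UNIV) * indicator B y \<partial>count_space UNIV)"
    by (simp only: nn_integral_count_space_UNIV[where C=A] nn_integral_count_space_UNIV[where C=B])
  also have "\<dots> = (\<integral>\<^sup>+y. \<integral>\<^sup>+x. g (x,y) \<partial>count_space UNIV \<partial>count_space UNIV)"
    unfolding g_def by (subst nn_integral_multc[symmetric]) simp_all
  finally have 2: "(\<integral>\<^sup>+y. \<integral>\<^sup>+x. f x y \<partial>count_space A \<partial>count_space B) = \<dots>" .
  show ?thesis unfolding 1 2 nn_integral_fst_count_space nn_integral_snd_count_space ..
qed

lemma nn_integral_count_space_times: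
  "(\<integral>\<^sup>+p. f (fst p) * g (snd p) \<partial>count_space (A \<times> B))
     = (\<integral>\<^sup>+x. f x \<partial>count_space A) * (\<integral>\<^sup>+y. g y \<partial>count_space B)"
proof -
  have "(\<integral>\<^sup>+p. f (fst p) * g (snd p) \<partial>count_space (A \<times> B))
    = (\<integral>\<^sup>+p. (f (fst p) * indicator A (fst p)) * (g (snd p) * indicator B (snd p)) \<partial>count_space UNIV)"
    by (subst nn_integral_count_space_UNIV)
       (auto intro!: nn_integral_cong simp: indicator_def split: if_splits)
  also have "\<dots> = (\<integral>\<^sup>+x. f x * indicator A x \<partial>count_space UNIV) * (\<integral>\<^sup>+y. g y * indicator B y \<partial>count_space UNIV)"
    by (subst nn_integral_fst_count_space[symmetric]) (simp add: nn_integral_cmult nn_integral_multc)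
  also have "\<dots> = (\<integral>\<^sup>+x. f x \<partial>count_space A) * (\<integral>\<^sup>+y. g y \<partial>count_space B)"
    by (simp only: nn_integral_count_space_UNIV[where C=A] nn_integral_count_space_UNIV[where C=B])
  finally show ?thesis .
qed

lemma poisson_weight_nonneg: "(\<And>x j. u x j \<ge> 0) \<Longrightarrow> poisson_weight u l \<ge> 0"
  by (auto simp: poisson_weight_def intro!: prod_nonneg)

lemma families_part_le:
  assumes "l \<in> families S n" "j \<in># l x"
  shows "j \<in> {1..n}"
proof -
  have fin: "finite (occupied l)" and n: "(\<Sum>x\<in>occupied l. occupation x l) = n" and x: "x \<in> occupied l"
    and "j \<noteq> 0"
    using assms by (auto simp: families_def spatial_partitions_def occupied_iff intro: ccontr)
  have "j \<le> j * count (l x) j" using assms(2) by (simp add: Suc_leI)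
  also have "\<dots> \<le> occupation x l"
    unfolding occupation_def part_mult_def using assms(2) by (intro member_le_sum) auto
  also have "\<dots> \<le> n" using fin x n by (metis member_le_sum zero_le)
  finally show ?thesis using \<open>j \<noteq> 0\<close> by auto
qed

text \<open>
  Both sides are the sum of \<open>j * count (l x) j\<close> times the weight over all families \<open>l\<close> of size \<open>n\<close>, all sites and
  all parts. For a fixed family the multiplicities add up to its size, which gives the left side. For fixed \<open>x\<close> and
  \<open>j\<close>, removing a part \<open>j\<close> at \<open>x\<close> is a bijection onto the families of size \<open>n - j\<close> which turns the factor
  \<open>count (l x) j\<close> into \<open>u x j\<close>, which gives the right side.
\<close>
lemma total_weight_recurrence:
  fixes u :: "int ^ 'd::finite \<Rightarrow> nat \<Rightarrow> real"
  assumes u: "\<And>x j. u x j \<ge> 0"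
  shows "of_nat n * total_weight u S n =
    (\<Sum>j\<in>{1..n}. (\<integral>\<^sup>+x. ennreal (real j * u x j) \<partial>count_space S) * total_weight u S (n - j))"
proof -
  let ?w = "poisson_weight u"
  note w = poisson_weight_nonneg[of u, OF u]
  define f where "f l x j = ennreal (real j * real (count (l x) j) * ?w l)" for l :: "'d spatial_family" and x j
  have pt: "of_nat n * ennreal (?w l) = (\<Sum>j\<in>{1..n}. \<integral>\<^sup>+x. f l x j \<partial>count_space S)"
    if l: "l \<in> families S n" for l
  proof -
    have fin: "finite (occupied l)" "occupied l \<subseteq> S" using l by (auto simp: families_def spatial_partitions_def)
    have "n = (\<Sum>(x,j)\<in>occupied l \<times> {1..n}. j * count (l x) j)"
    proof -
      have "set_mset (l x) \<subseteq> {1..n}" for x using families_part_le[OF l] by blast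
      then have "(\<Sum>x\<in>occupied l. occupation x l) = (\<Sum>(x,j)\<in>occupied l \<times> {1..n}. j * count (l x) j)"
        using fin by (intro size_superset) auto
      then show ?thesis using l by (simp add: families_def spatial_partitions_def)
    qed
    also have "\<dots> = (\<Sum>j\<in>{1..n}. \<Sum>x\<in>occupied l. j * count (l x) j)"
      by (subst sum.swap) (simp add: sum.cartesian_product)
    finally have "real n = real (\<Sum>j\<in>{1..n}. \<Sum>x\<in>occupied l. j * count (l x) j)" by simp
    then have "real n = (\<Sum>j\<in>{1..n}. \<Sum>x\<in>occupied l. real j * real (count (l x) j))"
      by (simp only: of_nat_sum of_nat_mult)
    then have "ennreal (real n * ?w l) = ennreal (\<Sum>j\<in>{1..n}. \<Sum>x\<in>occupied l. real j * real (count (l x) j) * ?w l)"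
      by (simp only: sum_distrib_right)
    also have "\<dots> = (\<Sum>j\<in>{1..n}. \<Sum>x\<in>occupied l. f l x j)"
      unfolding f_def by (simp add: sum_ennreal sum_nonneg w)
    also have "\<dots> = (\<Sum>j\<in>{1..n}. \<integral>\<^sup>+x. f l x j \<partial>count_space S)"
      by (intro sum.cong refl nn_integral_count_space'[symmetric])
         (use fin in \<open>auto simp: f_def occupied_iff\<close>)
    finally show ?thesis by (simp add: ennreal_mult w ennreal_of_nat_eq_real_of_nat)
  qed
  have inner: "(\<integral>\<^sup>+l. f l x j \<partial>count_space (families S n)) = ennreal (real j * u x j) * total_weight u S (n - j)"
    if x: "x \<in> S" and j: "j \<in> {1..n}" for x j
  proof -
    have "(\<integral>\<^sup>+l. f l x j \<partial>count_space (families S n))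
        = (\<integral>\<^sup>+l. f l x j \<partial>count_space {l \<in> families S n. j \<in># l x})"
      by (rule nn_integral_count_space_eq) (auto simp: f_def not_in_iff)
    also have "\<dots> = (\<integral>\<^sup>+l. f (add_part x j l) x j \<partial>count_space (families S (n - j)))"
      using bij_betw_add_part[OF x, of j "n - j"] j
      by (intro nn_integral_bij_count_space[symmetric]) auto
    also have "\<dots> = (\<integral>\<^sup>+l. ennreal (real j * u x j) * ennreal (?w l) \<partial>count_space (families S (n - j)))"
    proof (intro nn_integral_cong)
      fix l assume "l \<in> space (count_space (families S (n - j)))"
      then have "finite (occupied l)" by (auto simp: families_def spatial_partitions_def)
      from poisson_weight_add_part[OF this, of x j u]
      show "f (add_part x j l) x j = ennreal (real j * u x j) * ennreal (?w l)"
        using u w by (simp add: f_def count_add_part ennreal_mult[symmetric] mult.assoc del: of_nat_Suc)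
    qed
    also have "\<dots> = ennreal (real j * u x j) * total_weight u S (n - j)"
      unfolding total_weight_def by (rule nn_integral_cmult) simp
    finally show ?thesis .
  qed
  have "of_nat n * total_weight u S n = (\<integral>\<^sup>+l. of_nat n * ennreal (?w l) \<partial>count_space (families S n))"
    unfolding total_weight_def by (rule nn_integral_cmult[symmetric]) simp
  also have "\<dots> = (\<integral>\<^sup>+l. (\<Sum>j\<in>{1..n}. \<integral>\<^sup>+x. f l x j \<partial>count_space S) \<partial>count_space (families S n))"
    by (intro nn_integral_cong) (simp add: pt)
  also have "\<dots> = (\<Sum>j\<in>{1..n}. \<integral>\<^sup>+l. \<integral>\<^sup>+x. f l x j \<partial>count_space S \<partial>count_space (families S n))"
    by (rule nn_integral_sum) simp
  also have "\<dots> = (\<Sum>j\<in>{1..n}. \<integral>\<^sup>+x. ennreal (real j * u x j) * total_weight u S (n - j) \<partial>count_space S)"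
    by (subst nn_integral_count_space_swap, intro sum.cong refl nn_integral_cong) (simp add: inner)
  also have "\<dots> = (\<Sum>j\<in>{1..n}. (\<integral>\<^sup>+x. ennreal (real j * u x j) \<partial>count_space S) * total_weight u S (n - j))"
    by (intro sum.cong refl nn_integral_multc) simp
  finally show ?thesis .
qed

lemma families_0: "families S 0 = {\<lambda>_. {#}}"
proof -
  have "l = (\<lambda>_. {#})" if "l \<in> families S 0" for l
    using families_part_le[OF that] by (intro ext) (metis atLeastAtMost_iff multiset_nonemptyE not_one_le_zero order_trans)
  then show ?thesis by (auto simp: families_def spatial_partitions_def occupied_def)
qed

lemma total_weight_0: "total_weight u S 0 = 1"
  by (simp add: total_weight_def families_0 nn_integral_count_space_finite poisson_weight_def occupied_def)

text \<open>
  A family is the same as its partition at the origin together with its restriction to the other sites, and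
  weights multiply while sizes add.
\<close>
lemma total_weight_at_origin:
  fixes u :: "int ^ 'd::finite \<Rightarrow> nat \<Rightarrow> real"
  assumes u: "\<And>x j. u x j \<ge> 0" and "m \<le> n"
  shows "(\<integral>\<^sup>+l. ennreal (poisson_weight u l) \<partial>count_space {l \<in> spatial_partitions n. occupation 0 l = m})
     = total_weight u {0} m * total_weight u (- {0}) (n - m)"
proof -
  let ?w = "poisson_weight u"
  note w = poisson_weight_nonneg[of u, OF u]
  define g :: "'d spatial_family \<times> 'd spatial_family \<Rightarrow> 'd spatial_family"
    where "g p = (snd p)(0 := fst p 0)" for p
  let ?A = "families {0 :: int ^ 'd} m" and ?B = "families (- {0 :: int ^ 'd}) (n - m)"
  have occ0: "occupation 0 l1 = m" if "l1 \<in> ?A" for l1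
  proof -
    have "occupied l1 \<subseteq> {0}" using that by (auto simp: families_def)
    have "m = (\<Sum>x\<in>occupied l1. occupation x l1)"
      using that by (auto simp: families_def spatial_partitions_def)
    also have "(\<Sum>x\<in>occupied l1. occupation x l1) = (\<Sum>x\<in>{0}. occupation x l1)"
      using \<open>occupied l1 \<subseteq> {0}\<close> by (intro sum.mono_neutral_left) (auto simp: occupied_iff occupation_def)
    finally show ?thesis by simp
  qed
  have g: "occupied (g (l1, l2)) = occupied l1 \<union> occupied l2"
          "occupied l1 \<inter> occupied l2 = {}" "x \<in> occupied l1 \<Longrightarrow> g (l1, l2) x = l1 x"
          "x \<in> occupied l2 \<Longrightarrow> g (l1, l2) x = l2 x" "finite (occupied l1)" "finite (occupied l2)"
    if "l1 \<in> ?A" "l2 \<in> ?B" for l1 l2 x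
    using that by (auto simp: g_def families_def occupied_def spatial_partitions_def)
  have gw: "?w (g (l1, l2)) = ?w l1 * ?w l2" if "l1 \<in> ?A" "l2 \<in> ?B" for l1 l2
    unfolding poisson_weight_def part_mult_def using g[OF that]
    by (simp add: prod.union_disjoint)
  have gs: "(\<Sum>x\<in>occupied (g (l1, l2)). occupation x (g (l1, l2))) = n" if "l1 \<in> ?A" "l2 \<in> ?B" for l1 l2
    using g[OF that] that \<open>m \<le> n\<close>
    by (simp add: sum.union_disjoint occupation_def part_mult_def families_def spatial_partitions_def)
  have bij: "bij_betw g (?A \<times> ?B) {l \<in> spatial_partitions n. occupation 0 l = m}"
  proof (rule bij_betw_byWitness[where f' = "\<lambda>l. ((\<lambda>x. if x = 0 then l 0 else {#}), l(0 := {#}))"])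
    show "\<forall>p\<in>?A \<times> ?B. ((\<lambda>x. if x = 0 then g p 0 else {#}), (g p)(0 := {#})) = p"
      by (auto simp: g_def families_def occupied_def fun_eq_iff)
    show "\<forall>l\<in>{l \<in> spatial_partitions n. occupation 0 l = m}.
       g ((\<lambda>x. if x = 0 then l 0 else {#}), l(0 := {#})) = l"
      by (auto simp: g_def)
    show "g ` (?A \<times> ?B) \<subseteq> {l \<in> spatial_partitions n. occupation 0 l = m}"
    proof safe
      fix l1 l2 assume l: "l1 \<in> ?A" "l2 \<in> ?B"
      show "occupation 0 (g (l1, l2)) = m"
        using occ0[OF l(1)] by (simp add: g_def occupation_def part_mult_def)
      show "g (l1, l2) \<in> spatial_partitions n"
        using gs[OF l] g(1,5,6)[OF l] l by (auto simp: spatial_partitions_def families_def g_def)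
    qed
    show "(\<lambda>l. ((\<lambda>x. if x = 0 then l 0 else {#}), l(0 := {#}))) ` {l \<in> spatial_partitions n. occupation 0 l = m}
       \<subseteq> ?A \<times> ?B"
    proof safe
      fix l :: "'d spatial_family" assume l: "l \<in> spatial_partitions n" "m = occupation 0 l"
      let ?l1 = "\<lambda>x :: int ^ 'd. if x = 0 then l 0 else {#}" and ?l2 = "l(0 := {#})"
      have o1: "occupied ?l1 \<subseteq> {0}" by (auto simp: occupied_def)
      have o2: "occupied ?l2 = occupied l - {0}" by (auto simp: occupied_def)
      have "(\<Sum>x\<in>occupied ?l1. occupation x ?l1) = (\<Sum>x\<in>{0}. occupation x ?l1)"
        by (intro sum.mono_neutral_left) (auto simp: occupied_def occupation_def)
      then have s1: "(\<Sum>x\<in>occupied ?l1. occupation x ?l1) = occupation 0 l"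
        by (simp add: occupation_def part_mult_def)
      have "n = (\<Sum>x\<in>insert 0 (occupied l). occupation x l)"
        using l by (auto simp: spatial_partitions_def occupied_def occupation_def sum.insert_if)
      also have "\<dots> = occupation 0 l + (\<Sum>x\<in>occupied l - {0}. occupation x l)"
        using l by (subst sum.insert_remove) (auto simp: spatial_partitions_def)
      also have "(\<Sum>x\<in>occupied l - {0}. occupation x l) = (\<Sum>x\<in>occupied ?l2. occupation x ?l2)"
        unfolding o2 by (intro sum.cong) (auto simp: occupation_def part_mult_def)
      finally have s2: "(\<Sum>x\<in>occupied ?l2. occupation x ?l2) = n - occupation 0 l" by simp
      show "?l1 \<in> families {0} (occupation 0 l)"
        using l o1 s1 finite_subset[OF o1] by (auto simp: families_def spatial_partitions_def)
      show "?l2 \<in> families (- {0}) (n - occupation 0 l)"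
        using l o2 s2 by (auto simp: families_def spatial_partitions_def)
    qed
  qed
  have "(\<integral>\<^sup>+l. ennreal (?w l) \<partial>count_space {l \<in> spatial_partitions n. occupation 0 l = m})
      = (\<integral>\<^sup>+p. ennreal (?w (g p)) \<partial>count_space (?A \<times> ?B))"
    by (rule nn_integral_bij_count_space[OF bij, symmetric])
  also have "\<dots> = (\<integral>\<^sup>+p. ennreal (?w (fst p)) * ennreal (?w (snd p)) \<partial>count_space (?A \<times> ?B))"
    by (intro nn_integral_cong) (auto simp: gw ennreal_mult w)
  also have "\<dots> = total_weight u {0} m * total_weight u (- {0}) (n - m)"
    unfolding total_weight_def by (rule nn_integral_count_space_times)
  finally show ?thesis .
qed

section \<open>Power series with an exponential generating function\<close>

text \<open>
  Cauchy products of absolutely convergent series, iterated. The case \<open>z = 1\<close> is needed separately because it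
  supplies the absolute convergence for all other \<open>z\<close>.
\<close>
lemma sums_fps_power:
  fixes b :: "nat \<Rightarrow> real" and z :: complex
  assumes b: "\<And>n. b n \<ge> 0" "summable b" and z: "norm z \<le> 1"
  shows "fps_nth (Abs_fps b ^ k) n \<ge> 0"
    and "(\<lambda>n. fps_nth (Abs_fps b ^ k) n) sums (\<Sum>n. b n) ^ k"
    and "(\<lambda>n. of_real (fps_nth (Abs_fps b ^ k) n) * z ^ n) sums (\<Sum>n. of_real (b n) * z ^ n) ^ k"
proof -
  let ?p = "\<lambda>k n. fps_nth (Abs_fps b ^ k) n"
  have p_Suc: "?p (Suc k) n = (\<Sum>i\<le>n. b i * ?p k (n - i))" for k n
    by (simp add: fps_mult_nth atLeast0AtMost)
  have nonneg: "?p k n \<ge> 0" for k n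
  proof (induction k arbitrary: n)
    case (Suc k)
    then show ?case unfolding p_Suc using b by (auto intro!: sum_nonneg)
  qed simp
  have zle: "norm (of_real c * z ^ n) \<le> c" if "c \<ge> 0" for c n
    using that z by (simp add: norm_mult norm_power mult_left_le power_le_one)
  have real: "?p k sums (\<Sum>n. b n) ^ k" for k
  proof (induction k)
    case 0
    show ?case using sums_single[of 0 "\<lambda>_. 1::real"] by (simp add: if_distrib cong: if_cong)
  next
    case (Suc k)
    have "(\<lambda>n. \<Sum>i\<le>n. b i * ?p k (n - i)) sums ((\<Sum>n. b n) * (\<Sum>n. ?p k n))"
      using b Suc nonneg by (intro Cauchy_product_sums) (auto simp: sums_iff)
    also have "(\<lambda>n. \<Sum>i\<le>n. b i * ?p k (n - i)) = ?p (Suc k)" by (simp only: p_Suc)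
    finally show ?case using Suc by (simp add: sums_iff)
  qed
  have "(\<lambda>n. of_real (?p k n) * z ^ n) sums (\<Sum>n. of_real (b n) * z ^ n) ^ k" for k
  proof (induction k)
    case 0
    have "(\<lambda>n. of_real (?p 0 n) * z ^ n) = (\<lambda>n. if n = 0 then 1 else 0)" by (auto simp: fun_eq_iff)
    then show ?case using sums_single[of 0 "\<lambda>_. 1::complex"] by simp
  next
    case (Suc k)
    have "summable (\<lambda>n. norm (of_real (b n) * z ^ n))"
      by (rule summable_comparison_test'[of b 0]) (use b zle in auto)
    moreover have "summable (\<lambda>n. norm (of_real (?p k n) * z ^ n))"
      by (rule summable_comparison_test'[of "?p k" 0]) (use nonneg zle real[of k] in \<open>auto simp: sums_iff\<close>)
    ultimately have "(\<lambda>n. \<Sum>i\<le>n. (of_real (b i) * z ^ i) * (of_real (?p k (n - i)) * z ^ (n - i)))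
       sums ((\<Sum>n. of_real (b n) * z ^ n) * (\<Sum>n. of_real (?p k n) * z ^ n))"
      by (rule Cauchy_product_sums)
    also have "(\<lambda>n. \<Sum>i\<le>n. (of_real (b i) * z ^ i) * (of_real (?p k (n - i)) * z ^ (n - i)))
      = (\<lambda>n. of_real (?p (Suc k) n) * z ^ n)"
    proof
      fix n
      have "(of_real (b i) * z ^ i) * (of_real (?p k (n - i)) * z ^ (n - i)) = of_real (b i * ?p k (n - i)) * z ^ n"
        if "i \<le> n" for i
        using that by (simp add: power_add[symmetric] mult_ac flip: power_add)
      then show "(\<Sum>i\<le>n. (of_real (b i) * z ^ i) * (of_real (?p k (n - i)) * z ^ (n - i))) = of_real (?p (Suc k) n) * z ^ n"
        by (simp add: p_Suc sum_distrib_right del: of_real_mult power_Suc)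
    qed
    finally show ?case using Suc by (simp add: sums_iff)
  qed
  then show "fps_nth (Abs_fps b ^ k) n \<ge> 0"
    and "(\<lambda>n. fps_nth (Abs_fps b ^ k) n) sums (\<Sum>n. b n) ^ k"
    and "(\<lambda>n. of_real (fps_nth (Abs_fps b ^ k) n) * z ^ n) sums (\<Sum>n. of_real (b n) * z ^ n) ^ k"
    using nonneg real by auto
qed

text \<open>
  The recurrence is the coefficientwise form of the differential equation \<open>F' = F B'\<close>, which
  \<open>F = exp B\<close> satisfies and which determines \<open>F\<close> from its constant term.
\<close>
lemma exponential_coefficients:
  fixes a b :: "nat \<Rightarrow> real"
  assumes a0: "a 0 = 1" and b0: "b 0 = 0"
    and rec: "\<And>n. real n * a n = (\<Sum>j\<in>{1..n}. real j * b j * a (n - j))"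
  shows "a n = fps_nth (fps_exp 1 oo Abs_fps b) n"
proof (induction n rule: less_induct)
  case (less n)
  let ?F = "fps_exp 1 oo Abs_fps b"
  show ?case
  proof (cases n)
    case 0
    then show ?thesis by (simp add: a0)
  next
    case (Suc m)
    have "fps_deriv ?F = ?F * fps_deriv (Abs_fps b)"
      by (subst fps_compose_deriv) (simp_all add: b0)
    then have "fps_nth (fps_deriv ?F) m = (\<Sum>i=0..m. fps_nth ?F i * fps_nth (fps_deriv (Abs_fps b)) (m - i))"
      by (simp only: fps_mult_nth)
    then have "real n * fps_nth ?F n = (\<Sum>i=0..m. fps_nth ?F i * (real (Suc (m - i)) * b (Suc (m - i))))"
      using Suc by simp
    also have "\<dots> = (\<Sum>i=0..m. a i * (real (Suc (m - i)) * b (Suc (m - i))))"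
      using Suc by (intro sum.cong refl) (simp add: less.IH del: of_nat_Suc)
    also have "\<dots> = (\<Sum>j\<in>{1..n}. real j * b j * a (n - j))"
      by (rule sum.reindex_bij_witness[of _ "\<lambda>j. n - j" "\<lambda>i. n - i"]) (use Suc in \<open>auto simp: Suc_diff_le\<close>)
    also have "\<dots> = real n * a n" by (rule rec[symmetric])
    finally show ?thesis using Suc by simp
  qed
qed

text \<open>
  Convergence on the closed unit disc, boundary included, as required for characteristic functions. It does
  not follow from the identity of formal power series alone: the double series
  \<open>\<Sum>k n. (B\<^sup>k)\<^sub>n z\<^sup>n / k!\<close> is dominated by its value at \<open>z = 1\<close>, so its two orders of summation agree.
\<close>
lemma exponential_recurrence_sums:
  fixes a b :: "nat \<Rightarrow> real" and z :: complex
  assumes a0: "a 0 = 1" and b0: "b 0 = 0"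
    and rec: "\<And>n. real n * a n = (\<Sum>j\<in>{1..n}. real j * b j * a (n - j))"
    and b: "\<And>n. b n \<ge> 0" "summable b" and z: "norm z \<le> 1"
  shows "(\<lambda>n. of_real (a n) * z ^ n) sums exp (\<Sum>n. of_real (b n) * z ^ n)"
proof -
  let ?p = "\<lambda>k n. fps_nth (Abs_fps b ^ k) n"
  note p = sums_fps_power[OF b z]
  let ?B = "\<Sum>n. of_real (b n) * z ^ n"
  define f where "f q = of_real (?p (fst q) (snd q) / fact (fst q)) * z ^ snd q" for q
  define S where "S = (\<Sum>n. b n)"
  have S: "S \<ge> 0" using b by (simp add: S_def suminf_nonneg)
  have row_norm: "((\<lambda>n. ?p k n / fact k) has_sum (S ^ k / fact k)) UNIV" for k
    by (rule sums_nonneg_imp_has_sum) (use p in \<open>auto simp: S_def intro: sums_divide\<close>)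
  have abs: "(\<lambda>q. norm (f q)) summable_on (UNIV \<times> UNIV)"
  proof (rule Infinite_Sum.abs_summable_on_comparison_test')
    have "(\<lambda>k. S ^ k / fact k) summable_on UNIV"
      using S summable_norm_exp[of S]
      by (intro norm_summable_imp_summable_on) (simp add: divide_inverse mult.commute)
    moreover have "(\<lambda>n. ?p k n / fact k) summable_on UNIV" for k
      using row_norm[of k] by (auto simp: summable_on_def)
    moreover have "(\<Sum>\<^sub>\<infinity>n. ?p k n / fact k) = S ^ k / fact k" for k
      using row_norm[of k] by (rule infsumI)
    ultimately have "(\<lambda>q. norm (?p (fst q) (snd q) / fact (fst q))) summable_on (UNIV \<times> UNIV)"
      using p(1) S by (subst Infinite_Sum.abs_summable_on_Sigma_iff) (simp add: abs_of_nonneg)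
    then show "(\<lambda>q. ?p (fst q) (snd q) / fact (fst q)) summable_on (UNIV \<times> UNIV)"
      by (subst summable_on_iff_abs_summable_on_real) simp
    show "norm (f q) \<le> ?p (fst q) (snd q) / fact (fst q)" for q
    proof -
      have "norm (f q) = ?p (fst q) (snd q) / fact (fst q) * norm z ^ snd q"
        using p(1) by (simp add: f_def norm_mult norm_power norm_divide)
      also have "\<dots> \<le> ?p (fst q) (snd q) / fact (fst q) * 1"
        using p(1) z by (intro mult_left_mono power_le_one) auto
      finally show ?thesis by simp
    qed
  qed
  have row: "((\<lambda>n. f (k, n)) has_sum (?B ^ k /\<^sub>R fact k)) UNIV" for k
  proof (rule norm_summable_imp_has_sum)
    have "(\<lambda>n. norm (f (k, n))) summable_on UNIV"
      using abs by (subst (asm) Infinite_Sum.abs_summable_on_Sigma_iff) auto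
    then show "summable (\<lambda>n. norm (f (k, n)))" by (rule summable_on_imp_summable)
    have "(\<lambda>n. inverse (fact k) *\<^sub>R (of_real (?p k n) * z ^ n)) sums (inverse (fact k) *\<^sub>R ?B ^ k)"
      by (intro sums_scaleR_right p)
    then show "(\<lambda>n. f (k, n)) sums (?B ^ k /\<^sub>R fact k)"
      by (simp add: f_def scaleR_conv_of_real field_simps)
  qed
  have "((\<lambda>k. ?B ^ k /\<^sub>R fact k) has_sum exp ?B) UNIV"
    using summable_norm_exp exp_converges by (rule norm_summable_imp_has_sum)
  from has_sum_SigmaI[OF row this abs_summable_summable[OF abs]]
  have "(f has_sum exp ?B) (UNIV \<times> UNIV)" by simp
  then have swapped: "((\<lambda>(n,k). f (k,n)) has_sum exp ?B) (UNIV \<times> UNIV)"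
    by (subst (asm) has_sum_swap)
  have "((\<lambda>n. of_real (a n) * z ^ n) has_sum exp ?B) UNIV"
  proof (rule has_sum_SigmaD[OF swapped])
    fix n
    have p0: "?p k n = 0" if "k > n" for k
      using startsby_zero_power_prefix[of "Abs_fps b" k] that b0 by simp
    show "((\<lambda>k. case (n, k) of (n, k) \<Rightarrow> f (k, n)) has_sum of_real (a n) * z ^ n) UNIV"
      by (rule has_sum_finite_neutralI[of "{0..n}"])
         (auto simp: p0 f_def exponential_coefficients[OF a0 b0 rec] fps_compose_nth sum_distrib_right)
  qed
  then show ?thesis by (rule has_sum_imp_sums)
qed

section \<open>Slow growth of the weights of a single site\<close>

context
  fixes h :: "nat \<Rightarrow> real" and \<gamma> :: real
  assumes h0: "h 0 = 1" and h_nonneg: "\<And>n. h n \<ge> 0" and \<gamma>: "\<gamma> > 0"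
    and rec: "\<And>n. real n * h n = (\<Sum>j\<in>{1..n}. real j powr \<gamma> * h (n - j))"
begin

text \<open>
  Subtracting the recurrence at \<open>m\<close> from that at \<open>m + 1\<close> leaves differences of \<open>j\<^sup>\<gamma>\<close>. They are nonnegative, so
  \<open>h\<close> increases, and they are smaller than \<open>j\<^sup>\<gamma>\<close> by a factor of order \<open>1 / j\<close>, so it increases slowly.
\<close>
lemma weight_increment:
  "real (Suc m) * (h (Suc m) - h m) = (\<Sum>j\<in>{1..m}. (real (Suc j) powr \<gamma> - real j powr \<gamma>) * h (m - j))"
proof -
  have "real (Suc m) * h (Suc m) = (\<Sum>j\<in>{1..Suc m}. real j powr \<gamma> * h (Suc m - j))" by (rule rec)
  also have "{1..Suc m} = Suc ` {0..m}" by (simp add: image_Suc_atLeastAtMost)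
  also have "(\<Sum>j\<in>Suc ` {0..m}. real j powr \<gamma> * h (Suc m - j)) = (\<Sum>j\<in>{0..m}. real (Suc j) powr \<gamma> * h (m - j))"
    by (subst sum.reindex) auto
  also have "{0..m} = insert 0 {1..m}" by auto
  finally have "real (Suc m) * h (Suc m) = h m + (\<Sum>j\<in>{1..m}. real (Suc j) powr \<gamma> * h (m - j))"
    by simp
  moreover have "real (Suc m) * h m = h m + (\<Sum>j\<in>{1..m}. real j powr \<gamma> * h (m - j))"
    using rec[of m] by (simp add: algebra_simps)
  ultimately show ?thesis by (simp add: algebra_simps sum_subtractf)
qed

lemma weight_increment_nonneg: "h m \<le> h (Suc m)"
proof -
  have "0 \<le> real (Suc m) * (h (Suc m) - h m)"
    unfolding weight_increment using h_nonneg \<gamma> by (auto intro!: sum_nonneg mult_nonneg_nonneg powr_mono2)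
  then show ?thesis by (simp add: zero_le_mult_iff)
qed

lemma weight_mono: "m \<le> n \<Longrightarrow> h m \<le> h n"
  using weight_increment_nonneg by (rule lift_Suc_mono_le)

lemma weight_ge_1: "h n \<ge> 1"
  using weight_mono[of 0 n] h0 by simp

text \<open>
  The sum in \<open>weight_increment\<close> is split at \<open>J = m\<^sup>1\<^sup>/\<^sup>(\<^sup>1\<^sup>+\<^sup>\<gamma>\<^sup>)\<close>. For \<open>j > J\<close> the differences of \<open>j\<^sup>\<gamma>\<close> are
  at most a constant times \<open>j\<^sup>\<gamma> / J\<close>, and the recurrence bounds that part by \<open>m h(m) / J\<close>. For \<open>j \<le> J\<close>
  monotonicity replaces \<open>h (m - j)\<close> by \<open>h m\<close> and the differences telescope to \<open>J\<^sup>\<gamma>\<close>. With this \<open>J\<close> both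
  bounds have the same order.
\<close>
lemma weight_increment_le:
  assumes "m \<ge> 1"
  shows "h (Suc m) \<le> (1 + (\<gamma> * exp \<gamma> + 2 powr \<gamma>) * real m powr (- (1 / (1 + \<gamma>)))) * h m"
proof -
  \<comment> \<open>the split point: both \<open>m / J\<close> and \<open>J\<^sup>\<gamma>\<close> equal \<open>m\<^sup>\<gamma>\<^sup>/\<^sup>(\<^sup>1\<^sup>+\<^sup>\<gamma>\<^sup>)\<close>\<close>
  define J where "J = real m powr (1 / (1 + \<gamma>))"
  define N where "N = nat \<lfloor>J\<rfloor>"
  have J: "J \<ge> 1" using assms \<gamma> by (simp add: J_def ge_one_powr_ge_zero)
  have mJ: "real m / J = J powr \<gamma>" and mJ': "J powr \<gamma> / real m = real m powr (- (1 / (1 + \<gamma>)))"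
  proof -
    have e: "1 - 1 / (1 + \<gamma>) = 1 / (1 + \<gamma>) * \<gamma>" using \<gamma> by (simp add: field_simps)
    have "real m / J = real m powr 1 / real m powr (1 / (1 + \<gamma>))" using assms by (simp add: J_def)
    also have "\<dots> = real m powr (1 - 1 / (1 + \<gamma>))" by (simp only: powr_diff)
    finally show 1: "real m / J = J powr \<gamma>" by (simp only: e J_def powr_powr)
    have "J powr \<gamma> / real m = 1 / J" using assms J unfolding 1[symmetric] by simp
    also have "\<dots> = real m powr (- (1 / (1 + \<gamma>)))" by (simp only: J_def powr_minus_divide)
    finally show "J powr \<gamma> / real m = real m powr (- (1 / (1 + \<gamma>)))" .
  qed
  define D where "D j = real (Suc j) powr \<gamma> - real j powr \<gamma>" for j
  have D0: "D j \<ge> 0" for j using \<gamma> by (simp add: D_def powr_mono2)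
  have Dup: "D j \<le> \<gamma> * exp \<gamma> / real j * real j powr \<gamma>" if "j \<ge> 1" for j
  proof -
    have "real (Suc j) powr \<gamma> = (real j * (1 + 1 / real j)) powr \<gamma>" using that by (simp add: distrib_left add.commute)
    also have "\<dots> = real j powr \<gamma> * (1 + 1 / real j) powr \<gamma>" by (simp add: powr_mult)
    also have "(1 + 1 / real j) powr \<gamma> \<le> exp (1 / real j) powr \<gamma>"
      using \<gamma> by (intro powr_mono2) (auto intro: exp_ge_add_one_self)
    also have "\<dots> = exp (\<gamma> / real j)" by (simp add: powr_def)
    also have "\<dots> \<le> 1 + \<gamma> / real j * exp (\<gamma> / real j)"
    proof -
      have "exp x \<le> 1 + x * exp x" for x :: real
      proof -
        have "1 - x \<le> exp (- x)" using exp_ge_add_one_self[of "- x"] by simp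
        then have "(1 - x) * exp x \<le> exp (- x) * exp x" by (rule mult_right_mono) simp
        then show ?thesis by (simp add: exp_minus algebra_simps)
      qed
      then show ?thesis .
    qed
    also have "\<gamma> / real j * exp (\<gamma> / real j) \<le> \<gamma> / real j * exp \<gamma>"
      using \<gamma> that by (intro mult_left_mono) (auto simp: field_simps)
    finally have "real (Suc j) powr \<gamma> \<le> real j powr \<gamma> * (1 + \<gamma> / real j * exp \<gamma>)"
      by (simp add: mult_left_mono)
    then show ?thesis by (simp add: D_def algebra_simps)
  qed
  have "real (Suc m) * (h (Suc m) - h m) = (\<Sum>j\<in>{1..m}. D j * h (m - j))"
    unfolding weight_increment D_def ..
  also have "\<dots> \<le> (\<Sum>j\<in>{1..m}. \<gamma> * exp \<gamma> / J * (real j powr \<gamma> * h (m - j)) + (if j \<le> N then D j else 0) * h m)"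
  proof (intro sum_mono)
    fix j assume j: "j \<in> {1..m}"
    show "D j * h (m - j) \<le> \<gamma> * exp \<gamma> / J * (real j powr \<gamma> * h (m - j)) + (if j \<le> N then D j else 0) * h m"
    proof (cases "j \<le> N")
      case True
      have "D j * h (m - j) \<le> D j * h m" using D0 by (intro mult_left_mono weight_mono) auto
      moreover have "0 \<le> \<gamma> * exp \<gamma> / J * (real j powr \<gamma> * h (m - j))" using \<gamma> J h_nonneg by simp
      ultimately show ?thesis using True by simp
    next
      case False
      then have "J \<le> real j" using J unfolding N_def by linarith
      then have "\<gamma> * exp \<gamma> / real j * real j powr \<gamma> \<le> \<gamma> * exp \<gamma> / J * real j powr \<gamma>"
        using \<gamma> J by (intro mult_right_mono divide_left_mono) auto
      with Dup[of j] j have "D j \<le> \<gamma> * exp \<gamma> / J * real j powr \<gamma>" by auto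
      from mult_right_mono[OF this h_nonneg[of "m - j"]] show ?thesis using False by (simp add: mult.assoc)
    qed
  qed
  also have "\<dots> = \<gamma> * exp \<gamma> / J * (real m * h m) + (\<Sum>j\<in>{1..m}. if j \<le> N then D j else 0) * h m"
    by (simp only: sum.distrib sum_distrib_left[symmetric] sum_distrib_right[symmetric] rec[symmetric])
  also have "(\<Sum>j\<in>{1..m}. if j \<le> N then D j else 0) \<le> (\<Sum>j\<in>{1..N}. D j)"
    by (subst sum.inter_filter[symmetric]) (auto intro!: sum_mono2 simp: D0)
  also have "(\<Sum>j\<in>{1..N}. D j) = real (Suc N) powr \<gamma> - 1"
    unfolding D_def using sum_Suc_diff[of 1 N "\<lambda>j. real j powr \<gamma>"] by simp
  also have "\<dots> \<le> real (Suc N) powr \<gamma>" by simp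
  also have "real (Suc N) \<le> 2 * J" using J unfolding N_def by linarith
  then have "real (Suc N) powr \<gamma> \<le> (2 * J) powr \<gamma>" using \<gamma> by (intro powr_mono2) auto
  also have "\<dots> = 2 powr \<gamma> * J powr \<gamma>" using J by (simp add: powr_mult)
  finally have "real (Suc m) * (h (Suc m) - h m) \<le> \<gamma> * exp \<gamma> * (real m / J) * h m + 2 powr \<gamma> * J powr \<gamma> * h m"
    using h_nonneg[of m] by (simp add: mult_right_mono)
  then have "real (Suc m) * (h (Suc m) - h m) \<le> (\<gamma> * exp \<gamma> + 2 powr \<gamma>) * J powr \<gamma> * h m"
    unfolding mJ by (simp add: algebra_simps)
  moreover have "real m * (h (Suc m) - h m) \<le> real (Suc m) * (h (Suc m) - h m)"
    using weight_increment_nonneg[of m] by (intro mult_right_mono) auto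
  ultimately have "h (Suc m) - h m \<le> (\<gamma> * exp \<gamma> + 2 powr \<gamma>) * (J powr \<gamma> / real m) * h m"
  proof -
    assume a: "real (Suc m) * (h (Suc m) - h m) \<le> (\<gamma> * exp \<gamma> + 2 powr \<gamma>) * J powr \<gamma> * h m"
      and b: "real m * (h (Suc m) - h m) \<le> real (Suc m) * (h (Suc m) - h m)"
    have "(h (Suc m) - h m) * real m \<le> (\<gamma> * exp \<gamma> + 2 powr \<gamma>) * J powr \<gamma> * h m"
      using order_trans[OF b a] by (simp only: mult.commute)
    then have "h (Suc m) - h m \<le> (\<gamma> * exp \<gamma> + 2 powr \<gamma>) * J powr \<gamma> * h m / real m"
      using assms by (simp only: pos_le_divide_eq of_nat_0_less_iff)
    then show ?thesis by simp
  qed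
  then show ?thesis unfolding mJ' by (simp add: algebra_simps)
qed

lemma weight_growth:
  assumes "1 \<le> m1" "m1 \<le> m"
  shows "h (m + u) \<le> exp ((\<gamma> * exp \<gamma> + 2 powr \<gamma>) * real m1 powr (- (1 / (1 + \<gamma>))) * real u) * h m"
proof (induction u)
  case (Suc u)
  let ?C = "\<gamma> * exp \<gamma> + 2 powr \<gamma>"
  have C: "?C \<ge> 0" using \<gamma> by simp
  let ?a = "?C * real m1 powr (- (1 / (1 + \<gamma>)))"
  have "h (m + Suc u) \<le> (1 + ?C * real (m + u) powr (- (1 / (1 + \<gamma>)))) * h (m + u)"
    using weight_increment_le[of "m + u"] assms by simp
  also have "\<dots> \<le> exp ?a * (exp (?a * real u) * h m)"
  proof (rule mult_mono)
    have "real (m + u) powr (- (1 / (1 + \<gamma>))) \<le> real m1 powr (- (1 / (1 + \<gamma>)))"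
      using assms \<gamma> by (intro powr_mono2') auto
    then have "1 + ?C * real (m + u) powr (- (1 / (1 + \<gamma>))) \<le> 1 + ?a"
      using C by (simp add: mult_left_mono)
    also have "\<dots> \<le> exp ?a" by (rule exp_ge_add_one_self)
    finally show "1 + ?C * real (m + u) powr (- (1 / (1 + \<gamma>))) \<le> exp ?a" .
  qed (use Suc.IH h_nonneg in auto)
  also have "\<dots> = exp (?a * real (Suc u)) * h m"
    by (simp only: of_nat_Suc distrib_left exp_add mult_1_right mult.assoc)
  finally show ?case .
qed simp

end

section \<open>Sums over part sizes at small energy, and lattice sums of powers\<close>

text \<open>
  For \<open>q = \<gamma>\<close> this is the mean, and for \<open>q = \<gamma> + 1\<close> the variance, of the occupation of a site of energy \<open>\<epsilon>\<close>
  in the absence of a constraint on the total size.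
\<close>
definition power_exp_sum :: "real \<Rightarrow> real \<Rightarrow> real" where
  "power_exp_sum q \<epsilon> = (\<Sum>j. real j powr q * exp (- real j * \<epsilon>))"

lemma powr_le_exp_half:
  fixes t q :: real
  assumes "q > 0" "t \<ge> 0"
  shows "t powr q \<le> (2 * q) powr q * exp (t / 2)"
proof -
  have "t / (2 * q) \<le> exp (t / (2 * q))"
    using exp_ge_add_one_self[of "t / (2 * q)"] by linarith
  then have "t \<le> 2 * q * exp (t / (2 * q))" using assms by (simp add: field_simps)
  then have "t powr q \<le> (2 * q * exp (t / (2 * q))) powr q" using assms by (intro powr_mono2) auto
  also have "\<dots> = (2 * q) powr q * exp (t / (2 * q)) powr q" using assms by (simp add: powr_mult)
  also have "exp (t / (2 * q)) powr q = exp (t / 2)" using assms by (simp add: powr_def)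
  finally show ?thesis .
qed

lemma power_exp_term_le:
  assumes "q > 0" "\<epsilon> > 0"
  shows "real j powr q * exp (- real j * \<epsilon>) \<le> (2 * q) powr q * \<epsilon> powr (- q) * exp (- (\<epsilon> / 2)) ^ j"
proof -
  have "(real j * \<epsilon>) powr q \<le> (2 * q) powr q * exp (real j * \<epsilon> / 2)"
    using assms by (intro powr_le_exp_half) auto
  then have "\<epsilon> powr (- q) * exp (- real j * \<epsilon>) * (real j * \<epsilon>) powr q
      \<le> \<epsilon> powr (- q) * exp (- real j * \<epsilon>) * ((2 * q) powr q * exp (real j * \<epsilon> / 2))"
    by (rule mult_left_mono) auto
  also have "\<epsilon> powr (- q) * exp (- real j * \<epsilon>) * (real j * \<epsilon>) powr q = real j powr q * exp (- real j * \<epsilon>)"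
    using assms by (simp add: powr_mult powr_minus)
  also have "\<epsilon> powr (- q) * exp (- real j * \<epsilon>) * ((2 * q) powr q * exp (real j * \<epsilon> / 2))
      = (2 * q) powr q * \<epsilon> powr (- q) * (exp (- real j * \<epsilon>) * exp (real j * \<epsilon> / 2))" by (simp add: mult_ac)
  also have "exp (- real j * \<epsilon>) * exp (real j * \<epsilon> / 2) = exp (- (\<epsilon> / 2)) ^ j"
    by (simp add: exp_add[symmetric] exp_of_nat_mult[symmetric] field_simps)
  finally show ?thesis .
qed

lemma summable_power_exp:
  assumes "q > 0" "\<epsilon> > 0"
  shows "summable (\<lambda>j. real j powr q * exp (- real j * \<epsilon>))"
proof (rule summable_comparison_test'[of _ 0])
  show "summable (\<lambda>j. (2 * q) powr q * \<epsilon> powr (- q) * exp (- (\<epsilon> / 2)) ^ j)"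
    using assms by (intro summable_mult summable_geometric) auto
  show "norm (real j powr q * exp (- real j * \<epsilon>)) \<le> (2 * q) powr q * \<epsilon> powr (- q) * exp (- (\<epsilon> / 2)) ^ j" for j
    using power_exp_term_le[OF assms, of j] by simp
qed

lemma power_exp_sum_Suc:
  assumes "q > 0" "\<epsilon> > 0"
  shows "power_exp_sum q \<epsilon> = (\<Sum>j. real (Suc j) powr q * exp (- real (Suc j) * \<epsilon>))"
  unfolding power_exp_sum_def
  by (subst suminf_split_head[OF summable_power_exp[OF assms]]) simp

lemma power_exp_sum_nonneg: "q > 0 \<Longrightarrow> \<epsilon> > 0 \<Longrightarrow> power_exp_sum q \<epsilon> \<ge> 0"
  unfolding power_exp_sum_def by (intro suminf_nonneg summable_power_exp) auto

text \<open>
  The power \<open>j\<^sup>q\<close> is absorbed by half of the exponential, at the cost of \<open>\<epsilon>\<^sup>-\<^sup>q\<close>; the remaining geometric series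
  is at most \<open>2 / \<epsilon>\<close>.
\<close>
lemma power_exp_sum_le:
  assumes "q > 0" "\<epsilon> > 0"
  shows "power_exp_sum q \<epsilon> \<le> 2 * (2 * q) powr q * \<epsilon> powr (- (q + 1))"
proof -
  let ?r = "exp (- (\<epsilon> / 2))" and ?K = "(2 * q) powr q * \<epsilon> powr (- q)"
  have r: "0 < ?r" "?r < 1" using assms by auto
  have "power_exp_sum q \<epsilon> \<le> (\<Sum>j. ?K * ?r ^ Suc j)"
    unfolding power_exp_sum_Suc[OF assms]
  proof (rule suminf_le)
    show "real (Suc j) powr q * exp (- real (Suc j) * \<epsilon>) \<le> ?K * ?r ^ Suc j" for j
      by (rule power_exp_term_le[OF assms])
    show "summable (\<lambda>j. real (Suc j) powr q * exp (- real (Suc j) * \<epsilon>))"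
      using summable_power_exp[OF assms] by (subst summable_Suc_iff)
    show "summable (\<lambda>j. ?K * ?r ^ Suc j)"
      using r by (intro summable_mult) (simp add: summable_Suc_iff summable_geometric del: power_Suc)
  qed
  also have "\<dots> = ?K * (?r / (1 - ?r))"
  proof -
    have "(\<lambda>j. ?K * ?r * ?r ^ j) sums (?K * ?r * (1 / (1 - ?r)))"
      using r by (intro sums_mult geometric_sums) auto
    then show ?thesis by (simp add: sums_iff mult.assoc)
  qed
  also have "?r / (1 - ?r) \<le> 2 / \<epsilon>"
  proof -
    have "?r * (1 + \<epsilon> / 2) \<le> ?r * exp (\<epsilon> / 2)" using exp_ge_add_one_self by (intro mult_left_mono) auto
    also have "\<dots> = 1" by (simp add: exp_add[symmetric])
    finally show ?thesis using r assms by (simp add: field_simps)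
  qed
  also have "?K * (2 / \<epsilon>) = 2 * (2 * q) powr q * \<epsilon> powr (- (q + 1))"
    using assms by (simp add: powr_diff powr_minus field_simps)
  finally show ?thesis by (simp add: mult_left_mono)
qed

text \<open>
  The scaled sum is the integral of a step function which takes the value \<open>\<phi> (j \<epsilon>)\<close>, where
  \<open>\<phi> t = t\<^sup>q exp (- t)\<close>, on the interval of length \<open>\<epsilon>\<close> that ends at \<open>j \<epsilon>\<close>. It converges to the
  integral of \<open>\<phi>\<close>, which is the Gamma integral, by dominated convergence.
\<close>
lemma power_exp_sum_scaled_lim_aux:
  fixes X :: "nat \<Rightarrow> real"
  assumes q: "q > 0" and X: "\<And>k. 0 < X k" "\<And>k. X k \<le> 1" and lim: "X \<longlonglongrightarrow> 0"
  shows "(\<lambda>k. X k powr (q + 1) * power_exp_sum q (X k)) \<longlonglongrightarrow> Gamma (q + 1)"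
proof -
  define \<phi> where "\<phi> t = t powr q * exp (- t)" for t :: real
  define I where "I \<epsilon> j = {real j * \<epsilon> <.. real (Suc j) * \<epsilon>}" for \<epsilon> :: real and j :: nat
  define f where "f \<epsilon> t = (\<Sum>j. ennreal (\<phi> (real (Suc j) * \<epsilon>)) * indicator (I \<epsilon> j) t)" for \<epsilon> t
  have I_iff: "t \<in> I \<epsilon> j \<longleftrightarrow> t > 0 \<and> j = nat \<lceil>t / \<epsilon>\<rceil> - 1" if "\<epsilon> > 0" for \<epsilon> t j
  proof -
    have "t \<in> I \<epsilon> j \<longleftrightarrow> real j < t / \<epsilon> \<and> t / \<epsilon> \<le> real (Suc j)"
      using that by (simp add: I_def field_simps)
    also have "\<dots> \<longleftrightarrow> \<lceil>t / \<epsilon>\<rceil> = int (Suc j)"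
      by (subst ceiling_eq_iff) (auto simp: algebra_simps)
    also have "\<dots> \<longleftrightarrow> t > 0 \<and> j = nat \<lceil>t / \<epsilon>\<rceil> - 1"
    proof -
      have "t > 0 \<longleftrightarrow> \<lceil>t / \<epsilon>\<rceil> > 0" using that by (simp add: zero_less_ceiling zero_less_divide_iff)
      moreover have "c = int (Suc j) \<longleftrightarrow> c > 0 \<and> j = nat c - 1" for c by auto
      ultimately show ?thesis by blast
    qed
    finally show ?thesis .
  qed
  have disj: "disjoint_family (I \<epsilon>)" if "\<epsilon> > 0" for \<epsilon>
    using I_iff[OF that] by (auto simp: disjoint_family_on_def)
  have f_val: "\<exists>s. t \<le> s \<and> s \<le> t + \<epsilon> \<and> f \<epsilon> t = ennreal (\<phi> s)" if "\<epsilon> > 0" "t > 0" for \<epsilon> t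
  proof -
    define j where "j = nat \<lceil>t / \<epsilon>\<rceil> - 1"
    have j: "t \<in> I \<epsilon> j" using I_iff[OF that(1)] that(2) by (simp add: j_def)
    then have "f \<epsilon> t = ennreal (\<phi> (real (Suc j) * \<epsilon>))"
      unfolding f_def by (rule suminf_cmult_indicator[OF disj[OF that(1)]])
    moreover have "t \<le> real (Suc j) * \<epsilon>" "real (Suc j) * \<epsilon> \<le> t + \<epsilon>"
      using j that by (auto simp: I_def algebra_simps)
    ultimately show ?thesis by blast
  qed
  have f_zero: "f \<epsilon> t = 0" if "\<epsilon> > 0" "t \<le> 0" for \<epsilon> t
    using I_iff[OF that(1)] that(2) by (simp add: f_def indicator_def)
  have int_f: "(\<integral>\<^sup>+t. f \<epsilon> t \<partial>lborel) = ennreal (\<epsilon> powr (q + 1) * power_exp_sum q \<epsilon>)" if "\<epsilon> > 0" for \<epsilon>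
  proof -
    have "(\<integral>\<^sup>+t. f \<epsilon> t \<partial>lborel) = (\<Sum>j. \<integral>\<^sup>+t. ennreal (\<phi> (real (Suc j) * \<epsilon>)) * indicator (I \<epsilon> j) t \<partial>lborel)"
      unfolding f_def by (rule nn_integral_suminf) (simp add: I_def)
    also have "\<dots> = (\<Sum>j. ennreal (\<phi> (real (Suc j) * \<epsilon>) * \<epsilon>))"
    proof (intro arg_cong[where f = suminf] ext)
      fix j
      have "emeasure lborel (I \<epsilon> j) = ennreal \<epsilon>" using that by (simp add: I_def algebra_simps)
      then have "(\<integral>\<^sup>+t. ennreal (\<phi> (real (Suc j) * \<epsilon>)) * indicator (I \<epsilon> j) t \<partial>lborel)
          = ennreal (\<phi> (real (Suc j) * \<epsilon>)) * ennreal \<epsilon>"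
        by (subst nn_integral_cmult_indicator) (auto simp: I_def)
      also have "\<dots> = ennreal (\<phi> (real (Suc j) * \<epsilon>) * \<epsilon>)"
        using that by (simp add: \<phi>_def ennreal_mult)
      finally show "(\<integral>\<^sup>+t. ennreal (\<phi> (real (Suc j) * \<epsilon>)) * indicator (I \<epsilon> j) t \<partial>lborel)
          = ennreal (\<phi> (real (Suc j) * \<epsilon>) * \<epsilon>)" .
    qed
    also have "(\<lambda>j. \<phi> (real (Suc j) * \<epsilon>) * \<epsilon>) = (\<lambda>j. \<epsilon> powr (q + 1) * (real (Suc j) powr q * exp (- real (Suc j) * \<epsilon>)))"
      using that by (simp add: \<phi>_def powr_mult powr_add fun_eq_iff del: of_nat_Suc)
    also have "(\<Sum>j. ennreal (\<epsilon> powr (q + 1) * (real (Suc j) powr q * exp (- real (Suc j) * \<epsilon>))))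
       = ennreal (\<epsilon> powr (q + 1) * power_exp_sum q \<epsilon>)"
    proof -
      have s: "summable (\<lambda>j. real (Suc j) powr q * exp (- real (Suc j) * \<epsilon>))"
        using summable_power_exp[OF q that] by (subst summable_Suc_iff)
      have "(\<lambda>j. \<epsilon> powr (q + 1) * (real (Suc j) powr q * exp (- real (Suc j) * \<epsilon>))) sums (\<epsilon> powr (q + 1) * power_exp_sum q \<epsilon>)"
        unfolding power_exp_sum_Suc[OF q that] using s by (intro sums_mult summable_sums)
      then show ?thesis by (intro suminf_ennreal_eq) auto
    qed
    finally show ?thesis .
  qed
  have gamma: "(\<integral>\<^sup>+t. ennreal (indicator {0<..} t * \<phi> t) \<partial>lborel) = ennreal (Gamma (q + 1))"
  proof -
    have "ennreal (Gamma (q + 1)) = (\<integral>\<^sup>+t. ennreal (indicator {0..} t * t powr (q + 1 - 1) / exp t) \<partial>lborel)"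
      using q by (intro Gamma_conv_nn_integral_real) auto
    also have "\<dots> = (\<integral>\<^sup>+t. ennreal (indicator {0<..} t * \<phi> t) \<partial>lborel)"
      by (intro nn_integral_cong) (auto simp: \<phi>_def indicator_def exp_minus field_simps)
    finally show ?thesis ..
  qed
  \<comment> \<open>for \<open>\<epsilon> \<le> 1\<close> the step function at \<open>t\<close> is at most \<open>(1 + t)\<^sup>q exp (- t) = e \<phi> (1 + t)\<close>\<close>
  define w where "w t = ennreal (exp 1) * ennreal (indicator {0<..} (1 + 1 * t) * \<phi> (1 + 1 * t))" for t :: real
  have [measurable]: "\<phi> \<in> borel_measurable borel" unfolding \<phi>_def by measurable
  have "(\<lambda>k. \<integral>\<^sup>+t. f (X k) t \<partial>lborel) \<longlonglongrightarrow> (\<integral>\<^sup>+t. ennreal (indicator {0<..} t * \<phi> t) \<partial>lborel)"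
  proof (rule nn_integral_dominated_convergence[where w = w])
    show "f (X k) \<in> borel_measurable lborel" for k unfolding f_def I_def by measurable
    show "(\<lambda>t. ennreal (indicator {0<..} t * \<phi> t)) \<in> borel_measurable lborel" by measurable
    show "w \<in> borel_measurable lborel" unfolding w_def by measurable
    have "(\<integral>\<^sup>+t. w t \<partial>lborel) = ennreal (exp 1) * (\<integral>\<^sup>+t. ennreal (indicator {0<..} (1 + 1 * t) * \<phi> (1 + 1 * t)) \<partial>lborel)"
      unfolding w_def by (rule nn_integral_cmult) measurable
    also have "(\<integral>\<^sup>+t. ennreal (indicator {0<..} (1 + 1 * t) * \<phi> (1 + 1 * t)) \<partial>lborel) = ennreal (Gamma (q + 1))"
      unfolding gamma[symmetric]
      by (subst (2) nn_integral_real_affine[where c = 1 and t = 1]) simp_all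
    finally show "(\<integral>\<^sup>+t. w t \<partial>lborel) < \<infinity>" by (simp add: ennreal_mult_less_top)
    show "AE t in lborel. f (X k) t \<le> w t" for k
    proof (rule AE_I2)
      fix t :: real
      show "f (X k) t \<le> w t"
      proof (cases "t > 0")
        case True
        from f_val[OF X(1) True] obtain s where s: "t \<le> s" "s \<le> t + X k" "f (X k) t = ennreal (\<phi> s)" by blast
        have "\<phi> s \<le> (1 + t) powr q * exp (- t)"
          unfolding \<phi>_def using s X(2)[of k] True q by (intro mult_mono powr_mono2) auto
        also have "\<dots> = exp 1 * \<phi> (1 + t)" by (simp add: \<phi>_def exp_add[symmetric])
        finally show ?thesis using True s(3) by (simp add: w_def ennreal_mult'[symmetric] ennreal_leI)
      qed (simp add: f_zero X)
    qed
    show "AE t in lborel. (\<lambda>k. f (X k) t) \<longlonglongrightarrow> ennreal (indicator {0<..} t * \<phi> t)"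
    proof (rule AE_I2)
      fix t :: real
      show "(\<lambda>k. f (X k) t) \<longlonglongrightarrow> ennreal (indicator {0<..} t * \<phi> t)"
      proof (cases "t > 0")
        case True
        have "\<forall>k. \<exists>s. t \<le> s \<and> s \<le> t + X k \<and> f (X k) t = ennreal (\<phi> s)"
          using f_val[OF X(1) True] by blast
        then obtain s where s: "\<And>k. t \<le> s k" "\<And>k. s k \<le> t + X k" "\<And>k. f (X k) t = ennreal (\<phi> (s k))"
          by metis
        have "s \<longlonglongrightarrow> t"
          by (rule tendsto_sandwich[of "\<lambda>_. t" _ _ "\<lambda>k. t + X k"])
             (use s tendsto_add[OF tendsto_const[of t] lim] in auto)
        then have "(\<lambda>k. ennreal (\<phi> (s k))) \<longlonglongrightarrow> ennreal (\<phi> t)"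
          unfolding \<phi>_def using True q by (intro tendsto_intros) auto
        then show ?thesis using True s(3) by simp
      qed (simp add: f_zero X)
    qed
  qed
  then have "(\<lambda>k. ennreal (X k powr (q + 1) * power_exp_sum q (X k))) \<longlonglongrightarrow> ennreal (Gamma (q + 1))"
    by (simp only: int_f[OF X(1)] gamma)
  then show ?thesis
    using q X power_exp_sum_nonneg[OF q X(1)] by (subst (asm) tendsto_ennreal_iff) (auto intro!: Gamma_real_pos less_imp_le always_eventually)
qed

lemma power_exp_sum_scaled_lim:
  fixes X :: "nat \<Rightarrow> real"
  assumes q: "q > 0" and X: "\<And>k. 0 < X k" and lim: "X \<longlonglongrightarrow> 0"
  shows "(\<lambda>k. X k powr (q + 1) * power_exp_sum q (X k)) \<longlonglongrightarrow> Gamma (q + 1)"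
proof -
  have "eventually (\<lambda>k. X k < 1) sequentially" using lim by (rule order_tendstoD) simp
  then obtain N where N: "\<And>k. k \<ge> N \<Longrightarrow> X k < 1" by (auto simp: eventually_sequentially)
  have "(\<lambda>k. X (k + N) powr (q + 1) * power_exp_sum q (X (k + N))) \<longlonglongrightarrow> Gamma (q + 1)"
    using X N lim by (intro power_exp_sum_scaled_lim_aux q) (auto intro: less_imp_le LIMSEQ_ignore_initial_segment)
  then show ?thesis by (rule LIMSEQ_offset)
qed

lemma summable_on_int_powr:
  assumes "p > 1"
  shows "(\<lambda>k :: int. (1 + real_of_int \<bar>k\<bar>) powr (- p)) summable_on UNIV"
proof -
  let ?f = "\<lambda>k :: int. (1 + real_of_int \<bar>k\<bar>) powr (- p)"
  have "summable (\<lambda>n. real (Suc n) powr (- p))"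
    using assms by (subst summable_Suc_iff) (simp add: summable_real_powr_iff)
  then have n: "(\<lambda>n. (1 + real n) powr (- p)) summable_on UNIV"
    by (subst summable_on_UNIV_nonneg_real_iff) auto
  have "?f summable_on range int"
    by (subst summable_on_reindex) (use n in \<open>auto simp: o_def\<close>)
  moreover have "?f summable_on range (\<lambda>n. - int n)"
    by (subst summable_on_reindex) (use n in \<open>auto simp: o_def inj_on_def\<close>)
  then have "?f summable_on (range (\<lambda>n. - int n) - range int)"
    by (rule summable_on_subset_banach) auto
  ultimately have "?f summable_on (range int \<union> (range (\<lambda>n. - int n) - range int))"
    by (rule summable_on_Un_disjoint) auto
  moreover have "range int \<union> (range (\<lambda>n. - int n) - range int) = UNIV"
    by (auto simp: image_iff) (metis int_cases2)
  ultimately show ?thesis by simp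
qed

lemma lattice_point_component: "lattice_point x $ i = real_of_int (x $ i)"
  by (simp add: lattice_point_def)

lemma norm_lattice_point_ge_1:
  fixes x :: "int ^ 'd::finite"
  assumes "x \<noteq> 0"
  shows "norm (lattice_point x) \<ge> 1"
proof -
  from assms obtain i where "x $ i \<noteq> 0" by (auto simp: vec_eq_iff)
  then have "1 \<le> \<bar>lattice_point x $ i\<bar>" by (simp add: lattice_point_component)
  also have "\<dots> \<le> norm (lattice_point x)" by (rule component_le_norm_cart)
  finally show ?thesis .
qed

text \<open>
  Each coordinate is at most the norm, hence \<open>\<parallel>x\<parallel>\<^sup>-\<^sup>\<alpha>\<close> is at most \<open>2\<^sup>\<alpha>\<close> times the product over the \<open>d\<close>
  coordinates of \<open>(1 + \<bar>x\<^sub>i\<bar>)\<^sup>-\<^sup>\<alpha>\<^sup>/\<^sup>d\<close>, and this product is summable because \<open>\<alpha> / d > 1\<close>.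
\<close>
lemma lattice_powr_summable:
  assumes \<alpha>: "\<alpha> > real CARD('d::finite)"
  shows "(\<lambda>x :: int ^ 'd. norm (lattice_point x) powr (- \<alpha>)) summable_on (- {0})"
proof (rule nonneg_bdd_above_summable_on)
  define p where "p = \<alpha> / real CARD('d)"
  have p: "p > 1" using \<alpha> by (simp add: p_def)
  define c where "c k = (1 + real_of_int \<bar>k\<bar>) powr (- p)" for k :: int
  define T where "T = (\<Sum>\<^sub>\<infinity>k. c k)"
  have c_sum: "c summable_on UNIV" unfolding c_def using p by (rule summable_on_int_powr)
  have c0: "c k \<ge> 0" for k by (simp add: c_def)
  have site: "norm (lattice_point x) powr (- \<alpha>) \<le> 2 powr \<alpha> * (\<Prod>i\<in>UNIV. c (x $ i))"
    if "x \<noteq> 0" for x :: "int ^ 'd"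
  proof -
    let ?r = "norm (lattice_point x)"
    have r: "?r \<ge> 1" using that by (rule norm_lattice_point_ge_1)
    have "(2 * ?r) powr (- \<alpha>) = (\<Prod>i\<in>(UNIV :: 'd set). (2 * ?r) powr (- p))"
    proof -
      have "(\<Prod>i\<in>(UNIV :: 'd set). (2 * ?r) powr (- p)) = ((2 * ?r) powr (- p)) powr real CARD('d)"
        using r by (subst powr_realpow) auto
      also have "\<dots> = (2 * ?r) powr (- \<alpha>)" by (simp add: powr_powr p_def)
      finally show ?thesis ..
    qed
    also have "\<dots> \<le> (\<Prod>i\<in>UNIV. c (x $ i))"
    proof (intro prod_mono conjI)
      fix i
      have "\<bar>lattice_point x $ i\<bar> \<le> ?r" by (rule component_le_norm_cart)
      then have "1 + real_of_int \<bar>x $ i\<bar> \<le> 2 * ?r" using r by (simp add: lattice_point_component)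
      then show "(2 * ?r) powr (- p) \<le> c (x $ i)"
        unfolding c_def using p by (intro powr_mono2') auto
    qed auto
    finally have "2 powr \<alpha> * (2 * ?r) powr (- \<alpha>) \<le> 2 powr \<alpha> * (\<Prod>i\<in>UNIV. c (x $ i))"
      by (rule mult_left_mono) simp
    moreover have "2 powr \<alpha> * (2 * ?r) powr (- \<alpha>) = ?r powr (- \<alpha>)"
      using r by (simp add: powr_mult powr_minus)
    ultimately show ?thesis by simp
  qed
  show "bdd_above (sum (\<lambda>x :: int ^ 'd. norm (lattice_point x) powr (- \<alpha>)) ` {F. F \<subseteq> - {0} \<and> finite F})"
  proof (rule bdd_aboveI2)
    fix F :: "(int ^ 'd) set" assume F: "F \<in> {F. F \<subseteq> - {0} \<and> finite F}"
    define K where "K = (\<Union>x\<in>F. range (($) x))"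
    have K: "finite K" using F by (auto simp: K_def)
    have "(\<Sum>x\<in>F. norm (lattice_point x) powr (- \<alpha>)) \<le> (\<Sum>x\<in>F. 2 powr \<alpha> * (\<Prod>i\<in>UNIV. c (x $ i)))"
      using F by (intro sum_mono site) auto
    also have "\<dots> = 2 powr \<alpha> * (\<Sum>g\<in>($) ` F. \<Prod>i\<in>UNIV. c (g i))"
      by (subst sum.reindex) (auto simp: inj_on_def vec_eq_iff sum_distrib_left)
    also have "(\<Sum>g\<in>($) ` F. \<Prod>i\<in>UNIV. c (g i)) \<le> (\<Sum>g\<in>PiE (UNIV :: 'd set) (\<lambda>_. K). \<Prod>i\<in>UNIV. c (g i))"
      using K c0 by (intro sum_mono2 finite_PiE prod_nonneg) (auto simp: K_def PiE_def extensional_def)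
    also have "\<dots> = (\<Prod>i\<in>(UNIV :: 'd set). \<Sum>k\<in>K. c k)"
      using K by (subst prod_sum_PiE) auto
    also have "\<dots> \<le> (\<Prod>i\<in>(UNIV :: 'd set). T)"
      unfolding T_def using K c0 c_sum by (intro prod_mono conjI sum_nonneg finite_sum_le_infsum) auto
    finally show "(\<Sum>x\<in>F. norm (lattice_point x) powr (- \<alpha>)) \<le> 2 powr \<alpha> * T ^ CARD('d)"
      by (simp add: mult_left_mono)
  qed
qed auto

section \<open>Moments of the mass away from the origin\<close>

text \<open>
  The potential \<open>V (x / L)\<close> for \<open>V x = \<parallel>x\<parallel>\<^sup>\<delta>\<close>.
\<close>
definition site_energy :: "real \<Rightarrow> real \<Rightarrow> int ^ 'd::finite \<Rightarrow> real" where
  "site_energy \<delta> L x = (norm (lattice_point x) / L) powr \<delta>"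

lemma site_energy_pos: "x \<noteq> 0 \<Longrightarrow> L > 0 \<Longrightarrow> site_energy \<delta> L x > 0"
  using norm_lattice_point_ge_1[of x] by (auto simp: site_energy_def)

lemma site_energy_powr:
  assumes "x \<noteq> 0" "L > 0"
  shows "site_energy \<delta> L x powr r = norm (lattice_point x) powr (\<delta> * r) * L powr (- (\<delta> * r))"
  using assms norm_lattice_point_ge_1[OF assms(1)]
  by (simp add: site_energy_def powr_powr powr_divide powr_minus_divide)

lemma integral_count_space_eq_infsum:
  fixes f :: "'a \<Rightarrow> real"
  assumes "f summable_on A"
  shows "integrable (count_space A) f" "(\<integral>x. f x \<partial>count_space A) = infsum f A"
proof -
  have *: "Infinite_Set_Sum.abs_summable_on f A"
    unfolding abs_summable_equivalent[symmetric] summable_on_iff_abs_summable_on_real[symmetric] by (rule assms)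
  then show "integrable (count_space A) f" by (simp add: Infinite_Set_Sum.abs_summable_on_def)
  show "(\<integral>x. f x \<partial>count_space A) = infsum f A"
    using infsetsum_infsum[OF *] by (simp add: infsetsum_def)
qed

lemma site_sum_summable:
  assumes q: "q > 0" and \<delta>: "\<delta> * (q + 1) > real CARD('d::finite)" and L: "L > 0"
  shows "(\<lambda>x :: int ^ 'd. power_exp_sum q (site_energy \<delta> L x)) summable_on (- {0})"
proof (rule summable_on_comparison_test)
  let ?C = "2 * (2 * q) powr q * L powr (\<delta> * (q + 1))"
  show "(\<lambda>x :: int ^ 'd. ?C * norm (lattice_point x) powr (- (\<delta> * (q + 1)))) summable_on (- {0})"
    using \<delta> by (intro summable_on_cmult_right lattice_powr_summable)
  fix x :: "int ^ 'd" assume "x \<in> - {0}"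
  then have x: "x \<noteq> 0" by simp
  show "0 \<le> power_exp_sum q (site_energy \<delta> L x)"
    using power_exp_sum_nonneg[OF q site_energy_pos[OF x L]] .
  have "site_energy \<delta> L x powr (- (q + 1)) = L powr (\<delta> * (q + 1)) * norm (lattice_point x) powr (- (\<delta> * (q + 1)))"
    unfolding site_energy_powr[OF x L] by (simp add: algebra_simps)
  then show "power_exp_sum q (site_energy \<delta> L x) \<le> ?C * norm (lattice_point x) powr (- (\<delta> * (q + 1)))"
    using power_exp_sum_le[OF q site_energy_pos[OF x L, of \<delta>]] by (simp add: mult.assoc)
qed

text \<open>
  The exponent \<open>q' \<ge> q\<close> is there because the mean, where \<open>q = \<gamma>\<close>, is a convergent sum for each \<open>L\<close> although
  \<open>\<delta> (\<gamma> + 1) < d\<close>: it is dominated by the variance, where \<open>q' = \<gamma> + 1\<close>.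
\<close>
lemma pair_summable:
  assumes q: "0 < q" "q \<le> q'" and \<delta>: "\<delta> * (q' + 1) > real CARD('d::finite)" and L: "L > 0"
  shows "(\<lambda>(x :: int ^ 'd, j). real j powr q * exp (- real j * site_energy \<delta> L x)) summable_on (- {0}) \<times> UNIV"
proof -
  have q': "q' > 0" using q by simp
  let ?f = "\<lambda>p :: (int ^ 'd) \<times> nat. real (snd p) powr q' * exp (- real (snd p) * site_energy \<delta> L (fst p))"
  have row: "((\<lambda>j. ?f (x, j)) has_sum power_exp_sum q' (site_energy \<delta> L x)) UNIV" if "x \<in> - {0}" for x
  proof (rule sums_nonneg_imp_has_sum)
    have "site_energy \<delta> L x > 0" using that L by (intro site_energy_pos) auto
    from summable_power_exp[OF q' this]
    show "(\<lambda>j. ?f (x, j)) sums power_exp_sum q' (site_energy \<delta> L x)"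
      unfolding power_exp_sum_def by (simp add: summable_sums)
  qed auto
  have "(\<lambda>p. norm (?f p)) summable_on (- {0}) \<times> UNIV"
  proof (subst Infinite_Sum.abs_summable_on_Sigma_iff, intro conjI ballI)
    fix x :: "int ^ 'd" assume x: "x \<in> - {0}"
    show "(\<lambda>j. norm (?f (x, j))) summable_on UNIV" using row[OF x] by (auto simp: summable_on_def)
  next
    have "(\<lambda>x. norm (\<Sum>\<^sub>\<infinity>j. norm (?f (x, j)))) summable_on - {0} \<longleftrightarrow>
          (\<lambda>x. power_exp_sum q' (site_energy \<delta> L x)) summable_on - {0 :: int ^ 'd}"
    proof (rule summable_on_cong)
      fix x :: "int ^ 'd" assume x: "x \<in> - {0}"
      have "(\<Sum>\<^sub>\<infinity>j. norm (?f (x, j))) = power_exp_sum q' (site_energy \<delta> L x)"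
        using infsumI[OF row[OF x]] by simp
      moreover have "power_exp_sum q' (site_energy \<delta> L x) \<ge> 0"
        using x L q' by (intro power_exp_sum_nonneg site_energy_pos) auto
      ultimately show "norm (\<Sum>\<^sub>\<infinity>j. norm (?f (x, j))) = power_exp_sum q' (site_energy \<delta> L x)" by simp
    qed
    then show "(\<lambda>x. norm (\<Sum>\<^sub>\<infinity>j. norm (?f (x, j)))) summable_on - {0}"
      using site_sum_summable[OF q' \<delta> L] by simp
  qed
  then show ?thesis
  proof (rule Infinite_Sum.abs_summable_summable[OF Infinite_Sum.abs_summable_on_comparison_test])
    fix p :: "(int ^ 'd) \<times> nat" assume "p \<in> (- {0}) \<times> UNIV"
    have "real j powr q \<le> real j powr q'" for j
      by (cases "j = 0") (use q in \<open>auto intro: powr_mono\<close>)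
    then show "norm (case p of (x, j) \<Rightarrow> real j powr q * exp (- real j * site_energy \<delta> L x)) \<le> norm (?f p)"
      by (simp add: case_prod_unfold)
  qed
qed

definition lattice_exp_sum :: "'d::finite itself \<Rightarrow> real \<Rightarrow> real \<Rightarrow> nat \<Rightarrow> real" where
  "lattice_exp_sum _ \<delta> L j = (\<Sum>\<^sub>\<infinity>x\<in>- {0 :: int ^ 'd}. exp (- real j * site_energy \<delta> L x))"

lemma lattice_exp_summable:
  assumes q: "0 < q" and \<delta>: "\<delta> * (q + 1) > real CARD('d::finite)" and L: "L > 0" and j: "j \<ge> 1"
  shows "(\<lambda>x :: int ^ 'd. exp (- real j * site_energy \<delta> L x)) summable_on - {0}"
proof -
  have "(\<lambda>(j, x :: int ^ 'd). real j powr q * exp (- real j * site_energy \<delta> L x)) summable_on UNIV \<times> (- {0})"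
    using pair_summable[OF q order_refl \<delta> L] by (subst (asm) summable_on_swap) (simp add: case_prod_unfold)
  then have "(\<lambda>x :: int ^ 'd. real j powr q * exp (- real j * site_energy \<delta> L x)) summable_on - {0}"
    using summable_on_SigmaD1[of "\<lambda>j x. real j powr q * exp (- real j * site_energy \<delta> L x)" UNIV "\<lambda>_. - {0}" j] by simp
  then show ?thesis using j by (subst (asm) summable_on_cmult_right') auto
qed

lemma lattice_moment_sums:
  assumes q: "0 < q" "q \<le> q'" and \<delta>: "\<delta> * (q' + 1) > real CARD('d::finite)" and L: "L > 0"
  shows "(\<lambda>j. real j powr q * lattice_exp_sum TYPE('d) \<delta> L j) sums
           (\<Sum>\<^sub>\<infinity>x\<in>- {0 :: int ^ 'd}. power_exp_sum q (site_energy \<delta> L x))"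
proof -
  let ?f = "\<lambda>(x :: int ^ 'd) j. real j powr q * exp (- real j * site_energy \<delta> L x)"
  note sum = pair_summable[OF q \<delta> L]
  have inner: "(\<Sum>\<^sub>\<infinity>j. ?f x j) = power_exp_sum q (site_energy \<delta> L x)" if "x \<in> - {0}" for x
  proof (rule infsumI[OF sums_nonneg_imp_has_sum])
    have "site_energy \<delta> L x > 0" using that L by (intro site_energy_pos) auto
    from summable_power_exp[OF q(1) this]
    show "(\<lambda>j. ?f x j) sums power_exp_sum q (site_energy \<delta> L x)"
      unfolding power_exp_sum_def by (simp add: summable_sums)
  qed auto
  have sum': "(\<lambda>(j, x). ?f x j) summable_on UNIV \<times> (- {0})"
    using sum by (subst (asm) summable_on_swap) (simp add: case_prod_unfold)
  have "(\<lambda>j. \<Sum>\<^sub>\<infinity>x\<in>- {0}. ?f x j) summable_on UNIV"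
    using summable_on_Sigma_banach[of "\<lambda>j x. ?f x j" UNIV "\<lambda>_. - {0}"] sum' by simp
  then have "((\<lambda>j. \<Sum>\<^sub>\<infinity>x\<in>- {0}. ?f x j) has_sum (\<Sum>\<^sub>\<infinity>j. \<Sum>\<^sub>\<infinity>x\<in>- {0}. ?f x j)) UNIV"
    by (rule has_sum_infsum)
  also have "(\<Sum>\<^sub>\<infinity>j. \<Sum>\<^sub>\<infinity>x\<in>- {0}. ?f x j) = (\<Sum>\<^sub>\<infinity>x\<in>- {0}. \<Sum>\<^sub>\<infinity>j. ?f x j)"
    using infsum_swap_banach[OF sum] by simp
  also have "\<dots> = (\<Sum>\<^sub>\<infinity>x\<in>- {0 :: int ^ 'd}. power_exp_sum q (site_energy \<delta> L x))"
    by (rule infsum_cong) (rule inner)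
  finally show ?thesis
    by (simp add: lattice_exp_sum_def infsum_cmult_right' has_sum_imp_sums)
qed

text \<open>
  By \<open>site_energy_powr\<close> the term of a site \<open>x\<close>, after scaling, is \<open>\<parallel>x\<parallel>\<^sup>-\<^sup>\<delta>\<^sup>(\<^sup>q\<^sup>+\<^sup>1\<^sup>)\<close> times a quantity which is
  bounded (\<open>power_exp_sum_le\<close>) and tends to \<open>\<Gamma>(q + 1)\<close> (\<open>power_exp_sum_scaled_lim\<close>); dominated convergence
  applies.
\<close>
lemma lattice_moment_lim:
  fixes L :: "nat \<Rightarrow> real"
  assumes q: "q > 0" and \<delta>0: "\<delta> > 0" and \<delta>: "\<delta> * (q + 1) > real CARD('d::finite)"
    and L: "\<And>k. L k > 0" and lim: "filterlim L at_top sequentially"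
  shows "(\<lambda>k. L k powr (- (\<delta> * (q + 1))) * (\<Sum>\<^sub>\<infinity>x\<in>- {0 :: int ^ 'd}. power_exp_sum q (site_energy \<delta> (L k) x)))
     \<longlonglongrightarrow> Gamma (q + 1) * (\<Sum>\<^sub>\<infinity>x\<in>- {0 :: int ^ 'd}. norm (lattice_point x) powr (- (\<delta> * (q + 1))))"
proof -
  define r where "r x = norm (lattice_point x) powr (- (\<delta> * (q + 1)))" for x :: "int ^ 'd"
  define g where "g k x = r x * (site_energy \<delta> (L k) x powr (q + 1) * power_exp_sum q (site_energy \<delta> (L k) x))" for k x
  have r_sum: "r summable_on - {0}" unfolding r_def using \<delta> by (rule lattice_powr_summable)
  have g_eq: "L k powr (- (\<delta> * (q + 1))) * power_exp_sum q (site_energy \<delta> (L k) x) = g k x" if "x \<noteq> 0" for k x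
  proof -
    have "norm (lattice_point x) > 0" using norm_lattice_point_ge_1[OF that] by (rule less_le_trans[OF zero_less_one])
    then show ?thesis unfolding g_def site_energy_powr[OF that L] r_def by (simp add: powr_minus)
  qed
  have g_sum: "g k summable_on - {0}" for k
  proof -
    have "(\<lambda>x. L k powr (- (\<delta> * (q + 1))) * power_exp_sum q (site_energy \<delta> (L k) x)) summable_on - {0 :: int ^ 'd}"
      by (intro summable_on_cmult_right site_sum_summable q \<delta> L)
    then show ?thesis by (rule summable_on_cong[THEN iffD1, rotated]) (simp add: g_eq)
  qed
  have "(\<lambda>k. \<integral>x. g k x \<partial>count_space (- {0})) \<longlonglongrightarrow> (\<integral>x. Gamma (q + 1) * r x \<partial>count_space (- {0}))"
  proof (rule integral_dominated_convergence[where w = "\<lambda>x. 2 * (2 * q) powr q * r x"])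
    show "integrable (count_space (- {0})) (\<lambda>x. 2 * (2 * q) powr q * r x)"
      by (intro integral_count_space_eq_infsum summable_on_cmult_right r_sum)
    show "AE x in count_space (- {0}). (\<lambda>k. g k x) \<longlonglongrightarrow> Gamma (q + 1) * r x"
    proof (rule AE_I2)
      fix x :: "int ^ 'd" assume "x \<in> space (count_space (- {0}))"
      then have x: "x \<noteq> 0" by simp
      have "(\<lambda>k. norm (lattice_point x) / L k) \<longlonglongrightarrow> 0"
        by (intro real_tendsto_divide_at_top[OF tendsto_const lim])
      then have "(\<lambda>k. site_energy \<delta> (L k) x) \<longlonglongrightarrow> 0"
        unfolding site_energy_def using \<delta>0 L
        by (auto intro!: tendsto_zero_powrI always_eventually simp: less_imp_le)
      from power_exp_sum_scaled_lim[OF q site_energy_pos[OF x L] this]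
      have "(\<lambda>k. r x * (site_energy \<delta> (L k) x powr (q + 1) * power_exp_sum q (site_energy \<delta> (L k) x))) \<longlonglongrightarrow> r x * Gamma (q + 1)"
        by (rule tendsto_mult[OF tendsto_const])
      then show "(\<lambda>k. g k x) \<longlonglongrightarrow> Gamma (q + 1) * r x" by (simp add: g_def mult.commute)
    qed
    show "AE x in count_space (- {0}). norm (g k x) \<le> 2 * (2 * q) powr q * r x" for k
    proof (rule AE_I2)
      fix x :: "int ^ 'd" assume "x \<in> space (count_space (- {0}))"
      then have x: "x \<noteq> 0" by simp
      let ?e = "site_energy \<delta> (L k) x"
      have e: "?e > 0" by (rule site_energy_pos[OF x L])
      have "?e powr (q + 1) * power_exp_sum q ?e \<le> ?e powr (q + 1) * (2 * (2 * q) powr q * ?e powr (- (q + 1)))"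
        by (intro mult_left_mono power_exp_sum_le q e) auto
      also have "\<dots> = 2 * (2 * q) powr q * (?e powr (q + 1) * ?e powr (- (q + 1)))" by (simp only: mult_ac)
      also have "?e powr (q + 1) * ?e powr (- (q + 1)) = 1" using e by (simp only: powr_add[symmetric]) simp
      finally have "r x * (?e powr (q + 1) * power_exp_sum q ?e) \<le> r x * (2 * (2 * q) powr q)"
        by (intro mult_left_mono) (auto simp: r_def)
      moreover have "0 \<le> r x * (?e powr (q + 1) * power_exp_sum q ?e)"
        using power_exp_sum_nonneg[OF q e] by (auto simp: r_def)
      ultimately show "norm (g k x) \<le> 2 * (2 * q) powr q * r x" by (simp add: g_def mult_ac)
    qed
  qed auto
  moreover have "(\<integral>x. g k x \<partial>count_space (- {0}))
     = L k powr (- (\<delta> * (q + 1))) * (\<Sum>\<^sub>\<infinity>x\<in>- {0 :: int ^ 'd}. power_exp_sum q (site_energy \<delta> (L k) x))" for k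
    unfolding integral_count_space_eq_infsum(2)[OF g_sum] infsum_cmult_right'[symmetric]
    by (rule infsum_cong) (simp add: g_eq)
  moreover have "(\<integral>x. Gamma (q + 1) * r x \<partial>count_space (- {0})) = Gamma (q + 1) * infsum r (- {0})"
    using integral_count_space_eq_infsum(2)[OF r_sum] by simp
  ultimately show ?thesis by (simp only: r_def[abs_def])
qed

section \<open>The mass away from the origin stays below the density\<close>

lemma nn_integral_lborel_scale:
  fixes f :: "real ^ 'd::finite \<Rightarrow> ennreal"
  assumes [measurable]: "f \<in> borel_measurable borel" and b: "b > 0"
  shows "(\<integral>\<^sup>+y. f (y /\<^sub>R b) \<partial>lborel) = ennreal (b ^ CARD('d)) * (\<integral>\<^sup>+y. f y \<partial>lborel)"
proof -
  have "(\<integral>\<^sup>+y. f (y /\<^sub>R b) \<partial>lborel)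
      = (\<integral>\<^sup>+y. f (y /\<^sub>R b) \<partial>density (distr lborel borel (\<lambda>x :: real ^ 'd. 0 + b *\<^sub>R x)) (\<lambda>_. ennreal (\<bar>b\<bar> ^ DIM(real ^ 'd))))"
    using b lborel_affine[of b "0 :: real ^ 'd"] by simp
  also have "\<dots> = ennreal (b ^ CARD('d)) * (\<integral>\<^sup>+y. f ((b *\<^sub>R y) /\<^sub>R b) \<partial>lborel)"
    using b by (simp add: nn_integral_density nn_integral_distr nn_integral_cmult)
  finally show ?thesis using b by simp
qed

text \<open>
  Each site is replaced by the unit cube \<open>Q x\<close> that it spans. On \<open>Q x\<close> the norm exceeds that of \<open>x\<close> by at
  most \<open>d\<close>, hence by a factor of at most \<open>1 + \<eta>\<close> if \<open>\<parallel>x\<parallel> \<ge> d / \<eta>\<close>; enlarging the length scale by this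
  factor makes the integrand at least as large as the summand.
\<close>
lemma lattice_sum_le_integral:
  fixes X :: "(int ^ 'd::finite) set"
  assumes X: "finite X" "\<And>x. x \<in> X \<Longrightarrow> norm (lattice_point x) \<ge> real CARD('d) / \<eta>"
    and \<eta>: "\<eta> > 0" and L: "L > 0" and \<delta>: "\<delta> > 0"
  shows "(\<Sum>x\<in>X. ennreal (exp (- real j * site_energy \<delta> L x)))
     \<le> ennreal (((1 + \<eta>) * L) ^ CARD('d)) * (\<integral>\<^sup>+y. ennreal (exp (- real j * norm (y :: real ^ 'd) powr \<delta>)) \<partial>lborel)"
proof -
  define b where "b = (1 + \<eta>) * L"
  have b: "b > 0" using \<eta> L by (simp add: b_def)
  define Q where "Q x = box (lattice_point x) (lattice_point x + (\<chi> i. 1))" for x :: "int ^ 'd"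
  define f where "f y = ennreal (exp (- real j * norm (y :: real ^ 'd) powr \<delta>))" for y
  have [measurable]: "f \<in> borel_measurable borel" unfolding f_def by measurable
  have Q_iff: "y \<in> Q x \<longleftrightarrow> (\<forall>i. real_of_int (x $ i) < y $ i \<and> y $ i < real_of_int (x $ i) + 1)" for x y
    by (simp add: Q_def mem_box_cart lattice_point_component)
  have Q_disj: "x = x'" if "y \<in> Q x" "y \<in> Q x'" for x x' y
  proof -
    have "x $ i = x' $ i" for i
    proof -
      have "real_of_int (x $ i) < y $ i" "y $ i < real_of_int (x $ i) + 1"
           "real_of_int (x' $ i) < y $ i" "y $ i < real_of_int (x' $ i) + 1"
        using that by (auto simp: Q_iff)
      then show ?thesis by linarith
    qed
    then show ?thesis by (simp add: vec_eq_iff)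
  qed
  have Q_meas: "emeasure lborel (Q x) = 1" for x
  proof -
    have "(lattice_point x + (\<chi> i. 1) - lattice_point x) \<bullet> c = 1" if "c \<in> Basis" for c :: "real ^ 'd"
      using that by (auto simp: Basis_vec_def inner_axis)
    moreover have "lattice_point x \<bullet> c \<le> (lattice_point x + (\<chi> i. 1)) \<bullet> c" if "c \<in> Basis" for c :: "real ^ 'd"
      using that by (auto simp: Basis_vec_def inner_axis)
    ultimately show ?thesis unfolding Q_def by (subst emeasure_lborel_box) auto
  qed
  have site: "ennreal (exp (- real j * site_energy \<delta> L x)) \<le> (\<integral>\<^sup>+y. f (y /\<^sub>R b) * indicator (Q x) y \<partial>lborel)"
    if x: "x \<in> X" for x
  proof -
    have "ennreal (exp (- real j * site_energy \<delta> L x)) = (\<integral>\<^sup>+y. ennreal (exp (- real j * site_energy \<delta> L x)) * indicator (Q x) y \<partial>lborel)"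
      by (subst nn_integral_cmult_indicator) (simp_all add: Q_meas, simp add: Q_def)
    also have "\<dots> \<le> (\<integral>\<^sup>+y. f (y /\<^sub>R b) * indicator (Q x) y \<partial>lborel)"
    proof (rule nn_integral_mono)
      fix y :: "real ^ 'd"
      show "ennreal (exp (- real j * site_energy \<delta> L x)) * indicator (Q x) y \<le> f (y /\<^sub>R b) * indicator (Q x) y"
      proof (cases "y \<in> Q x")
        case True
        have "norm (y - lattice_point x) \<le> (\<Sum>i\<in>UNIV. \<bar>(y - lattice_point x) $ i\<bar>)" by (rule norm_le_l1_cart)
        also have "\<dots> \<le> (\<Sum>i\<in>(UNIV :: 'd set). 1)"
        proof (rule sum_mono)
          fix i
          have "real_of_int (x $ i) < y $ i" "y $ i < real_of_int (x $ i) + 1" using True by (auto simp: Q_iff)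
          then show "\<bar>(y - lattice_point x) $ i\<bar> \<le> 1" by (simp add: lattice_point_component)
        qed
        finally have "norm (y - lattice_point x) \<le> real CARD('d)" by simp
        moreover have "real CARD('d) \<le> \<eta> * norm (lattice_point x)"
          using X(2)[OF x] \<eta> by (simp add: field_simps)
        moreover have "norm y \<le> norm (lattice_point x) + norm (y - lattice_point x)"
          using norm_triangle_ineq[of "lattice_point x" "y - lattice_point x"] by simp
        ultimately have "norm y \<le> (1 + \<eta>) * norm (lattice_point x)" by (simp add: algebra_simps)
        then have "norm y / b \<le> (1 + \<eta>) * norm (lattice_point x) / b"
          using b by (intro divide_right_mono) auto
        also have "\<dots> = norm (lattice_point x) / L" using \<eta> by (simp add: b_def)
        finally have "norm (y /\<^sub>R b) \<le> norm (lattice_point x) / L"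
          using b by (simp add: divide_inverse mult.commute)
        then have "norm (y /\<^sub>R b) powr \<delta> \<le> site_energy \<delta> L x"
          unfolding site_energy_def using \<delta> by (intro powr_mono2) auto
        then have "exp (- real j * site_energy \<delta> L x) \<le> exp (- real j * norm (y /\<^sub>R b) powr \<delta>)"
          by (simp add: mult_left_mono)
        then show ?thesis using True by (simp add: f_def ennreal_leI)
      qed simp
    qed
    finally show ?thesis .
  qed
  have "(\<Sum>x\<in>X. ennreal (exp (- real j * site_energy \<delta> L x))) \<le> (\<Sum>x\<in>X. \<integral>\<^sup>+y. f (y /\<^sub>R b) * indicator (Q x) y \<partial>lborel)"
    by (rule sum_mono) (rule site)
  also have "\<dots> = (\<integral>\<^sup>+y. (\<Sum>x\<in>X. f (y /\<^sub>R b) * indicator (Q x) y) \<partial>lborel)"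
    by (rule nn_integral_sum[symmetric]) (simp add: Q_def)
  also have "\<dots> \<le> (\<integral>\<^sup>+y. f (y /\<^sub>R b) \<partial>lborel)"
  proof (rule nn_integral_mono)
    fix y :: "real ^ 'd"
    show "(\<Sum>x\<in>X. f (y /\<^sub>R b) * indicator (Q x) y) \<le> f (y /\<^sub>R b)"
    proof (cases "\<exists>x\<in>X. y \<in> Q x")
      case True
      then obtain x where x: "x \<in> X" "y \<in> Q x" by blast
      have "(\<Sum>x\<in>X. f (y /\<^sub>R b) * indicator (Q x) y) = (\<Sum>x\<in>{x}. f (y /\<^sub>R b) * indicator (Q x) y)"
        by (rule sum.mono_neutral_right) (use X x Q_disj in \<open>auto simp: indicator_def\<close>)
      then show ?thesis using x by simp
    next
      case False
      then have "(\<Sum>x\<in>X. f (y /\<^sub>R b) * indicator (Q x) y) = 0" by (intro sum.neutral) auto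
      then show ?thesis by simp
    qed
  qed
  also have "\<dots> = ennreal (b ^ CARD('d)) * (\<integral>\<^sup>+y. f y \<partial>lborel)"
    using b by (intro nn_integral_lborel_scale) auto
  finally show ?thesis by (simp add: b_def f_def)
qed

lemma finite_lattice_ball: "finite {x :: int ^ 'd::finite. norm (lattice_point x) < K}"
proof -
  have "finite (PiE (UNIV :: 'd set) (\<lambda>_. {- \<lceil>K\<rceil>..\<lceil>K\<rceil>}))" by (intro finite_PiE) auto
  moreover have "($) ` {x :: int ^ 'd. norm (lattice_point x) < K} \<subseteq> PiE (UNIV :: 'd set) (\<lambda>_. {- \<lceil>K\<rceil>..\<lceil>K\<rceil>})"
  proof safe
    fix x :: "int ^ 'd" and i assume x: "norm (lattice_point x) < K"
    have "\<bar>lattice_point x $ i\<bar> \<le> norm (lattice_point x)" by (rule component_le_norm_cart)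
    then have "\<bar>real_of_int (x $ i)\<bar> < K" using x by (simp add: lattice_point_component)
    then show "x $ i \<in> {- \<lceil>K\<rceil>..\<lceil>K\<rceil>}" by (auto simp: abs_less_iff) linarith+
  qed auto
  ultimately have "finite (($) ` {x :: int ^ 'd. norm (lattice_point x) < K})" by (rule finite_subset[rotated])
  then show ?thesis by (rule finite_imageD) (auto simp: inj_on_def vec_eq_iff)
qed

lemma far_sites_mass_le:
  fixes V :: "real ^ 'd::finite \<Rightarrow> real" and X :: "(int ^ 'd) set"
  assumes \<delta>: "\<delta> > 0" and V: "\<And>x. V x = norm x powr \<delta>" and \<gamma>: "\<gamma> > 0"
    and \<theta>: "\<And>j. j \<ge> 1 \<Longrightarrow> \<theta> j = real j powr \<gamma>"
    and crit: "critical_density \<theta> V = ennreal R" "R \<ge> 0"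
    and X: "finite X" "0 \<notin> X" "\<And>x. x \<in> X \<Longrightarrow> norm (lattice_point x) \<ge> real CARD('d) / \<eta>"
    and \<eta>: "\<eta> > 0" and L: "L > 0"
  shows "(\<Sum>x\<in>X. power_exp_sum \<gamma> (site_energy \<delta> L x)) \<le> ((1 + \<eta>) * L) ^ CARD('d) * R"
proof -
  let ?t = "\<lambda>x j. real j powr \<gamma> * exp (- real j * site_energy \<delta> L x)"
  let ?I = "\<lambda>j. \<integral>\<^sup>+y. ennreal (exp (- real j * V y)) \<partial>lborel"
  have sums: "?t x sums power_exp_sum \<gamma> (site_energy \<delta> L x)" if "x \<in> X" for x
  proof -
    have "site_energy \<delta> L x > 0" using that X L by (intro site_energy_pos) auto
    from summable_power_exp[OF \<gamma> this] show ?thesis unfolding power_exp_sum_def by (rule summable_sums)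
  qed
  then have "(\<lambda>j. \<Sum>x\<in>X. ?t x j) sums (\<Sum>x\<in>X. power_exp_sum \<gamma> (site_energy \<delta> L x))"
    by (rule sums_sum)
  moreover have "(\<Sum>j<N. \<Sum>x\<in>X. ?t x j) \<le> ((1 + \<eta>) * L) ^ CARD('d) * R" for N
  proof -
    let ?J = "{1..<N}" and ?b = "((1 + \<eta>) * L) ^ CARD('d)"
    have "(\<Sum>j<N. \<Sum>x\<in>X. ?t x j) = (\<Sum>j\<in>?J. \<Sum>x\<in>X. ?t x j)"
      by (rule sum.mono_neutral_right) (auto simp: Suc_le_eq intro!: sum.neutral)
    then have "ennreal (\<Sum>j<N. \<Sum>x\<in>X. ?t x j) = ennreal (\<Sum>j\<in>?J. real j powr \<gamma> * (\<Sum>x\<in>X. exp (- real j * site_energy \<delta> L x)))"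
      by (simp only: sum_distrib_left)
    also have "\<dots> = (\<Sum>j\<in>?J. ennreal (real j powr \<gamma> * (\<Sum>x\<in>X. exp (- real j * site_energy \<delta> L x))))"
      by (rule sum_ennreal[symmetric]) (simp add: sum_nonneg)
    also have "\<dots> = (\<Sum>j\<in>?J. ennreal (real j powr \<gamma>) * (\<Sum>x\<in>X. ennreal (exp (- real j * site_energy \<delta> L x))))"
      by (intro sum.cong refl) (simp add: ennreal_mult sum_nonneg)
    also have "\<dots> \<le> (\<Sum>j\<in>?J. ennreal (\<theta> j) * (ennreal ?b * ?I j))"
      using lattice_sum_le_integral[OF X(1,3) \<eta> L \<delta>] \<theta> by (intro sum_mono mult_mono) (auto simp: V)
    also have "\<dots> = ennreal ?b * (\<Sum>j\<in>?J. ennreal (\<theta> j) * ?I j)"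
      by (simp add: sum_distrib_left mult_ac)
    also have "(\<Sum>j\<in>?J. ennreal (\<theta> j) * ?I j) \<le> critical_density \<theta> V"
      unfolding critical_density_def
    proof -
      let ?c = "\<lambda>j. ennreal (\<theta> j) * ?I j"
      have "infsum ?c ?J \<le> infsum ?c {1..}"
        by (rule infsum_mono_neutral) (auto intro: nonneg_summable_on_complete)
      then show "sum ?c ?J \<le> infsum ?c {1..}" by simp
    qed
    finally have "ennreal (\<Sum>j<N. \<Sum>x\<in>X. ?t x j) \<le> ennreal (?b * R)"
      using \<eta> L crit by (simp add: ennreal_mult mult_left_mono)
    then show ?thesis using \<eta> L crit by (subst (asm) ennreal_le_iff) auto
  qed
  ultimately show ?thesis
    by (metis (no_types, lifting) LIMSEQ_le_const2 sums_def)
qed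

text \<open>
  Sites with \<open>\<parallel>x\<parallel> \<ge> d / \<eta>\<close> contribute at most \<open>(1 + \<eta>)\<^sup>d \<rho>\<^sub>c L\<^sup>d\<close> by comparison with the integral, and \<open>\<eta>\<close> can be
  chosen with \<open>(1 + \<eta>)\<^sup>d \<rho>\<^sub>c < \<rho>\<close>. The finitely many other sites contribute \<open>O(L\<^sup>\<delta>\<^sup>(\<^sup>1\<^sup>+\<^sup>\<gamma>\<^sup>))\<close>, which is
  \<open>o(L\<^sup>d)\<close>.
\<close>
lemma eventually_mass_below_density:
  fixes V :: "real ^ 'd::finite \<Rightarrow> real" and L :: "nat \<Rightarrow> real"
  assumes \<delta>: "\<delta> > 0" and V: "\<And>x. V x = norm x powr \<delta>" and \<gamma>: "\<gamma> > 0"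
    and \<theta>: "\<And>j. j \<ge> 1 \<Longrightarrow> \<theta> j = real j powr \<gamma>"
    and d1: "\<delta> * (1 + \<gamma>) < real CARD('d)"
    and crit: "critical_density \<theta> V < ennreal \<rho>"
    and L: "\<And>k. L k > 0" and lim: "filterlim L at_top sequentially"
  shows "\<exists>c>0. eventually (\<lambda>k. (\<Sum>\<^sub>\<infinity>x\<in>- {0 :: int ^ 'd}. power_exp_sum \<gamma> (site_energy \<delta> (L k) x))
            \<le> (\<rho> - c) * L k ^ CARD('d)) sequentially"
proof -
  obtain R where R: "critical_density \<theta> V = ennreal R" "R \<ge> 0" "R < \<rho>"
    using crit by (cases "critical_density \<theta> V") (auto simp: ennreal_less_iff)
  have "((\<lambda>\<eta>. (1 + \<eta>) ^ CARD('d) * R) \<longlongrightarrow> (1 + 0) ^ CARD('d) * R) (at_right 0)"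
    by (intro tendsto_intros)
  then have "eventually (\<lambda>\<eta>. (1 + \<eta>) ^ CARD('d) * R < (R + \<rho>) / 2) (at_right 0)"
    by (rule order_tendstoD) (use R in simp)
  then have "eventually (\<lambda>\<eta>. (1 + \<eta>) ^ CARD('d) * R < (R + \<rho>) / 2 \<and> \<eta> > 0) (at_right 0)"
    by (rule eventually_conj[OF _ eventually_at_right_less])
  then obtain \<eta> where \<eta>: "\<eta> > 0" "(1 + \<eta>) ^ CARD('d) * R < (R + \<rho>) / 2"
    using eventually_happens'[OF trivial_limit_at_right_real] by blast
  \<comment> \<open>the sites too close to the origin for the comparison with the integral\<close>
  define S where "S = {x :: int ^ 'd. norm (lattice_point x) < real CARD('d) / \<eta>} - {0}"
  have S: "finite S" unfolding S_def using finite_lattice_ball by (rule finite_Diff)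
  let ?C = "2 * (2 * \<gamma>) powr \<gamma>"
  define D where "D = (\<Sum>x\<in>S. ?C * norm (lattice_point x) powr (- (\<delta> * (\<gamma> + 1))))"
  have D0: "D \<ge> 0" unfolding D_def by (intro sum_nonneg) auto
  have pos: "0 \<le> power_exp_sum \<gamma> (site_energy \<delta> (L k) x)" if "x \<noteq> 0" for k and x :: "int ^ 'd"
    using that by (intro power_exp_sum_nonneg \<gamma> site_energy_pos L)
  have bound: "(\<Sum>\<^sub>\<infinity>x\<in>- {0 :: int ^ 'd}. power_exp_sum \<gamma> (site_energy \<delta> (L k) x))
      \<le> D * L k powr (\<delta> * (\<gamma> + 1)) + ((1 + \<eta>) * L k) ^ CARD('d) * R" (is "_ \<le> ?B k") for k
  proof -
    have fin: "(\<Sum>x\<in>F. power_exp_sum \<gamma> (site_energy \<delta> (L k) x)) \<le> ?B k" if F: "finite F" "F \<subseteq> - {0}" for F :: "(int ^ 'd) set"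
    proof -
      have "(\<Sum>x\<in>F. power_exp_sum \<gamma> (site_energy \<delta> (L k) x)) \<le> (\<Sum>x\<in>S \<union> (F - S). power_exp_sum \<gamma> (site_energy \<delta> (L k) x))"
        using F S by (intro sum_mono2) (auto simp: S_def pos)
      also have "\<dots> = (\<Sum>x\<in>S. power_exp_sum \<gamma> (site_energy \<delta> (L k) x)) + (\<Sum>x\<in>F - S. power_exp_sum \<gamma> (site_energy \<delta> (L k) x))"
        using F S by (intro sum.union_disjoint) auto
      also have "(\<Sum>x\<in>F - S. power_exp_sum \<gamma> (site_energy \<delta> (L k) x)) \<le> ((1 + \<eta>) * L k) ^ CARD('d) * R"
        using F by (intro far_sites_mass_le[OF \<delta> V \<gamma> \<theta> R(1,2) _ _ _ \<eta>(1) L]) (auto simp: S_def not_less)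
      also have "(\<Sum>x\<in>S. power_exp_sum \<gamma> (site_energy \<delta> (L k) x)) \<le> D * L k powr (\<delta> * (\<gamma> + 1))"
        unfolding D_def sum_distrib_right
      proof (rule sum_mono)
        fix x assume "x \<in> S"
        then have x: "x \<noteq> 0" by (simp add: S_def)
        have "site_energy \<delta> (L k) x powr (- (\<gamma> + 1)) = norm (lattice_point x) powr (- (\<delta> * (\<gamma> + 1))) * L k powr (\<delta> * (\<gamma> + 1))"
          unfolding site_energy_powr[OF x L] by (simp add: algebra_simps)
        then show "power_exp_sum \<gamma> (site_energy \<delta> (L k) x) \<le> ?C * norm (lattice_point x) powr (- (\<delta> * (\<gamma> + 1))) * L k powr (\<delta> * (\<gamma> + 1))"
          using power_exp_sum_le[OF \<gamma> site_energy_pos[OF x L, of \<delta>], of k] by (simp add: mult.assoc)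
      qed
      finally show ?thesis by simp
    qed
    have "(\<lambda>x :: int ^ 'd. power_exp_sum \<gamma> (site_energy \<delta> (L k) x)) summable_on - {0}"
      by (rule nonneg_bdd_above_summable_on) (auto intro!: pos bdd_aboveI2[of _ _ "?B k"] fin)
    then show ?thesis by (rule infsum_le_finite_sums) (rule fin)
  qed
  have "((\<lambda>k. D * L k powr (\<delta> * (\<gamma> + 1) - real CARD('d))) \<longlongrightarrow> D * 0) sequentially"
    using d1 by (intro tendsto_mult tendsto_const tendsto_neg_powr lim) (simp add: algebra_simps)
  then have "eventually (\<lambda>k. D * L k powr (\<delta> * (\<gamma> + 1) - real CARD('d)) < (\<rho> - R) / 4) sequentially"
    by (rule order_tendstoD) (use R in simp)
  then have "eventually (\<lambda>k. (\<Sum>\<^sub>\<infinity>x\<in>- {0 :: int ^ 'd}. power_exp_sum \<gamma> (site_energy \<delta> (L k) x))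
            \<le> (\<rho> - (\<rho> - R) / 4) * L k ^ CARD('d)) sequentially"
  proof eventually_elim
    case (elim k)
    have Ld: "L k powr (\<delta> * (\<gamma> + 1)) = L k powr (\<delta> * (\<gamma> + 1) - real CARD('d)) * L k ^ CARD('d)"
      using L[of k] by (simp add: powr_realpow[symmetric] powr_add[symmetric])
    have "?B k = (D * L k powr (\<delta> * (\<gamma> + 1) - real CARD('d)) + (1 + \<eta>) ^ CARD('d) * R) * L k ^ CARD('d)"
      unfolding Ld power_mult_distrib by (simp add: algebra_simps)
    also have "\<dots> \<le> ((\<rho> - R) / 4 + (R + \<rho>) / 2) * L k ^ CARD('d)"
      using elim \<eta> L[of k] by (intro mult_right_mono add_mono) auto
    also have "(\<rho> - R) / 4 + (R + \<rho>) / 2 = \<rho> - (\<rho> - R) / 4" by (simp add: field_simps)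
    finally show ?case using bound[of k] by simp
  qed
  moreover have "(\<rho> - R) / 4 > 0" using R by simp
  ultimately show ?thesis by blast
qed

section \<open>Compound Poisson laws and their tilts\<close>

text \<open>
  The \<open>k\<close>-th cumulant of the compound Poisson variable \<open>\<Sum>j. j N\<^sub>j\<close> with \<open>N\<^sub>j\<close> independent of mean \<open>b j\<close>
  (for \<open>k \<ge> 1\<close>); for \<open>k = 0\<close> the expected number of jumps, which normalizes its law.
\<close>
definition moment :: "(nat \<Rightarrow> real) \<Rightarrow> nat \<Rightarrow> real" where
  "moment b k = (\<Sum>j. real j ^ k * b j)"

text \<open>
  The probabilities of this compound Poisson variable, when \<open>A\<close> is the coefficient sequence of
  \<open>exp (\<Sum>j. b j z\<^sup>j)\<close>.
\<close>
definition law :: "(nat \<Rightarrow> real) \<Rightarrow> (nat \<Rightarrow> real) \<Rightarrow> nat \<Rightarrow> real" where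
  "law A b r = exp (- moment b 0) * A r"

text \<open>
  The product of \<open>1 - x + x\<^sup>2 / 2\<close> with \<open>1 + x + x\<^sup>2 / 2 \<le> exp x\<close> is \<open>1 + x\<^sup>4 / 4 \<ge> 1\<close>.
\<close>
lemma exp_minus_le_quadratic:
  fixes x :: real
  assumes "x \<ge> 0"
  shows "exp (- x) \<le> 1 - x + x\<^sup>2 / 2"
proof -
  have q: "1 - x + x\<^sup>2 / 2 > 0"
  proof -
    have "1 - x + x\<^sup>2 / 2 = ((x - 1)\<^sup>2 + 1) / 2" by (simp add: power2_eq_square field_simps)
    also have "\<dots> > 0" by (simp add: add_nonneg_pos)
    finally show ?thesis .
  qed
  have "1 \<le> (1 - x + x\<^sup>2 / 2) * (1 + x + x\<^sup>2 / 2)"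
  proof -
    have "(1 - x + x\<^sup>2 / 2) * (1 + x + x\<^sup>2 / 2) = 1 + (x\<^sup>2)\<^sup>2 / 4"
      by (simp add: power2_eq_square field_simps)
    then show ?thesis by simp
  qed
  also have "\<dots> \<le> (1 - x + x\<^sup>2 / 2) * exp x"
    using q exp_lower_Taylor_quadratic[OF assms] by (intro mult_left_mono) auto
  finally have "1 * exp (- x) \<le> (1 - x + x\<^sup>2 / 2) * exp x * exp (- x)"
    by (rule mult_right_mono) simp
  then show ?thesis by (simp add: mult.assoc exp_add[symmetric])
qed

context
  fixes A b :: "nat \<Rightarrow> real"
  assumes A0: "A 0 = 1" and b0: "b 0 = 0" and A_nonneg: "\<And>n. A n \<ge> 0"
    and rec: "\<And>n. real n * A n = (\<Sum>j\<in>{1..n}. real j * b j * A (n - j))"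
    and b_nonneg: "\<And>j. b j \<ge> 0" and third: "summable (\<lambda>j. real j ^ 3 * b j)"
begin

lemma moment_sums:
  assumes "k \<le> 3"
  shows "(\<lambda>j. real j ^ k * b j) sums moment b k"
proof -
  have "summable (\<lambda>j. real j ^ k * b j)"
  proof (rule summable_comparison_test'[OF third, of 0])
    fix j :: nat
    show "norm (real j ^ k * b j) \<le> real j ^ 3 * b j"
    proof (cases "j = 0")
      case False
      then have "real j ^ k \<le> real j ^ 3" using assms by (intro power_increasing) auto
      then show ?thesis using b_nonneg[of j] by (simp add: mult_right_mono)
    qed (simp add: b0)
  qed
  then show ?thesis unfolding moment_def by (rule summable_sums)
qed

lemma moment_nonneg: "k \<le> 3 \<Longrightarrow> moment b k \<ge> 0"
  unfolding moment_def using moment_sums[of k] b_nonneg by (intro suminf_nonneg) (auto simp: sums_iff)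

lemma summable_b: "summable b"
  using moment_sums[of 0] by (simp add: sums_iff)

lemma law_nonneg: "law A b r \<ge> 0"
  by (simp add: law_def A_nonneg)

lemma law_laplace:
  assumes "\<alpha> \<ge> 0"
  shows "(\<lambda>r. law A b r * exp (\<alpha> * (moment b 1 - real r))) sums
           exp (\<Sum>j. b j * (exp (- (\<alpha> * real j)) - 1 + \<alpha> * real j))"
proof -
  let ?z = "exp (- \<alpha>)"
  have z: "?z \<le> 1" using assms by simp
  have sb: "summable (\<lambda>j. b j * ?z ^ j)"
  proof (rule summable_comparison_test'[OF summable_b, of 0])
    fix j show "norm (b j * ?z ^ j) \<le> b j"
      using b_nonneg z by (simp add: mult_left_le power_le_one)
  qed
  have "(\<lambda>r. of_real (A r) * (of_real ?z :: complex) ^ r) sums exp (\<Sum>j. of_real (b j) * of_real ?z ^ j)"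
    using z by (intro exponential_recurrence_sums A0 b0 rec b_nonneg summable_b) simp
  then have "(\<lambda>r. complex_of_real (A r * ?z ^ r)) sums exp (\<Sum>j. complex_of_real (b j * ?z ^ j))" by simp
  also have "(\<Sum>j. complex_of_real (b j * ?z ^ j)) = of_real (\<Sum>j. b j * ?z ^ j)"
    by (rule suminf_of_real[OF sb, symmetric])
  finally have "(\<lambda>r. complex_of_real (A r * ?z ^ r)) sums complex_of_real (exp (\<Sum>j. b j * ?z ^ j))"
    by (simp add: exp_of_real)
  then have "(\<lambda>r. A r * ?z ^ r) sums exp (\<Sum>j. b j * ?z ^ j)" by (simp only: sums_of_real_iff)
  then have "(\<lambda>r. exp (- moment b 0 + \<alpha> * moment b 1) * (A r * ?z ^ r)) sums
      (exp (- moment b 0 + \<alpha> * moment b 1) * exp (\<Sum>j. b j * ?z ^ j))" by (rule sums_mult)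
  moreover have "exp (- moment b 0 + \<alpha> * moment b 1) * (A r * ?z ^ r) = law A b r * exp (\<alpha> * (moment b 1 - real r))" for r
    by (simp add: law_def exp_add exp_diff exp_minus right_diff_distrib exp_of_nat_mult[symmetric] mult.commute field_simps)
  moreover have "(\<lambda>j. b j * ?z ^ j - real j ^ 0 * b j + \<alpha> * (real j ^ 1 * b j)) sums
      ((\<Sum>j. b j * ?z ^ j) - moment b 0 + \<alpha> * moment b 1)"
    by (intro sums_add sums_diff sums_mult moment_sums summable_sums sb) auto
  then have "(\<Sum>j. b j * (exp (- (\<alpha> * real j)) - 1 + \<alpha> * real j)) = (\<Sum>j. b j * ?z ^ j) - moment b 0 + \<alpha> * moment b 1"
    by (simp add: sums_iff algebra_simps exp_of_nat_mult[symmetric])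
  then have "exp (- moment b 0 + \<alpha> * moment b 1) * exp (\<Sum>j. b j * ?z ^ j) = exp (\<Sum>j. b j * (exp (- (\<alpha> * real j)) - 1 + \<alpha> * real j))"
    by (simp add: exp_add[symmetric])
  ultimately show ?thesis by simp
qed

lemma law_sums_1: "law A b sums 1"
  using law_laplace[of 0] by simp

text \<open>
  The lower bound is the inequality of Jensen for the centred variable, the upper bound expresses that a
  sum of positive Poisson jumps has a lower tail of Gaussian type.
\<close>
lemma laplace_exponent_bounds:
  assumes "\<alpha> \<ge> 0"
  shows "0 \<le> (\<Sum>j. b j * (exp (- (\<alpha> * real j)) - 1 + \<alpha> * real j))"
    and "(\<Sum>j. b j * (exp (- (\<alpha> * real j)) - 1 + \<alpha> * real j)) \<le> \<alpha>\<^sup>2 / 2 * moment b 2"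
proof -
  have nn: "0 \<le> b j * (exp (- (\<alpha> * real j)) - 1 + \<alpha> * real j)" for j
    using exp_ge_add_one_self[of "- (\<alpha> * real j)"] b_nonneg by (intro mult_nonneg_nonneg) auto
  have le: "b j * (exp (- (\<alpha> * real j)) - 1 + \<alpha> * real j) \<le> \<alpha>\<^sup>2 / 2 * (real j ^ 2 * b j)" for j
  proof -
    have "b j * (exp (- (\<alpha> * real j)) - 1 + \<alpha> * real j) \<le> b j * ((\<alpha> * real j)\<^sup>2 / 2)"
      using exp_minus_le_quadratic[of "\<alpha> * real j"] assms b_nonneg by (intro mult_left_mono) auto
    then show ?thesis by (simp add: power_mult_distrib mult_ac)
  qed
  have s2: "(\<lambda>j. \<alpha>\<^sup>2 / 2 * (real j ^ 2 * b j)) sums (\<alpha>\<^sup>2 / 2 * moment b 2)"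
    by (intro sums_mult moment_sums) simp
  have s: "summable (\<lambda>j. b j * (exp (- (\<alpha> * real j)) - 1 + \<alpha> * real j))"
    by (rule summable_comparison_test'[of "\<lambda>j. \<alpha>\<^sup>2 / 2 * (real j ^ 2 * b j)" 0])
       (use s2 le nn in \<open>auto simp: sums_iff\<close>)
  show "0 \<le> (\<Sum>j. b j * (exp (- (\<alpha> * real j)) - 1 + \<alpha> * real j))"
    using s nn by (rule suminf_nonneg)
  show "(\<Sum>j. b j * (exp (- (\<alpha> * real j)) - 1 + \<alpha> * real j)) \<le> \<alpha>\<^sup>2 / 2 * moment b 2"
    using suminf_le[OF le s] s2 by (simp add: sums_iff)
qed

text \<open>
  The characteristic function of the centred variable is \<open>exp\<close> of the sum of the second order remainders of
  \<open>exp\<close>; the third cumulant bounds its distance from the Gaussian exponent.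
\<close>
lemma law_char:
  shows "(\<lambda>r. of_real (law A b r) * iexp (t * (moment b 1 - real r))) sums
           exp (\<Sum>j. of_real (b j) * (iexp (- t * real j) - 1 + \<i> * of_real (t * real j)))"
    and "norm ((\<Sum>j. of_real (b j) * (iexp (- t * real j) - 1 + \<i> * of_real (t * real j))) + of_real (t\<^sup>2 / 2 * moment b 2))
           \<le> \<bar>t\<bar> ^ 3 / 6 * moment b 3"
proof -
  let ?z = "iexp (- t)"
  let ?T = "\<lambda>j. of_real (b j) * (iexp (- t * real j) - 1 + \<i> * of_real (t * real j))"
  have zpow: "?z ^ j = iexp (- t * real j)" for j
    by (simp add: exp_of_nat_mult[symmetric] mult_ac)
  have sb: "summable (\<lambda>j. of_real (b j) * ?z ^ j)"
  proof (rule summable_comparison_test'[OF summable_b, of 0])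
    fix j show "norm (of_real (b j) * ?z ^ j) \<le> b j"
      using b_nonneg by (simp add: norm_mult norm_power)
  qed
  have main: "(\<lambda>r. of_real (A r) * ?z ^ r) sums exp (\<Sum>j. of_real (b j) * ?z ^ j)"
    by (intro exponential_recurrence_sums A0 b0 rec b_nonneg summable_b) simp
  let ?c = "- of_real (moment b 0) + \<i> * of_real t * of_real (moment b 1)"
  from main have "(\<lambda>r. exp ?c * (of_real (A r) * ?z ^ r)) sums (exp ?c * exp (\<Sum>j. of_real (b j) * ?z ^ j))"
    by (rule sums_mult)
  moreover have "exp ?c * (of_real (A r) * ?z ^ r) = of_real (law A b r) * iexp (t * (moment b 1 - real r))" for r
  proof -
    have "of_real (law A b r) * iexp (t * (moment b 1 - real r))
       = of_real (A r) * (exp (of_real (- moment b 0)) * iexp (t * (moment b 1 - real r)))"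
      by (simp add: law_def exp_of_real[symmetric] mult_ac)
    also have "exp (of_real (- moment b 0)) * iexp (t * (moment b 1 - real r)) = exp ?c * iexp (- t * real r)"
      by (simp add: exp_add[symmetric] algebra_simps)
    finally show ?thesis unfolding zpow by (simp only: mult_ac)
  qed
  moreover have "(\<lambda>j. of_real (b j) * ?z ^ j - of_real (real j ^ 0 * b j) + \<i> * of_real t * of_real (real j ^ 1 * b j)) sums
      ((\<Sum>j. of_real (b j) * ?z ^ j) - of_real (moment b 0) + \<i> * of_real t * of_real (moment b 1))"
    by (intro sums_add sums_diff sums_mult sums_of_real moment_sums summable_sums sb) auto
  then have T: "?T sums ((\<Sum>j. of_real (b j) * ?z ^ j) - of_real (moment b 0) + \<i> * of_real t * of_real (moment b 1))"
    unfolding zpow by (simp add: algebra_simps)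
  then have "(\<Sum>j. ?T j) = ?c + (\<Sum>j. of_real (b j) * ?z ^ j)"
  proof -
    have "x - y + w = (- y + w) + x" for x y w :: complex by simp
    then show ?thesis using sums_unique[OF T, symmetric] by metis
  qed
  then have "exp ?c * exp (\<Sum>j. of_real (b j) * ?z ^ j) = exp (\<Sum>j. ?T j)"
    by (simp only: exp_add)
  ultimately show "(\<lambda>r. of_real (law A b r) * iexp (t * (moment b 1 - real r))) sums exp (\<Sum>j. ?T j)" by simp
  have "(\<lambda>j. of_real (t\<^sup>2 / 2 * (real j ^ 2 * b j)) :: complex) sums of_real (t\<^sup>2 / 2 * moment b 2)"
    by (intro sums_of_real sums_mult moment_sums) simp
  from sums_add[OF T this]
  have "(\<lambda>j. ?T j + of_real (t\<^sup>2 / 2 * (real j ^ 2 * b j))) sums ((\<Sum>j. ?T j) + of_real (t\<^sup>2 / 2 * moment b 2))"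
    using T by (simp add: sums_iff)
  moreover have "norm (?T j + of_real (t\<^sup>2 / 2 * (real j ^ 2 * b j))) \<le> \<bar>t\<bar> ^ 3 / 6 * (real j ^ 3 * b j)" for j
  proof -
    let ?x = "- t * real j"
    have "norm (iexp ?x - (\<Sum>k\<le>2. (\<i> * ?x) ^ k / fact k)) \<le> \<bar>?x\<bar> ^ Suc 2 / fact (Suc 2)"
      by (rule iexp_approx1)
    also have "(\<Sum>k\<le>2. (\<i> * complex_of_real ?x) ^ k / fact k) = 1 - \<i> * of_real (t * real j) - of_real (t\<^sup>2 / 2 * real j ^ 2)"
      by (simp add: eval_nat_numeral) (simp add: field_simps)
    also have "\<bar>?x\<bar> ^ Suc 2 / fact (Suc 2) = \<bar>t\<bar> ^ 3 / 6 * real j ^ 3"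
      by (simp add: abs_mult power_mult_distrib eval_nat_numeral fact_numeral)
    finally have "b j * norm (iexp ?x - (1 - \<i> * of_real (t * real j) - of_real (t\<^sup>2 / 2 * real j ^ 2))) \<le> b j * (\<bar>t\<bar> ^ 3 / 6 * real j ^ 3)"
      using b_nonneg by (rule mult_left_mono)
    moreover have "?T j + of_real (t\<^sup>2 / 2 * (real j ^ 2 * b j))
        = of_real (b j) * (iexp ?x - (1 - \<i> * of_real (t * real j) - of_real (t\<^sup>2 / 2 * real j ^ 2)))"
      by (simp add: algebra_simps)
    ultimately show ?thesis using b_nonneg[of j] by (simp add: norm_mult mult_ac del: of_real_mult of_real_power of_real_divide)
  qed
  moreover have "(\<lambda>j. \<bar>t\<bar> ^ 3 / 6 * (real j ^ 3 * b j)) sums (\<bar>t\<bar> ^ 3 / 6 * moment b 3)"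
    by (intro sums_mult moment_sums) simp
  ultimately show "norm ((\<Sum>j. ?T j) + of_real (t\<^sup>2 / 2 * moment b 2)) \<le> \<bar>t\<bar> ^ 3 / 6 * moment b 3"
    by - (rule norm_sums_le)
qed

text \<open>
  With \<open>X = exp (\<alpha> (N - R)) - 1\<close>, the bounds on the Laplace transform at \<open>\<alpha>\<close> and \<open>2 \<alpha>\<close> give
  \<open>E X\<^sup>2 = E exp (2 \<alpha> (N - R)) - 2 E exp (\<alpha> (N - R)) + 1 \<le> exp (2 \<alpha> + 2 \<alpha>\<^sup>2 Var R) - 1\<close>, and \<open>(E \<bar>X\<bar>)\<^sup>2 \<le> E X\<^sup>2\<close>.
  The centre \<open>N\<close> is allowed to differ from the mean because it will be an integer.
\<close>
lemma law_exp_deviation: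
  assumes \<alpha>: "\<alpha> > 0" and N: "moment b 1 \<le> N" "N \<le> moment b 1 + 1"
  shows "summable (\<lambda>r. law A b r * \<bar>exp (\<alpha> * (N - real r)) - 1\<bar>)"
    and "(\<Sum>r. law A b r * \<bar>exp (\<alpha> * (N - real r)) - 1\<bar>) \<le> sqrt (exp (2 * \<alpha> + 2 * \<alpha>\<^sup>2 * moment b 2) - 1)"
proof -
  define X where "X r = exp (\<alpha> * (N - real r)) - 1" for r
  define D where "D = exp (2 * \<alpha> + 2 * \<alpha>\<^sup>2 * moment b 2) - 1"
  \<comment> \<open>the minimizer of \<open>(D / \<kappa> + \<kappa>) / 2\<close>, which bounds \<open>E \<bar>X\<bar>\<close>\<close>
  define \<kappa> where "\<kappa> = sqrt D"
  have "2 * \<alpha> + 2 * \<alpha>\<^sup>2 * moment b 2 > 0" using \<alpha> moment_nonneg[of 2] by (intro add_pos_nonneg) auto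
  then have D: "D > 0" by (simp add: D_def)
  then have \<kappa>: "\<kappa> > 0" "\<kappa> * \<kappa> = D" by (auto simp: \<kappa>_def)
  have shifted: "\<exists>E. (\<lambda>r. law A b r * exp (\<beta> * (N - real r))) sums E \<and> 1 \<le> E \<and> E \<le> exp (\<beta> + \<beta>\<^sup>2 / 2 * moment b 2)"
    if \<beta>: "\<beta> \<ge> 0" for \<beta>
  proof (intro exI conjI)
    let ?e = "\<Sum>j. b j * (exp (- (\<beta> * real j)) - 1 + \<beta> * real j)"
    have "(\<lambda>r. exp (\<beta> * (N - moment b 1)) * (law A b r * exp (\<beta> * (moment b 1 - real r)))) sums (exp (\<beta> * (N - moment b 1)) * exp ?e)"
      by (intro sums_mult law_laplace \<beta>)
    moreover have "exp (\<beta> * (N - moment b 1)) * (law A b r * exp (\<beta> * (moment b 1 - real r))) = law A b r * exp (\<beta> * (N - real r))" for r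
    proof -
      have "exp (\<beta> * (N - moment b 1)) * exp (\<beta> * (moment b 1 - real r)) = exp (\<beta> * (N - real r))"
        by (simp add: exp_add[symmetric] algebra_simps)
      then show ?thesis by (metis mult.left_commute)
    qed
    ultimately show "(\<lambda>r. law A b r * exp (\<beta> * (N - real r))) sums exp (\<beta> * (N - moment b 1) + ?e)"
      by (simp only: exp_add)
    have "0 \<le> \<beta> * (N - moment b 1)" using \<beta> N by simp
    then show "1 \<le> exp (\<beta> * (N - moment b 1) + ?e)"
      using laplace_exponent_bounds(1)[OF \<beta>] by simp
    have "\<beta> * (N - moment b 1) \<le> \<beta> * 1" using \<beta> N by (intro mult_left_mono) auto
    then show "exp (\<beta> * (N - moment b 1) + ?e) \<le> exp (\<beta> + \<beta>\<^sup>2 / 2 * moment b 2)"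
      using laplace_exponent_bounds(2)[OF \<beta>] by simp
  qed
  obtain E1 where E1: "(\<lambda>r. law A b r * exp (\<alpha> * (N - real r))) sums E1" "1 \<le> E1"
    using shifted[of \<alpha>] \<alpha> by auto
  obtain E2 where E2: "(\<lambda>r. law A b r * exp (2 * \<alpha> * (N - real r))) sums E2" "E2 \<le> D + 1"
    using shifted[of "2 * \<alpha>"] \<alpha> by (auto simp: D_def power_mult_distrib)
  have sq: "(\<lambda>r. law A b r * (X r)\<^sup>2) sums (E2 - 2 * E1 + 1)"
  proof -
    have "(\<lambda>r. law A b r * exp (2 * \<alpha> * (N - real r)) - 2 * (law A b r * exp (\<alpha> * (N - real r))) + law A b r)
        sums (E2 - 2 * E1 + 1)"
      by (intro sums_add sums_diff sums_mult E1 E2 law_sums_1)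
    moreover have "law A b r * exp (2 * \<alpha> * (N - real r)) - 2 * (law A b r * exp (\<alpha> * (N - real r))) + law A b r
        = law A b r * (X r)\<^sup>2" for r
    proof -
      have "exp (2 * \<alpha> * (N - real r)) = exp (\<alpha> * (N - real r)) * exp (\<alpha> * (N - real r))"
        by (simp add: exp_add[symmetric])
      then show ?thesis by (simp add: X_def power2_eq_square algebra_simps)
    qed
    ultimately show ?thesis by simp
  qed
  have maj: "(\<lambda>r. (law A b r * (X r)\<^sup>2 / \<kappa> + \<kappa> * law A b r) / 2) sums (((E2 - 2 * E1 + 1) / \<kappa> + \<kappa> * 1) / 2)"
    by (intro sums_divide sums_add sums_mult sq law_sums_1)
  have le: "law A b r * \<bar>X r\<bar> \<le> (law A b r * (X r)\<^sup>2 / \<kappa> + \<kappa> * law A b r) / 2" for r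
  proof -
    have "0 \<le> (\<bar>X r\<bar> - \<kappa>)\<^sup>2" by simp
    then have "2 * \<kappa> * \<bar>X r\<bar> \<le> (X r)\<^sup>2 + \<kappa>\<^sup>2" by (simp add: power2_diff mult_ac)
    then have "\<bar>X r\<bar> \<le> ((X r)\<^sup>2 / \<kappa> + \<kappa>) / 2" using \<kappa>(1) by (simp add: field_simps power2_eq_square)
    then have "law A b r * \<bar>X r\<bar> \<le> law A b r * (((X r)\<^sup>2 / \<kappa> + \<kappa>) / 2)"
      by (rule mult_left_mono) (rule law_nonneg)
    then show ?thesis by (simp add: field_simps)
  qed
  show s: "summable (\<lambda>r. law A b r * \<bar>exp (\<alpha> * (N - real r)) - 1\<bar>)"
    unfolding X_def[symmetric]
    by (rule summable_comparison_test'[of "\<lambda>r. (law A b r * (X r)\<^sup>2 / \<kappa> + \<kappa> * law A b r) / 2" 0])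
       (use maj le law_nonneg in \<open>auto simp: sums_iff abs_mult\<close>)
  have "(\<Sum>r. law A b r * \<bar>X r\<bar>) \<le> ((E2 - 2 * E1 + 1) / \<kappa> + \<kappa> * 1) / 2"
    by (rule sums_le[OF le summable_sums[OF s[folded X_def]] maj])
  also have "\<dots> \<le> (D / \<kappa> + \<kappa>) / 2"
    using E1 E2 \<kappa>(1) by (auto intro!: divide_right_mono)
  also have "\<dots> = \<kappa>" using \<kappa> by (simp add: field_simps)
  finally show "(\<Sum>r. law A b r * \<bar>exp (\<alpha> * (N - real r)) - 1\<bar>) \<le> sqrt (exp (2 * \<alpha> + 2 * \<alpha>\<^sup>2 * moment b 2) - 1)"
    by (simp add: X_def \<kappa>_def D_def)
qed

end

lemma abs_deviation_le:
  fixes e w :: real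
  shows "1 \<le> w \<Longrightarrow> w \<le> e \<Longrightarrow> \<bar>w - 1\<bar> \<le> 2 * \<bar>e - 1\<bar>"
    and "e \<le> w \<Longrightarrow> w \<le> 1 \<Longrightarrow> \<bar>w - 1\<bar> \<le> 2 * \<bar>e - 1\<bar>"
    and "e \<le> 1 / 2 \<Longrightarrow> 0 \<le> w \<Longrightarrow> w \<le> 1 \<Longrightarrow> \<bar>w - 1\<bar> \<le> 2 * \<bar>e - 1\<bar>"
  by (auto simp: abs_if)

text \<open>
  For \<open>n - r \<ge> m0 - m0 div 2\<close> the ratio lies between \<open>1\<close> and \<open>exp (\<alpha> Y)\<close>, where \<open>Y = n - m0 - r\<close>. For smaller
  \<open>n - r\<close> the growth bound is not available, but there \<open>exp (\<alpha> Y) \<le> 1 / 2\<close> while the ratio is in \<open>[0, 1]\<close>, and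
  the factor \<open>2\<close> suffices.
\<close>
lemma density_ratio_bound:
  fixes h :: "nat \<Rightarrow> real"
  assumes mono: "\<And>m n. m \<le> n \<Longrightarrow> h m \<le> h n" and ge1: "\<And>m. h m \<ge> 1"
    and growth: "\<And>m u. m0 - m0 div 2 \<le> m \<Longrightarrow> h (m + u) \<le> exp (\<alpha> * real u) * h m"
    and \<alpha>: "\<alpha> > 0" "1 \<le> \<alpha> * real (m0 div 2)" and m0: "m0 \<le> n"
  shows "\<bar>(if r \<le> n then h (n - r) / h m0 else 0) - 1\<bar> \<le> 2 * \<bar>exp (\<alpha> * (real (n - m0) - real r)) - 1\<bar>"
proof -
  have pos: "h m > 0" for m using ge1[of m] by linarith
  let ?Y = "real (n - m0) - real r"
  consider (up) "r \<le> n - m0" | (mid) "n - m0 < r" "r \<le> n - m0 + m0 div 2" | (low) "n - m0 + m0 div 2 < r"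
    by linarith
  then show ?thesis
  proof cases
    case up
    have r: "r \<le> n" using up by linarith
    have eq: "n - r = m0 + (n - m0 - r)" using up m0 by linarith
    have "h (n - r) \<le> exp (\<alpha> * real (n - m0 - r)) * h m0"
      unfolding eq by (rule growth) simp
    also have "real (n - m0 - r) = ?Y" using up by (rule of_nat_diff)
    finally have "h (n - r) / h m0 \<le> exp (\<alpha> * ?Y)" using pos[of m0] by (simp add: pos_divide_le_eq)
    moreover have "1 \<le> h (n - r) / h m0" using mono[of m0 "n - r"] eq pos[of m0] by (simp add: field_simps)
    ultimately show ?thesis unfolding if_P[OF r] by (rule abs_deviation_le(1)[rotated])
  next
    case mid
    have r: "r \<le> n" using mid m0 by linarith
    have eq: "m0 = (n - r) + (r - (n - m0))" using mid m0 by linarith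
    have "h m0 \<le> exp (\<alpha> * real (r - (n - m0))) * h (n - r)"
      by (subst eq, rule growth) (use mid m0 in linarith)
    also have "real (r - (n - m0)) = - ?Y" using mid by (simp add: of_nat_diff)
    finally have "exp (\<alpha> * ?Y) * h m0 \<le> exp (\<alpha> * ?Y) * (exp (\<alpha> * - ?Y) * h (n - r))"
      by (rule mult_left_mono) simp
    also have "\<dots> = h (n - r)" by (simp add: mult.assoc[symmetric] exp_add[symmetric] del: mult_minus_right) (simp add: algebra_simps)
    finally have "exp (\<alpha> * ?Y) \<le> h (n - r) / h m0" using pos[of m0] by (simp add: field_simps)
    moreover have "h (n - r) / h m0 \<le> 1" using mono[of "n - r" m0] eq pos[of m0] by (simp add: field_simps)
    ultimately show ?thesis unfolding if_P[OF r] by (rule abs_deviation_le(2))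
  next
    case low
    have Y: "?Y \<le> - real (m0 div 2)" using low by linarith
    have "\<alpha> * ?Y \<le> \<alpha> * - real (m0 div 2)" using \<alpha> Y by (intro mult_left_mono) auto
    then have "\<alpha> * ?Y \<le> - 1" using \<alpha> by simp
    then have "exp (\<alpha> * ?Y) \<le> exp (- 1)" by simp
    also have "\<dots> \<le> 1 / 2"
      using exp_ge_add_one_self[of 1] by (simp add: exp_minus inverse_eq_divide field_simps)
    finally have e: "exp (\<alpha> * ?Y) \<le> 1 / 2" .
    have "0 \<le> (if r \<le> n then h (n - r) / h m0 else 0)" "(if r \<le> n then h (n - r) / h m0 else 0) \<le> 1"
      using low mono[of "n - r" m0] pos[of m0] pos[of "n - r"] by (auto simp: less_imp_le)
    then show ?thesis by (rule abs_deviation_le(3)[OF e])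
  qed
qed

section \<open>The occupation of the origin under the partition measure\<close>

lemma occupation_le:
  assumes "l \<in> spatial_partitions n"
  shows "occupation x l \<le> n"
proof (cases "x \<in> occupied l")
  case True
  have "occupation x l \<le> (\<Sum>x\<in>occupied l. occupation x l)"
    using assms True by (intro member_le_sum) (auto simp: spatial_partitions_def)
  then show ?thesis using assms by (simp add: spatial_partitions_def)
qed (simp add: occupied_iff occupation_def)

lemma weight_eq_poisson_weight:
  "weight \<theta> V L = poisson_weight (\<lambda>x j. \<theta> j / real j * exp (- real j * V (lattice_point x /\<^sub>R L)))"
  by (simp add: fun_eq_iff weight_def poisson_weight_def)

context
  fixes \<theta> :: "nat \<Rightarrow> real" and V :: "real ^ 'd::finite \<Rightarrow> real" and L :: real
    and u :: "int ^ 'd \<Rightarrow> nat \<Rightarrow> real" and h A :: "nat \<Rightarrow> real" and n :: nat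
  assumes u_def: "u = (\<lambda>x j. \<theta> j / real j * exp (- real j * V (lattice_point x /\<^sub>R L)))"
    and u_nonneg: "\<And>x j. u x j \<ge> 0"
    and h: "\<And>m. total_weight u {0} m = ennreal (h m)" and h_pos: "\<And>m. h m > 0"
    and A: "\<And>r. total_weight u (- {0}) r = ennreal (A r)" and A_nonneg: "\<And>r. A r \<ge> 0" and A0: "A 0 = 1"
begin

lemma weight_nonneg: "weight \<theta> V L l \<ge> 0"
  unfolding weight_eq_poisson_weight u_def[symmetric] by (rule poisson_weight_nonneg) (rule u_nonneg)

lemma weight_origin_split:
  assumes "m \<le> n"
  shows "(\<integral>\<^sup>+l. ennreal (weight \<theta> V L l) * indicator {l. occupation 0 l = m} l \<partial>count_space (spatial_partitions n))
    = ennreal (h m * A (n - m))"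
proof -
  have "(\<integral>\<^sup>+l. ennreal (weight \<theta> V L l) * indicator {l. occupation 0 l = m} l \<partial>count_space (spatial_partitions n))
      = (\<integral>\<^sup>+l. ennreal (weight \<theta> V L l) \<partial>count_space {l \<in> spatial_partitions n. occupation 0 l = m})"
    by (simp only: nn_integral_count_space_UNIV[where C = "spatial_partitions n"]
        nn_integral_count_space_UNIV[where C = "{l \<in> spatial_partitions n. occupation 0 l = m}"])
       (auto intro!: nn_integral_cong simp: indicator_def)
  also have "\<dots> = total_weight u {0} m * total_weight u (- {0}) (n - m)"
    unfolding weight_eq_poisson_weight u_def[symmetric] by (rule total_weight_at_origin[OF u_nonneg assms])
  finally show ?thesis unfolding h A using h_pos[of m] A_nonneg by (simp add: ennreal_mult)
qed

text \<open>
  The partition function, see \<open>partition_function_eq\<close>.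
\<close>
definition convolution_total :: real where
  "convolution_total = (\<Sum>m\<le>n. h m * A (n - m))"

lemma total_pos: "convolution_total > 0"
proof -
  have "0 < h n * A (n - n)" using h_pos A0 by simp
  also have "\<dots> \<le> convolution_total" unfolding convolution_total_def
    using less_imp_le[OF h_pos] A_nonneg by (intro member_le_sum) auto
  finally show ?thesis .
qed

lemma nn_integral_weight:
  "(\<integral>\<^sup>+l. ennreal (weight \<theta> V L l) \<partial>count_space (spatial_partitions n)) = ennreal convolution_total"
proof -
  have "(\<integral>\<^sup>+l. ennreal (weight \<theta> V L l) \<partial>count_space (spatial_partitions n))
     = (\<integral>\<^sup>+l. (\<Sum>m\<le>n. ennreal (weight \<theta> V L l) * indicator {l. occupation 0 l = m} l) \<partial>count_space (spatial_partitions n))"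
  proof (rule nn_integral_cong)
    fix l :: "'d spatial_family" assume "l \<in> space (count_space (spatial_partitions n))"
    then have "occupation 0 l \<le> n" using occupation_le by auto
    then show "ennreal (weight \<theta> V L l) = (\<Sum>m\<le>n. ennreal (weight \<theta> V L l) * indicator {l. occupation 0 l = m} l)"
      by (simp add: indicator_def sum.delta if_distrib cong: if_cong)
  qed
  also have "\<dots> = (\<Sum>m\<le>n. \<integral>\<^sup>+l. ennreal (weight \<theta> V L l) * indicator {l. occupation 0 l = m} l \<partial>count_space (spatial_partitions n))"
    by (rule nn_integral_sum) simp
  also have "\<dots> = (\<Sum>m\<le>n. ennreal (h m * A (n - m)))"
    by (intro sum.cong refl weight_origin_split) simp
  also have "\<dots> = ennreal convolution_total"
    unfolding convolution_total_def using less_imp_le[OF h_pos] A_nonneg by (intro sum_ennreal) auto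
  finally show ?thesis .
qed

lemma partition_function_eq: "partition_function \<theta> V L n = convolution_total"
proof -
  have int: "integrable (count_space (spatial_partitions n)) (weight \<theta> V L)"
    by (rule integrableI_nonneg) (use nn_integral_weight weight_nonneg in auto)
  then have *: "Infinite_Set_Sum.abs_summable_on (weight \<theta> V L) (spatial_partitions n)"
    by (simp add: Infinite_Set_Sum.abs_summable_on_def)
  have "partition_function \<theta> V L n = (\<integral>l. weight \<theta> V L l \<partial>count_space (spatial_partitions n))"
    unfolding partition_function_def infsetsum_infsum[OF *, symmetric] infsetsum_def ..
  also have "\<dots> = convolution_total"
    using nn_integral_weight weight_nonneg total_pos by (subst integral_eq_nn_integral) auto
  finally show ?thesis .
qed

lemma space_partition_measure: "space (partition_measure \<theta> V L n) = spatial_partitions n"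
  and sets_partition_measure: "sets (partition_measure \<theta> V L n) = Pow (spatial_partitions n)"
  by (simp_all add: partition_measure_def space_point_measure sets_point_measure)

lemma emeasure_partition_measure:
  assumes "S \<subseteq> spatial_partitions n"
  shows "emeasure (partition_measure \<theta> V L n) S
    = (\<integral>\<^sup>+l. ennreal (weight \<theta> V L l) * indicator S l \<partial>count_space (spatial_partitions n)) / ennreal convolution_total"
proof -
  have "emeasure (partition_measure \<theta> V L n) S
     = (\<integral>\<^sup>+l. ennreal (weight \<theta> V L l / convolution_total) * indicator S l \<partial>count_space (spatial_partitions n))"
    unfolding partition_measure_def point_measure_def partition_function_eq
    using assms by (intro emeasure_density) auto
  also have "\<dots> = (\<integral>\<^sup>+l. ennreal (weight \<theta> V L l) * indicator S l / ennreal convolution_total \<partial>count_space (spatial_partitions n))"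
    using total_pos weight_nonneg
    by (intro nn_integral_cong) (auto simp: indicator_def divide_ennreal)
  also have "\<dots> = (\<integral>\<^sup>+l. ennreal (weight \<theta> V L l) * indicator S l \<partial>count_space (spatial_partitions n)) / ennreal convolution_total"
    by (rule nn_integral_divide) simp
  finally show ?thesis .
qed

lemma prob_space_partition_measure: "prob_space (partition_measure \<theta> V L n)"
proof (rule prob_spaceI)
  have "(\<integral>\<^sup>+l. ennreal (weight \<theta> V L l) * indicator (spatial_partitions n) l \<partial>count_space (spatial_partitions n)) = ennreal convolution_total"
    unfolding nn_integral_weight[symmetric] by (rule nn_integral_cong) simp
  then show "emeasure (partition_measure \<theta> V L n) (space (partition_measure \<theta> V L n)) = 1"
    using total_pos by (simp add: space_partition_measure emeasure_partition_measure ennreal_divide_self)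
qed

lemma measure_occupation:
  assumes "m \<le> n"
  shows "measure (partition_measure \<theta> V L n) {l \<in> spatial_partitions n. occupation 0 l = m} = h m * A (n - m) / convolution_total"
proof -
  have "(\<integral>\<^sup>+l. ennreal (weight \<theta> V L l) * indicator {l \<in> spatial_partitions n. occupation 0 l = m} l \<partial>count_space (spatial_partitions n))
     = ennreal (h m * A (n - m))"
    unfolding weight_origin_split[OF assms, symmetric] by (rule nn_integral_cong) (simp add: indicator_def)
  then have "emeasure (partition_measure \<theta> V L n) {l \<in> spatial_partitions n. occupation 0 l = m} = ennreal (h m * A (n - m) / convolution_total)"
    using total_pos h_pos[of m] A_nonneg by (subst emeasure_partition_measure) (auto simp: divide_ennreal)
  then show ?thesis using total_pos h_pos[of m] A_nonneg by (simp add: measure_def)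
qed

lemma measurable_partition_measure: "f \<in> partition_measure \<theta> V L n \<rightarrow>\<^sub>M borel"
  by (simp add: partition_measure_def)

lemma real_distribution_occupation:
  "real_distribution (distr (partition_measure \<theta> V L n) borel f)"
proof -
  interpret prob_space "partition_measure \<theta> V L n" by (rule prob_space_partition_measure)
  show ?thesis by (rule real_distribution_distr) (rule measurable_partition_measure)
qed

text \<open>
  The measure enters the limit theorem only through this finite sum.
\<close>
lemma char_occupation:
  "char (distr (partition_measure \<theta> V L n) borel (\<lambda>l. F (occupation 0 l))) t
     = (\<Sum>m\<le>n. of_real (h m * A (n - m) / convolution_total) * iexp (t * F m))"
proof -
  interpret prob_space "partition_measure \<theta> V L n" by (rule prob_space_partition_measure)
  let ?S = "\<lambda>m. {l \<in> spatial_partitions n. occupation 0 l = m}"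
  have S: "?S m \<in> sets (partition_measure \<theta> V L n)" for m by (auto simp: sets_partition_measure)
  have "char (distr (partition_measure \<theta> V L n) borel (\<lambda>l. F (occupation 0 l))) t
     = (\<integral>l. iexp (t * F (occupation 0 l)) \<partial>partition_measure \<theta> V L n)"
    unfolding char_def by (rule integral_distr) (auto intro: measurable_partition_measure)
  also have "\<dots> = (\<integral>l. (\<Sum>m\<le>n. indicator (?S m) l *\<^sub>R iexp (t * F m)) \<partial>partition_measure \<theta> V L n)"
  proof (rule Bochner_Integration.integral_cong[OF refl])
    fix l assume "l \<in> space (partition_measure \<theta> V L n)"
    then have l: "l \<in> spatial_partitions n" by (simp add: space_partition_measure)
    then have le: "occupation 0 l \<le> n" by (rule occupation_le)
    have "(\<Sum>m\<le>n. indicator (?S m) l *\<^sub>R iexp (t * F m)) = (\<Sum>m\<in>{occupation 0 l}. indicator (?S m) l *\<^sub>R iexp (t * F m))"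
      by (rule sum.mono_neutral_right) (use le in auto)
    then show "iexp (t * F (occupation 0 l)) = (\<Sum>m\<le>n. indicator (?S m) l *\<^sub>R iexp (t * F m))"
      using l by simp
  qed
  also have "\<dots> = (\<Sum>m\<le>n. \<integral>l. indicator (?S m) l *\<^sub>R iexp (t * F m) \<partial>partition_measure \<theta> V L n)"
    using S by (intro Bochner_Integration.integral_sum integrable_scaleR_left) (simp add: emeasure_eq_measure)
  also have "\<dots> = (\<Sum>m\<le>n. measure (partition_measure \<theta> V L n) (?S m) *\<^sub>R iexp (t * F m))"
  proof (intro sum.cong refl)
    fix m
    have "(\<integral>l. indicator (?S m) l *\<^sub>R iexp (t * F m) \<partial>partition_measure \<theta> V L n)
       = (\<integral>l. indicator (?S m) l \<partial>partition_measure \<theta> V L n) *\<^sub>R iexp (t * F m)"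
      using S by (intro integral_scaleR_left) (simp add: emeasure_eq_measure)
    also have "(\<integral>l. indicator (?S m) l \<partial>partition_measure \<theta> V L n) = measure (partition_measure \<theta> V L n) (?S m)"
      using S[THEN sets.sets_into_space] by (simp add: Int_absorb1 Int_commute space_partition_measure)
    finally show "(\<integral>l. indicator (?S m) l *\<^sub>R iexp (t * F m) \<partial>partition_measure \<theta> V L n)
      = measure (partition_measure \<theta> V L n) (?S m) *\<^sub>R iexp (t * F m)" .
  qed
  also have "\<dots> = (\<Sum>m\<le>n. of_real (h m * A (n - m) / convolution_total) * iexp (t * F m))"
    by (intro sum.cong refl) (simp add: measure_occupation scaleR_conv_of_real)
  finally show ?thesis .
qed

end

section \<open>The partition measure as a tilted compound Poisson law\<close>

definition part_weight :: "(nat \<Rightarrow> real) \<Rightarrow> (real ^ 'd::finite \<Rightarrow> real) \<Rightarrow> real \<Rightarrow> int ^ 'd \<Rightarrow> nat \<Rightarrow> real" where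
  "part_weight \<theta> V L = (\<lambda>x j. \<theta> j / real j * exp (- real j * V (lattice_point x /\<^sub>R L)))"

definition origin_weight :: "(nat \<Rightarrow> real) \<Rightarrow> (real ^ 'd::finite \<Rightarrow> real) \<Rightarrow> real \<Rightarrow> nat \<Rightarrow> real" where
  "origin_weight \<theta> V L m = enn2real (total_weight (part_weight \<theta> V L) {0} m)"

definition outer_weight :: "(nat \<Rightarrow> real) \<Rightarrow> (real ^ 'd::finite \<Rightarrow> real) \<Rightarrow> real \<Rightarrow> nat \<Rightarrow> real" where
  "outer_weight \<theta> V L r = enn2real (total_weight (part_weight \<theta> V L) (- {0}) r)"

text \<open>
  With these rates, \<open>moment\<close> and \<open>law\<close> describe the mass of all sites but the origin: its jumps of size \<open>j\<close> have the
  total intensity \<open>\<Sum>x\<noteq>0. \<theta> j / j * exp (- j V (x / L))\<close>.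
\<close>
definition outer_rate :: "'d::finite itself \<Rightarrow> real \<Rightarrow> real \<Rightarrow> real \<Rightarrow> nat \<Rightarrow> real" where
  "outer_rate T \<delta> \<gamma> L j = real j powr \<gamma> * lattice_exp_sum T \<delta> L j / real j"

text \<open>
  Finiteness of the total weights comes for free from the recurrence, which expresses each of them by finitely
  many earlier ones.
\<close>
lemma ennreal_recurrence:
  fixes T :: "nat \<Rightarrow> ennreal" and c :: "nat \<Rightarrow> real"
  assumes T0: "T 0 = 1" and c: "\<And>j. c j \<ge> 0"
    and rec: "\<And>n. of_nat n * T n = (\<Sum>j\<in>{1..n}. ennreal (c j) * T (n - j))"
  shows "T n = ennreal (enn2real (T n))"
    and "real n * enn2real (T n) = (\<Sum>j\<in>{1..n}. c j * enn2real (T (n - j)))"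
proof -
  have fin: "T n < \<infinity>" for n
  proof (induction n rule: less_induct)
    case (less n)
    show ?case
    proof (cases "n = 0")
      case False
      have "of_nat n * T n < \<infinity>"
        unfolding rec using less by (auto simp: ennreal_mult_less_top)
      then show ?thesis using False by (auto simp: ennreal_mult_less_top)
    qed (simp add: T0)
  qed
  then show eq: "T n = ennreal (enn2real (T n))" for n by simp
  have "ennreal (real n * enn2real (T n)) = of_nat n * T n"
    using fin[of n] by (simp add: ennreal_mult ennreal_of_nat_eq_real_of_nat)
  also have "\<dots> = (\<Sum>j\<in>{1..n}. ennreal (c j * enn2real (T (n - j))))"
    unfolding rec using fin c by (intro sum.cong refl) (simp add: ennreal_mult)
  also have "\<dots> = ennreal (\<Sum>j\<in>{1..n}. c j * enn2real (T (n - j)))"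
    using c by (intro sum_ennreal) simp
  finally show "real n * enn2real (T n) = (\<Sum>j\<in>{1..n}. c j * enn2real (T (n - j)))"
    using c by (subst (asm) ennreal_inj) (auto intro!: sum_nonneg)
qed

context
  fixes V :: "real ^ 'd::finite \<Rightarrow> real" and \<theta> :: "nat \<Rightarrow> real" and \<gamma> \<delta> :: real
  assumes \<delta>: "\<delta> > 0" and V: "\<And>x. V x = norm x powr \<delta>"
    and \<gamma>: "\<gamma> > 0" and \<theta>: "\<And>j. j \<ge> 1 \<Longrightarrow> \<theta> j = real j powr \<gamma>"
    and d: "\<delta> * (\<gamma> + 2) > real CARD('d)"
begin

lemma part_weight_nonneg: "part_weight \<theta> V L x j \<ge> 0"
  using \<theta>[of j] by (cases "j = 0") (auto simp: part_weight_def)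

lemma mult_part_weight:
  assumes "j \<ge> 1" "L > 0"
  shows "real j * part_weight \<theta> V L x j = real j powr \<gamma> * exp (- real j * site_energy \<delta> L x)"
  using assms \<theta>[of j] by (simp add: part_weight_def V site_energy_def divide_inverse mult.commute)

lemma second_moment_exponent: "\<delta> * ((\<gamma> + 1) + 1) > real CARD('d)"
  using d by (simp add: algebra_simps)

lemma third_moment_exponent: "\<delta> * ((\<gamma> + 2) + 1) > real CARD('d)"
  using d \<delta> by (simp add: algebra_simps)

lemma lattice_exp_sum_nonneg: "lattice_exp_sum TYPE('d) \<delta> L j \<ge> 0"
  unfolding lattice_exp_sum_def by (rule infsum_nonneg) simp

lemma origin_weight_props:
  assumes L: "L > 0"
  shows "total_weight (part_weight \<theta> V L) {0} m = ennreal (origin_weight \<theta> V L m)"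
    and "origin_weight \<theta> V L 0 = 1"
    and "real m * origin_weight \<theta> V L m = (\<Sum>j\<in>{1..m}. real j powr \<gamma> * origin_weight \<theta> V L (m - j))"
    and "origin_weight \<theta> V L m \<ge> 0"
proof -
  let ?T = "total_weight (part_weight \<theta> V L) {0}"
  have "of_nat n * ?T n = (\<Sum>j\<in>{1..n}. ennreal (real j powr \<gamma>) * ?T (n - j))" for n
  proof -
    have "of_nat n * ?T n = (\<Sum>j\<in>{1..n}. (\<integral>\<^sup>+x. ennreal (real j * part_weight \<theta> V L x j) \<partial>count_space {0}) * ?T (n - j))"
      by (rule total_weight_recurrence) (rule part_weight_nonneg)
    also have "\<dots> = (\<Sum>j\<in>{1..n}. ennreal (real j powr \<gamma>) * ?T (n - j))"
    proof (intro sum.cong refl)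
      fix j assume j: "j \<in> {1..n}"
      have "lattice_point (0 :: int ^ 'd) = 0" by (simp add: lattice_point_def vec_eq_iff)
      then have "real j * part_weight \<theta> V L 0 j = real j powr \<gamma>"
        using j L by (subst mult_part_weight) (auto simp: site_energy_def)
      then show "(\<integral>\<^sup>+x. ennreal (real j * part_weight \<theta> V L x j) \<partial>count_space {0}) * ?T (n - j) = ennreal (real j powr \<gamma>) * ?T (n - j)"
        by (simp add: nn_integral_count_space_finite)
    qed
    finally show ?thesis .
  qed
  note rec = ennreal_recurrence[of ?T "\<lambda>j. real j powr \<gamma>", OF total_weight_0 _ this]
  show "?T m = ennreal (origin_weight \<theta> V L m)" unfolding origin_weight_def by (rule rec(1)) simp
  show "origin_weight \<theta> V L 0 = 1" by (simp add: origin_weight_def total_weight_0)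
  show "real m * origin_weight \<theta> V L m = (\<Sum>j\<in>{1..m}. real j powr \<gamma> * origin_weight \<theta> V L (m - j))"
    unfolding origin_weight_def by (rule rec(2)) simp
  show "origin_weight \<theta> V L m \<ge> 0" by (simp add: origin_weight_def)
qed

lemma mult_outer_rate: "real j * outer_rate TYPE('d) \<delta> \<gamma> L j = real j powr \<gamma> * lattice_exp_sum TYPE('d) \<delta> L j"
  by (simp add: outer_rate_def)

lemma outer_weight_props:
  assumes L: "L > 0"
  shows "total_weight (part_weight \<theta> V L) (- {0}) r = ennreal (outer_weight \<theta> V L r)"
    and "outer_weight \<theta> V L 0 = 1"
    and "real r * outer_weight \<theta> V L r = (\<Sum>j\<in>{1..r}. real j * outer_rate TYPE('d) \<delta> \<gamma> L j * outer_weight \<theta> V L (r - j))"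
    and "outer_weight \<theta> V L r \<ge> 0"
proof -
  let ?T = "total_weight (part_weight \<theta> V L) (- {0})"
  have rate_nonneg: "real j * outer_rate TYPE('d) \<delta> \<gamma> L j \<ge> 0" for j
    unfolding mult_outer_rate by (intro mult_nonneg_nonneg lattice_exp_sum_nonneg) simp
  have "of_nat n * ?T n = (\<Sum>j\<in>{1..n}. ennreal (real j * outer_rate TYPE('d) \<delta> \<gamma> L j) * ?T (n - j))" for n
  proof -
    have "of_nat n * ?T n = (\<Sum>j\<in>{1..n}. (\<integral>\<^sup>+x. ennreal (real j * part_weight \<theta> V L x j) \<partial>count_space (- {0})) * ?T (n - j))"
      by (rule total_weight_recurrence) (rule part_weight_nonneg)
    also have "\<dots> = (\<Sum>j\<in>{1..n}. ennreal (real j * outer_rate TYPE('d) \<delta> \<gamma> L j) * ?T (n - j))"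
    proof (intro sum.cong refl arg_cong2[where f = "(*)"])
      fix j assume j: "j \<in> {1..n}"
      have s: "(\<lambda>x :: int ^ 'd. real j powr \<gamma> * exp (- real j * site_energy \<delta> L x)) summable_on - {0}"
        using j by (intro summable_on_cmult_right lattice_exp_summable[OF _ second_moment_exponent L]) (use \<gamma> in auto)
      have "(\<integral>\<^sup>+x. ennreal (real j * part_weight \<theta> V L x j) \<partial>count_space (- {0}))
          = (\<integral>\<^sup>+x. ennreal (real j powr \<gamma> * exp (- real j * site_energy \<delta> L x)) \<partial>count_space (- {0 :: int ^ 'd}))"
        using j L by (intro nn_integral_cong) (simp add: mult_part_weight)
      also have "\<dots> = ennreal (\<integral>x. real j powr \<gamma> * exp (- real j * site_energy \<delta> L x) \<partial>count_space (- {0 :: int ^ 'd}))"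
        using integral_count_space_eq_infsum(1)[OF s] by (intro nn_integral_eq_integral) auto
      also have "(\<integral>x. real j powr \<gamma> * exp (- real j * site_energy \<delta> L x) \<partial>count_space (- {0 :: int ^ 'd}))
          = real j * outer_rate TYPE('d) \<delta> \<gamma> L j"
        unfolding integral_count_space_eq_infsum(2)[OF s] mult_outer_rate lattice_exp_sum_def by (rule infsum_cmult_right')
      finally show "(\<integral>\<^sup>+x. ennreal (real j * part_weight \<theta> V L x j) \<partial>count_space (- {0})) = ennreal (real j * outer_rate TYPE('d) \<delta> \<gamma> L j)" .
    qed
    finally show ?thesis .
  qed
  note rec = ennreal_recurrence[of ?T "\<lambda>j. real j * outer_rate TYPE('d) \<delta> \<gamma> L j", OF total_weight_0 rate_nonneg this]
  show "?T r = ennreal (outer_weight \<theta> V L r)" unfolding outer_weight_def by (rule rec(1))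
  show "outer_weight \<theta> V L 0 = 1" by (simp add: outer_weight_def total_weight_0)
  show "real r * outer_weight \<theta> V L r = (\<Sum>j\<in>{1..r}. real j * outer_rate TYPE('d) \<delta> \<gamma> L j * outer_weight \<theta> V L (r - j))"
    unfolding outer_weight_def by (rule rec(2))
  show "outer_weight \<theta> V L r \<ge> 0" by (simp add: outer_weight_def)
qed

lemma outer_rate_nonneg: "outer_rate TYPE('d) \<delta> \<gamma> L j \<ge> 0"
  unfolding outer_rate_def by (intro divide_nonneg_nonneg mult_nonneg_nonneg lattice_exp_sum_nonneg) auto

lemma outer_rate_0: "outer_rate TYPE('d) \<delta> \<gamma> L 0 = 0"
  by (simp add: outer_rate_def)

lemma outer_rate_moment_term:
  assumes "k \<ge> 1"
  shows "real j ^ k * outer_rate TYPE('d) \<delta> \<gamma> L j = real j powr (\<gamma> + real (k - 1)) * lattice_exp_sum TYPE('d) \<delta> L j"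
proof (cases "j = 0")
  case False
  have "real j ^ k = real j * real j ^ (k - 1)" using assms by (cases k) auto
  then have "real j ^ k * outer_rate TYPE('d) \<delta> \<gamma> L j = real j ^ (k - 1) * (real j * outer_rate TYPE('d) \<delta> \<gamma> L j)"
    by (simp add: mult_ac)
  also have "\<dots> = real j powr (\<gamma> + real (k - 1)) * lattice_exp_sum TYPE('d) \<delta> L j"
    using False by (simp add: mult_outer_rate powr_add powr_realpow)
  finally show ?thesis .
qed (use assms \<gamma> in simp)

lemma outer_moment_sums:
  assumes L: "L > 0" and k: "k \<in> {1, 2, 3}"
  shows "(\<lambda>j. real j ^ k * outer_rate TYPE('d) \<delta> \<gamma> L j) sums
     (\<Sum>\<^sub>\<infinity>x\<in>- {0 :: int ^ 'd}. power_exp_sum (\<gamma> + real (k - 1)) (site_energy \<delta> L x))"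
proof -
  have "k \<ge> 1" using k by auto
  then show ?thesis unfolding outer_rate_moment_term[OF \<open>k \<ge> 1\<close>]
    using k \<gamma> by (intro lattice_moment_sums[OF _ _ third_moment_exponent L]) auto
qed

lemma outer_moment:
  assumes L: "L > 0" and k: "k \<in> {1, 2, 3}"
  shows "moment (outer_rate TYPE('d) \<delta> \<gamma> L) k
     = (\<Sum>\<^sub>\<infinity>x\<in>- {0 :: int ^ 'd}. power_exp_sum (\<gamma> + real (k - 1)) (site_energy \<delta> L x))"
  unfolding moment_def using outer_moment_sums[OF assms] by (simp add: sums_iff)

lemma outer_third_summable: "L > 0 \<Longrightarrow> summable (\<lambda>j. real j ^ 3 * outer_rate TYPE('d) \<delta> \<gamma> L j)"
  using outer_moment_sums[of L 3] by (simp add: sums_iff)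

text \<open>
  This identity is the reason for centring with \<open>\<rho>\<^sub>c\<^sup>L\<close>: it is exactly the mean of the law before tilting,
  while the distance of \<open>\<rho>\<^sub>c L\<^sup>d\<close> from this mean need not be small on the scale of the fluctuations.
\<close>
lemma critical_density_L_eq:
  assumes L: "L > 0"
  shows "critical_density_L \<theta> V L * L ^ CARD('d) = moment (outer_rate TYPE('d) \<delta> \<gamma> L) 1"
proof -
  have "(\<Sum>\<^sub>\<infinity>j\<in>{1..}. \<Sum>\<^sub>\<infinity>x\<in>- {0}. \<theta> j * exp (- real j * V (lattice_point x /\<^sub>R L)))
      = (\<Sum>\<^sub>\<infinity>j\<in>{1..}. real j ^ 1 * outer_rate TYPE('d) \<delta> \<gamma> L j)"
  proof (rule infsum_cong)
    fix j :: nat assume j: "j \<in> {1..}"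
    have "(\<Sum>\<^sub>\<infinity>x\<in>- {0}. \<theta> j * exp (- real j * V (lattice_point x /\<^sub>R L)))
        = (\<Sum>\<^sub>\<infinity>x\<in>- {0 :: int ^ 'd}. real j powr \<gamma> * exp (- real j * site_energy \<delta> L x))"
      using j L \<theta>[of j] by (intro infsum_cong) (simp add: V site_energy_def divide_inverse mult.commute)
    then show "(\<Sum>\<^sub>\<infinity>x\<in>- {0}. \<theta> j * exp (- real j * V (lattice_point x /\<^sub>R L))) = real j ^ 1 * outer_rate TYPE('d) \<delta> \<gamma> L j"
      by (simp only: power_one_right mult_outer_rate lattice_exp_sum_def infsum_cmult_right')
  qed
  also have "\<dots> = (\<Sum>\<^sub>\<infinity>j. real j ^ 1 * outer_rate TYPE('d) \<delta> \<gamma> L j)"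
    by (rule infsum_cong_neutral) (auto simp: not_le)
  also have "\<dots> = moment (outer_rate TYPE('d) \<delta> \<gamma> L) 1"
    unfolding moment_def
    by (rule infsumI[OF sums_nonneg_imp_has_sum])
       (use outer_moment_sums[OF L, of 1] outer_rate_nonneg in \<open>auto simp: sums_iff\<close>)
  finally show ?thesis using L by (simp add: critical_density_L_def)
qed

text \<open>
  Here \<open>num / den\<close> is the tilted expectation \<open>E[W exp (i t Y / s)] / E[W]\<close> with \<open>Y\<close> the centred mass away from the origin, taken
  with the opposite sign, and \<open>W = h (n - R) / h m0\<close>. Both expectations differ by at most \<open>E \<bar>W - 1\<bar>\<close> from those
  without \<open>W\<close>.
\<close>
lemma occupation_char_close:
  fixes n :: nat and L s t \<rho> :: real
  defines "b \<equiv> outer_rate TYPE('d) \<delta> \<gamma> L"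
  defines "m0 \<equiv> nat \<lfloor>real n - moment b 1\<rfloor>"
  defines "\<alpha> \<equiv> (\<gamma> * exp \<gamma> + 2 powr \<gamma>) * real (m0 - m0 div 2) powr (- (1 / (1 + \<gamma>)))"
  defines "\<eta> \<equiv> 2 * sqrt (exp (2 * \<alpha> + 2 * \<alpha>\<^sup>2 * moment b 2) - 1)"
  assumes L: "L > 0" and n: "real n = \<rho> * L ^ CARD('d)"
    and m0: "moment b 1 \<le> real n" "m0 \<ge> 1" and \<alpha>: "1 \<le> \<alpha> * real (m0 div 2)"
  obtains num den :: complex where
    "char (distr (partition_measure \<theta> V L n) borel
       (\<lambda>l. (real (occupation 0 l) - (\<rho> - critical_density_L \<theta> V L) * L ^ CARD('d)) / s)) t = num / den"
    "norm (num - exp (\<Sum>j. of_real (b j) * (iexp (- (t / s) * real j) - 1 + \<i> * of_real ((t / s) * real j)))) \<le> \<eta>"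
    "norm (den - 1) \<le> \<eta>"
proof -
  define h where "h = origin_weight \<theta> V L"
  define A where "A = outer_weight \<theta> V L"
  define W where "W r = (if r \<le> n then h (n - r) / h m0 else 0)" for r
  define q where "q = law A b"
  define N where "N = real (n - m0)"
  note h = origin_weight_props[OF L, folded h_def]
  note A = outer_weight_props[OF L, folded A_def b_def]
  note b_nonneg = outer_rate_nonneg[of L, folded b_def]
  note third = outer_third_summable[OF L, folded b_def]
  have b0: "b 0 = 0" by (simp add: b_def outer_rate_0)
  note hyps = A(2) b0 A(4) A(3) b_nonneg third
  have h_ge_1: "h m \<ge> 1" for m by (rule weight_ge_1[OF h(2,4) \<gamma> h(3)])
  then have h_pos: "h m > 0" for m by (rule less_le_trans[OF zero_less_one])
  have m0_floor: "real m0 \<le> real n - moment b 1" "real n - moment b 1 < real m0 + 1"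
    using m0(1) unfolding m0_def by linarith+
  have \<mu>0: "moment b 1 \<ge> 0" by (rule moment_nonneg[OF hyps]) simp
  then have m0_le: "m0 \<le> n" using m0_floor by linarith
  have N: "moment b 1 \<le> N" "N \<le> moment b 1 + 1"
    using m0_floor m0_le unfolding N_def by (auto simp: of_nat_diff)
  have "m0 - m0 div 2 \<ge> 1" using m0(2) by linarith
  then have \<alpha>_pos: "\<alpha> > 0" using \<gamma> unfolding \<alpha>_def by (intro mult_pos_pos add_pos_pos) auto
  have W: "\<bar>W r - 1\<bar> \<le> 2 * \<bar>exp (\<alpha> * (N - real r)) - 1\<bar>" for r
    unfolding W_def N_def
  proof (rule density_ratio_bound)
    show "h m \<le> h n" if "m \<le> n" for m n by (rule weight_mono[OF h(2,4) \<gamma> h(3) that])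
    show "h (m + u) \<le> exp (\<alpha> * real u) * h m" if "m0 - m0 div 2 \<le> m" for m u
      unfolding \<alpha>_def by (rule weight_growth[OF h(2,4) \<gamma> h(3) \<open>m0 - m0 div 2 \<ge> 1\<close> that])
  qed (use h_ge_1 \<alpha>_pos \<alpha> m0_le in auto)
  note dev = law_exp_deviation[OF hyps \<alpha>_pos N, folded q_def]
  have q_nonneg: "q r \<ge> 0" for r unfolding q_def by (rule law_nonneg[OF hyps])
  have q1: "q sums 1" unfolding q_def by (rule law_sums_1[OF hyps])
  have close: "norm ((\<Sum>r\<le>n. of_real (W r * q r) * e r) - E) \<le> \<eta>"
    if e: "\<And>r. norm (e r) \<le> 1" and E: "(\<lambda>r. of_real (q r) * e r) sums E" for e :: "nat \<Rightarrow> complex" and E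
  proof -
    have "(\<lambda>r. of_real (W r * q r) * e r) sums (\<Sum>r\<le>n. of_real (W r * q r) * e r)"
      by (rule sums_finite) (auto simp: W_def)
    then have "(\<lambda>r. of_real (W r * q r) * e r - of_real (q r) * e r) sums ((\<Sum>r\<le>n. of_real (W r * q r) * e r) - E)"
      using E by (rule sums_diff)
    moreover have "norm (of_real (W r * q r) * e r - of_real (q r) * e r) \<le> 2 * (q r * \<bar>exp (\<alpha> * (N - real r)) - 1\<bar>)" for r
    proof -
      have "of_real (W r * q r) * e r - of_real (q r) * e r = of_real (q r * (W r - 1)) * e r" by (simp add: algebra_simps)
      then have "norm (of_real (W r * q r) * e r - of_real (q r) * e r) = q r * \<bar>W r - 1\<bar> * norm (e r)"
        using q_nonneg[of r] by (simp only: norm_mult norm_of_real abs_mult abs_of_nonneg)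
      also have "\<dots> \<le> q r * \<bar>W r - 1\<bar> * 1" using e q_nonneg by (intro mult_left_mono) auto
      also have "\<dots> \<le> q r * (2 * \<bar>exp (\<alpha> * (N - real r)) - 1\<bar>)"
        using W[of r] q_nonneg[of r] by (simp add: mult_left_mono)
      finally show ?thesis by (simp add: mult_ac)
    qed
    moreover have "(\<lambda>r. 2 * (q r * \<bar>exp (\<alpha> * (N - real r)) - 1\<bar>)) sums (2 * (\<Sum>r. q r * \<bar>exp (\<alpha> * (N - real r)) - 1\<bar>))"
      by (intro sums_mult summable_sums dev(1))
    ultimately have "norm ((\<Sum>r\<le>n. of_real (W r * q r) * e r) - E) \<le> 2 * (\<Sum>r. q r * \<bar>exp (\<alpha> * (N - real r)) - 1\<bar>)"
      by - (rule norm_sums_le)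
    also have "\<dots> \<le> \<eta>" unfolding \<eta>_def by (intro mult_left_mono dev(2)) auto
    finally show ?thesis .
  qed
  define e where "e r = iexp ((t / s) * (moment b 1 - real r))" for r
  define num where "num = (\<Sum>r\<le>n. of_real (W r * q r) * e r)"
  define den where "den = (\<Sum>r\<le>n. of_real (W r * q r) * (1 :: complex))"
  show ?thesis
  proof (rule that)
    show "norm (num - exp (\<Sum>j. of_real (b j) * (iexp (- (t / s) * real j) - 1 + \<i> * of_real ((t / s) * real j)))) \<le> \<eta>"
      unfolding num_def
    proof (rule close)
      show "norm (e r) \<le> 1" for r by (simp add: e_def)
      show "(\<lambda>r. of_real (q r) * e r) sums exp (\<Sum>j. of_real (b j) * (iexp (- (t / s) * real j) - 1 + \<i> * of_real ((t / s) * real j)))"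
        unfolding e_def q_def by (rule law_char(1)[OF hyps])
    qed
    have "(\<lambda>r. of_real (q r) :: complex) sums of_real 1" by (rule sums_of_real[OF q1])
    then show "norm (den - 1) \<le> \<eta>" unfolding den_def by (intro close) auto
    \<comment> \<open>the factor by which \<open>W\<close> and the normalization of \<open>law\<close> change numerator and denominator alike\<close>
    define K where "K = exp (- moment b 0) / h m0"
    have K: "K > 0" using h_pos by (simp add: K_def)
    have Wq: "W r * q r = K * (h (n - r) * A r)" if "r \<le> n" for r
      using that by (simp add: W_def q_def law_def K_def)
    define F where "F m = (real m - (\<rho> - critical_density_L \<theta> V L) * L ^ CARD('d)) / s" for m
    have F: "F (n - r) = (moment b 1 - real r) / s" if "r \<le> n" for r
      using that n critical_density_L_eq[OF L, folded b_def] by (simp add: F_def of_nat_diff algebra_simps)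
    let ?Z = "convolution_total h A n"
    have Z: "?Z = (\<Sum>r\<le>n. h (n - r) * A r)"
      unfolding convolution_total_def[OF part_weight_def part_weight_nonneg h(1) h_pos A(1,4,2)]
      by (rule sum.reindex_bij_witness[of _ "\<lambda>r. n - r" "\<lambda>r. n - r"]) auto
    have "char (distr (partition_measure \<theta> V L n) borel (\<lambda>l. F (occupation 0 l))) t
       = (\<Sum>m\<le>n. of_real (h m * A (n - m) / ?Z) * iexp (t * F m))"
      by (rule char_occupation[OF part_weight_def part_weight_nonneg h(1) h_pos A(1,4,2)])
    also have "\<dots> = (\<Sum>r\<le>n. of_real (h (n - r) * A r / ?Z) * iexp (t * F (n - r)))"
      by (rule sum.reindex_bij_witness[of _ "\<lambda>r. n - r" "\<lambda>r. n - r"]) auto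
    also have "\<dots> = (\<Sum>r\<le>n. of_real (h (n - r) * A r) * e r) / of_real ?Z"
      unfolding sum_divide_distrib
    proof (intro sum.cong refl)
      fix r assume "r \<in> {..n}"
      then have "F (n - r) = (moment b 1 - real r) / s" by (intro F) simp
      then have "t * F (n - r) = (t / s) * (moment b 1 - real r)" by simp
      then show "of_real (h (n - r) * A r / ?Z) * iexp (t * F (n - r)) = of_real (h (n - r) * A r) * e r / of_real ?Z"
        unfolding e_def by (simp only: of_real_divide) simp
    qed
    also have "\<dots> = (of_real K * (\<Sum>r\<le>n. of_real (h (n - r) * A r) * e r)) / (of_real K * of_real ?Z)"
      using K by simp
    also have "of_real K * (\<Sum>r\<le>n. of_real (h (n - r) * A r) * e r) = num"
      unfolding num_def sum_distrib_left by (intro sum.cong refl) (simp add: Wq mult_ac)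
    also have "of_real K * of_real ?Z = den"
      unfolding den_def Z of_real_sum sum_distrib_left by (intro sum.cong refl) (simp add: Wq)
    finally show "char (distr (partition_measure \<theta> V L n) borel
       (\<lambda>l. (real (occupation 0 l) - (\<rho> - critical_density_L \<theta> V L) * L ^ CARD('d)) / s)) t = num / den"
      unfolding F_def .
  qed
qed

lemma real_distribution_occupation_law:
  assumes L: "L > 0"
  shows "real_distribution (distr (partition_measure \<theta> V L n) borel f)"
proof -
  have "origin_weight \<theta> V L m > 0" for m
    using weight_ge_1[OF origin_weight_props(2,4)[OF L] \<gamma> origin_weight_props(3)[OF L]] by (rule less_le_trans[OF zero_less_one])
  from real_distribution_occupation[OF part_weight_def part_weight_nonneg origin_weight_props(1)[OF L] this
      outer_weight_props(1,4,2)[OF L]]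
  show ?thesis .
qed

end

section \<open>Convergence in distribution\<close>

lemma tendsto_powr_neg_exponent:
  fixes L :: "nat \<Rightarrow> real"
  assumes "filterlim L at_top sequentially" "e < 0"
  shows "(\<lambda>k. L k powr e) \<longlonglongrightarrow> 0"
  using tendsto_neg_powr[OF assms(2,1)] .

text \<open>
  The exponents of \<open>L\<close> decide. The rate \<open>\<alpha>\<close> is \<open>O(L\<^sup>-\<^sup>d\<^sup>\<beta>)\<close> and the scale is
  \<open>s = L\<^sup>\<delta>\<^sup>(\<^sup>1\<^sup>+\<^sup>\<gamma>\<^sup>/\<^sup>2\<^sup>)\<close>; the hypothesis \<open>lower\<close> is \<open>\<delta> (1 + \<gamma> / 2) < d \<beta>\<close>, so that \<open>\<alpha> s\<close> tends to \<open>0\<close> and with it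
  the error \<open>\<eta>\<close> of \<open>occupation_char_close\<close>.
\<close>
lemma occupation_char_tendsto:
  fixes V :: "real ^ 'd::finite \<Rightarrow> real" and \<theta> :: "nat \<Rightarrow> real"
    and \<gamma> \<delta> \<rho> t :: real and n :: "nat \<Rightarrow> nat" and L :: "nat \<Rightarrow> real"
  assumes \<delta>: "\<delta> > 0" and V: "\<And>x. V x = norm x powr \<delta>"
    and \<gamma>: "\<gamma> > 0" and \<theta>: "\<And>j. j \<ge> 1 \<Longrightarrow> \<theta> j = real j powr \<gamma>"
    and lower: "\<delta> * (1 + \<gamma>) * (1 + \<gamma> / 2) < real CARD('d)" and upper: "real CARD('d) < \<delta> * (\<gamma> + 2)"
    and crit: "critical_density \<theta> V < ennreal \<rho>"
    and L: "\<And>k. L k > 0" and lim: "filterlim L at_top sequentially"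
    and n: "\<And>k. real (n k) = \<rho> * L k ^ CARD('d)"
  shows "(\<lambda>k. char (distr (partition_measure \<theta> V (L k) (n k)) borel
       (\<lambda>l. (real (occupation 0 l) - (\<rho> - critical_density_L \<theta> V (L k)) * L k ^ CARD('d))
             / L k powr (\<delta> * (1 + \<gamma> / 2)))) t)
    \<longlonglongrightarrow> of_real (exp (- (t\<^sup>2 / 2 * (Gamma (\<gamma> + 2) *
         (\<Sum>\<^sub>\<infinity>x\<in>- {0 :: int ^ 'd}. norm (lattice_point x) powr (- (\<delta> * (\<gamma> + 2))))))))"
proof -
  let ?d = "real CARD('d)"
  define \<sigma>2 where "\<sigma>2 = Gamma (\<gamma> + 2) * (\<Sum>\<^sub>\<infinity>x\<in>- {0 :: int ^ 'd}. norm (lattice_point x) powr (- (\<delta> * (\<gamma> + 2))))"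
  define \<beta> where "\<beta> = 1 / (1 + \<gamma>)"
  define C where "C = \<gamma> * exp \<gamma> + 2 powr \<gamma>"
  have C: "C > 0" using \<gamma> unfolding C_def by (intro add_pos_pos) auto
  have \<beta>: "0 < \<beta>" "\<beta> < 1" using \<gamma> by (auto simp: \<beta>_def)
  note ctx = \<delta> V \<gamma> \<theta> upper
  define b where "b k = outer_rate TYPE('d) \<delta> \<gamma> (L k)" for k
  define m0 where "m0 k = nat \<lfloor>real (n k) - moment (b k) 1\<rfloor>" for k
  define \<alpha> where "\<alpha> k = C * real (m0 k - m0 k div 2) powr (- \<beta>)" for k
  define s where "s k = L k powr (\<delta> * (1 + \<gamma> / 2))" for k
  define \<eta> where "\<eta> k = 2 * sqrt (exp (2 * \<alpha> k + 2 * (\<alpha> k)\<^sup>2 * moment (b k) 2) - 1)" for k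
  have s_pos: "s k > 0" for k using L[of k] by (simp add: s_def)
  have s2: "(s k)\<^sup>2 = L k powr (\<delta> * (\<gamma> + 2))" for k
    using L[of k] by (simp add: s_def power2_eq_square powr_add[symmetric] algebra_simps)

  have var: "(\<lambda>k. L k powr (- (\<delta> * (\<gamma> + 2))) * moment (b k) 2) \<longlonglongrightarrow> \<sigma>2"
  proof -
    have "\<gamma> + 1 > 0" "\<delta> * (\<gamma> + 1 + 1) > ?d" using \<gamma> upper by (auto simp: algebra_simps)
    from lattice_moment_lim[OF this(1) \<delta> this(2) L lim] show ?thesis
      unfolding b_def \<sigma>2_def using outer_moment[OF ctx L, of 2] by (simp add: add.assoc)
  qed
  obtain w where third: "(\<lambda>k. L k powr (- (\<delta> * (\<gamma> + 3))) * moment (b k) 3) \<longlonglongrightarrow> w"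
  proof -
    have "\<gamma> + 2 > 0" "\<delta> * (\<gamma> + 2 + 1) > ?d" using \<gamma> \<delta> upper by (auto simp: algebra_simps)
    from lattice_moment_lim[OF this(1) \<delta> this(2) L lim] show ?thesis
      using outer_moment[OF ctx L, of 3] by (intro that) (simp add: add.assoc b_def)
  qed

  have "\<delta> * (1 + \<gamma>) * 1 \<le> \<delta> * (1 + \<gamma>) * (1 + \<gamma> / 2)" using \<delta> \<gamma> by (intro mult_left_mono) auto
  then have d1: "\<delta> * (1 + \<gamma>) < ?d" using lower by simp
  obtain c where c: "c > 0" "eventually (\<lambda>k. moment (b k) 1 \<le> (\<rho> - c) * L k ^ CARD('d)) sequentially"
    using eventually_mass_below_density[OF \<delta> V \<gamma> \<theta> d1 crit L lim] outer_moment[OF ctx L, of 1]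
    by (auto simp: b_def)
  have Ld: "filterlim (\<lambda>k. L k ^ CARD('d)) at_top sequentially"
    by (rule filterlim_pow_at_top[OF _ lim]) simp
  have "eventually (\<lambda>k. 2 / c \<le> L k ^ CARD('d)) sequentially"
    using Ld by (simp add: filterlim_at_top)
  with c(2) have m0_ev: "eventually (\<lambda>k. moment (b k) 1 \<le> real (n k) \<and> c / 2 * L k ^ CARD('d) \<le> real (m0 k)) sequentially"
  proof eventually_elim
    case (elim k)
    have "c * L k ^ CARD('d) \<le> real (n k) - moment (b k) 1"
      using elim n[of k] by (simp add: algebra_simps)
    moreover have "1 \<le> c / 2 * L k ^ CARD('d)" using elim c(1) by (simp add: field_simps)
    ultimately show ?case unfolding m0_def by (simp add: field_simps) linarith
  qed
  have m0_top: "filterlim (\<lambda>k. real (m0 k)) at_top sequentially"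
  proof (rule filterlim_at_top_mono)
    show "filterlim (\<lambda>k. c / 2 * L k ^ CARD('d)) at_top sequentially"
      using c(1) by (intro filterlim_tendsto_pos_mult_at_top[OF tendsto_const _ Ld]) simp
    show "eventually (\<lambda>k. c / 2 * L k ^ CARD('d) \<le> real (m0 k)) sequentially"
      using m0_ev by (rule eventually_mono) simp
  qed
  then have m0_2: "eventually (\<lambda>k. 2 \<le> real (m0 k)) sequentially"
    unfolding filterlim_at_top by (rule spec)

  \<comment> \<open>\<open>\<alpha> * (m0 div 2)\<close> has at least the order \<open>m0\<^sup>1\<^sup>-\<^sup>\<beta>\<close>; the constant \<open>4\<close> covers the rounding in \<open>m0 div 2\<close>\<close>
  have \<alpha>_large: "eventually (\<lambda>k. 1 \<le> \<alpha> k * real (m0 k div 2)) sequentially"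
  proof -
    have "filterlim (\<lambda>k. real (m0 k) powr (1 - \<beta>)) at_top sequentially"
      by (rule filterlim_compose[OF real_powr_at_top m0_top]) (use \<beta> in auto)
    then have "eventually (\<lambda>k. 4 / C \<le> real (m0 k) powr (1 - \<beta>)) sequentially" by (simp add: filterlim_at_top)
    with m0_2 show ?thesis
    proof eventually_elim
      case (elim k)
      have "1 \<le> C / 4 * real (m0 k) powr (1 - \<beta>)" using elim C by (simp add: field_simps)
      also have "\<dots> = C * real (m0 k) powr (- \<beta>) * (real (m0 k) / 4)"
        using elim by (simp add: powr_diff powr_minus field_simps)
      also have "\<dots> \<le> \<alpha> k * real (m0 k div 2)"
        unfolding \<alpha>_def
      proof (intro mult_mono mult_left_mono powr_mono2')
        show "real (m0 k) / 4 \<le> real (m0 k div 2)" using elim by linarith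
        show "0 < real (m0 k - m0 k div 2)" using elim by linarith
      qed (use C \<beta> in auto)
      finally show ?case .
    qed
  qed
  have \<alpha>_upper: "eventually (\<lambda>k. 0 \<le> \<alpha> k \<and> \<alpha> k \<le> C * (c / 4) powr (- \<beta>) * L k powr (- (?d * \<beta>))) sequentially"
    using m0_ev m0_2
  proof eventually_elim
    case (elim k)
    have pos: "0 < c / 4 * L k ^ CARD('d)" using c(1) L[of k] by simp
    have "c / 4 * L k ^ CARD('d) \<le> real (m0 k) / 2" using elim by simp
    also have "\<dots> \<le> real (m0 k - m0 k div 2)" by linarith
    finally have "real (m0 k - m0 k div 2) powr (- \<beta>) \<le> (c / 4 * L k ^ CARD('d)) powr (- \<beta>)"
      using pos \<beta> by (intro powr_mono2') auto
    also have "\<dots> = (c / 4) powr (- \<beta>) * (L k ^ CARD('d)) powr (- \<beta>)"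
      by (rule powr_mult)
    also have "(L k ^ CARD('d)) powr (- \<beta>) = L k powr (- (?d * \<beta>))"
      by (simp only: powr_realpow[OF L, symmetric] powr_powr mult_minus_right)
    finally show ?case using C by (simp add: \<alpha>_def mult.assoc mult_left_mono)
  qed
  have \<alpha>0: "\<alpha> \<longlonglongrightarrow> 0"
  proof (rule tendsto_sandwich[of "\<lambda>_. 0"])
    have "(\<lambda>k. C * (c / 4) powr (- \<beta>) * L k powr (- (?d * \<beta>))) \<longlonglongrightarrow> C * (c / 4) powr (- \<beta>) * 0"
      by (intro tendsto_mult tendsto_const tendsto_powr_neg_exponent lim) (use \<beta> in simp)
    then show "(\<lambda>k. C * (c / 4) powr (- \<beta>) * L k powr (- (?d * \<beta>))) \<longlonglongrightarrow> 0" by simp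
  qed (use \<alpha>_upper in \<open>auto elim: eventually_mono\<close>)
  have \<alpha>s: "(\<lambda>k. \<alpha> k * s k) \<longlonglongrightarrow> 0"
  proof (rule tendsto_sandwich[of "\<lambda>_. 0"])
    have "\<delta> * (1 + \<gamma> / 2) < ?d * \<beta>"
      using lower \<gamma> by (simp add: \<beta>_def field_simps)
    then have "(\<lambda>k. C * (c / 4) powr (- \<beta>) * L k powr (- (?d * \<beta>) + \<delta> * (1 + \<gamma> / 2))) \<longlonglongrightarrow> C * (c / 4) powr (- \<beta>) * 0"
      by (intro tendsto_mult tendsto_const tendsto_powr_neg_exponent lim) simp
    then show "(\<lambda>k. C * (c / 4) powr (- \<beta>) * L k powr (- (?d * \<beta>)) * s k) \<longlonglongrightarrow> 0"
      by (simp only: s_def powr_add mult.assoc mult_zero_right)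
    show "eventually (\<lambda>k. 0 \<le> \<alpha> k * s k) sequentially"
      using \<alpha>_upper by eventually_elim (simp add: less_imp_le[OF s_pos])
    show "eventually (\<lambda>k. \<alpha> k * s k \<le> C * (c / 4) powr (- \<beta>) * L k powr (- (?d * \<beta>)) * s k) sequentially"
      using \<alpha>_upper by eventually_elim (intro mult_right_mono, auto simp: less_imp_le[OF s_pos])
  qed simp
  have \<eta>0: "\<eta> \<longlonglongrightarrow> 0"
  proof -
    have "(\<alpha> k)\<^sup>2 * moment (b k) 2 = (\<alpha> k * s k)\<^sup>2 * (L k powr (- (\<delta> * (\<gamma> + 2))) * moment (b k) 2)" for k
      using L[of k] by (simp add: power_mult_distrib s2 powr_minus)
    moreover have "(\<lambda>k. (\<alpha> k * s k)\<^sup>2 * (L k powr (- (\<delta> * (\<gamma> + 2))) * moment (b k) 2)) \<longlonglongrightarrow> 0\<^sup>2 * \<sigma>2"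
      by (intro tendsto_intros \<alpha>s var)
    ultimately have a2v: "(\<lambda>k. (\<alpha> k)\<^sup>2 * moment (b k) 2) \<longlonglongrightarrow> 0"
      by (simp only: zero_power2 mult_zero_left)
    have "(\<lambda>k. 2 * sqrt (exp (2 * \<alpha> k + 2 * ((\<alpha> k)\<^sup>2 * moment (b k) 2)) - 1)) \<longlonglongrightarrow> 2 * sqrt (exp (2 * 0 + 2 * 0) - 1)"
      by (intro tendsto_intros \<alpha>0 a2v)
    then show ?thesis by (simp add: \<eta>_def[abs_def] mult.assoc)
  qed

  define S where "S k = (\<Sum>j. of_real (b k j) * (iexp (- (t / s k) * real j) - 1 + \<i> * of_real ((t / s k) * real j)))" for k
  have S: "S \<longlonglongrightarrow> of_real (- (t\<^sup>2 / 2 * \<sigma>2))"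
  proof -
    have quad: "(t / s k)\<^sup>2 / 2 * moment (b k) 2 = t\<^sup>2 / 2 * (L k powr (- (\<delta> * (\<gamma> + 2))) * moment (b k) 2)" for k
      by (simp add: power_divide s2 powr_minus_divide)
    have cub: "\<bar>t / s k\<bar> ^ 3 / 6 * moment (b k) 3
        = \<bar>t\<bar> ^ 3 / 6 * (L k powr (- (\<delta> * \<gamma> / 2)) * (L k powr (- (\<delta> * (\<gamma> + 3))) * moment (b k) 3))" for k
    proof -
      have "s k ^ 3 = L k powr (\<delta> * \<gamma> / 2 + \<delta> * (\<gamma> + 3))"
        using L[of k] by (simp add: s_def power3_eq_cube powr_add[symmetric] algebra_simps)
      then have "1 / s k ^ 3 = L k powr (- (\<delta> * \<gamma> / 2)) * L k powr (- (\<delta> * (\<gamma> + 3)))"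
        by (simp only: powr_minus_divide[symmetric] powr_add[symmetric] minus_add_distrib)
      moreover have "\<bar>t / s k\<bar> ^ 3 = \<bar>t\<bar> ^ 3 * (1 / s k ^ 3)"
        using s_pos[of k] by (simp add: abs_divide power_divide)
      ultimately show ?thesis by simp
    qed
    have "(\<lambda>k. S k + of_real ((t / s k)\<^sup>2 / 2 * moment (b k) 2)) \<longlonglongrightarrow> 0"
    proof (rule Lim_null_comparison)
      have "norm (S k + of_real ((t / s k)\<^sup>2 / 2 * moment (b k) 2)) \<le> \<bar>t / s k\<bar> ^ 3 / 6 * moment (b k) 3" for k
        unfolding S_def
      proof (rule law_char(2))
        note A = outer_weight_props[OF ctx L]
        show "outer_weight \<theta> V (L k) 0 = 1" by (rule A(2))
        show "outer_weight \<theta> V (L k) m \<ge> 0" for m by (rule A(4))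
        show "real m * outer_weight \<theta> V (L k) m = (\<Sum>j\<in>{1..m}. real j * b k j * outer_weight \<theta> V (L k) (m - j))" for m
          unfolding b_def by (rule A(3))
        show "b k 0 = 0" unfolding b_def by (rule outer_rate_0[OF ctx])
        show "b k j \<ge> 0" for j unfolding b_def by (rule outer_rate_nonneg[OF ctx])
        show "summable (\<lambda>j. real j ^ 3 * b k j)" unfolding b_def by (rule outer_third_summable[OF ctx L])
      qed
      then show "eventually (\<lambda>k. norm (S k + of_real ((t / s k)\<^sup>2 / 2 * moment (b k) 2)) \<le> \<bar>t / s k\<bar> ^ 3 / 6 * moment (b k) 3) sequentially"
        by simp
      have "(\<lambda>k. \<bar>t\<bar> ^ 3 / 6 * (L k powr (- (\<delta> * \<gamma> / 2)) * (L k powr (- (\<delta> * (\<gamma> + 3))) * moment (b k) 3))) \<longlonglongrightarrow> \<bar>t\<bar> ^ 3 / 6 * (0 * w)"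
        using \<delta> \<gamma> by (intro tendsto_mult tendsto_const tendsto_powr_neg_exponent lim third) simp
      then show "(\<lambda>k. \<bar>t / s k\<bar> ^ 3 / 6 * moment (b k) 3) \<longlonglongrightarrow> 0" unfolding cub by simp
    qed
    moreover have "(\<lambda>k. complex_of_real ((t / s k)\<^sup>2 / 2 * moment (b k) 2)) \<longlonglongrightarrow> of_real (t\<^sup>2 / 2 * \<sigma>2)"
      unfolding quad by (intro tendsto_of_real tendsto_mult tendsto_const var)
    ultimately have "(\<lambda>k. S k + of_real ((t / s k)\<^sup>2 / 2 * moment (b k) 2) - of_real ((t / s k)\<^sup>2 / 2 * moment (b k) 2))
        \<longlonglongrightarrow> 0 - of_real (t\<^sup>2 / 2 * \<sigma>2)" by (rule tendsto_diff)
    then show ?thesis by simp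
  qed

  let ?char = "\<lambda>k. char (distr (partition_measure \<theta> V (L k) (n k)) borel
       (\<lambda>l. (real (occupation 0 l) - (\<rho> - critical_density_L \<theta> V (L k)) * L k ^ CARD('d)) / s k)) t"
  have "\<forall>k. \<exists>num den. (moment (b k) 1 \<le> real (n k) \<and> m0 k \<ge> 1 \<and> 1 \<le> \<alpha> k * real (m0 k div 2))
       \<longrightarrow> ?char k = num / den \<and> norm (num - exp (S k)) \<le> \<eta> k \<and> norm (den - 1) \<le> \<eta> k"
  proof
    fix k
    show "\<exists>num den. (moment (b k) 1 \<le> real (n k) \<and> m0 k \<ge> 1 \<and> 1 \<le> \<alpha> k * real (m0 k div 2))
       \<longrightarrow> ?char k = num / den \<and> norm (num - exp (S k)) \<le> \<eta> k \<and> norm (den - 1) \<le> \<eta> k"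
    proof (cases "moment (b k) 1 \<le> real (n k) \<and> m0 k \<ge> 1 \<and> 1 \<le> \<alpha> k * real (m0 k div 2)")
      case True
      note defs = \<eta>_def S_def \<alpha>_def m0_def b_def C_def \<beta>_def
      show ?thesis
      proof (rule occupation_char_close[OF ctx L[of k] n[of k], of "s k" t], goal_cases)
        case (1 j)
        then show ?case .
      next
        case 2
        show ?case using True unfolding defs by blast
      next
        case 3
        show ?case using True unfolding defs by blast
      next
        case 4
        show ?case using True unfolding defs by blast
      next
        case (5 num den)
        then show ?case unfolding defs by blast
      qed
    qed blast
  qed
  from this[THEN choice] obtain num where "\<forall>k. \<exists>den. (moment (b k) 1 \<le> real (n k) \<and> m0 k \<ge> 1 \<and> 1 \<le> \<alpha> k * real (m0 k div 2))
       \<longrightarrow> ?char k = num k / den \<and> norm (num k - exp (S k)) \<le> \<eta> k \<and> norm (den - 1) \<le> \<eta> k" ..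
  from this[THEN choice] obtain den where nd: "\<forall>k. (moment (b k) 1 \<le> real (n k) \<and> m0 k \<ge> 1 \<and> 1 \<le> \<alpha> k * real (m0 k div 2))
       \<longrightarrow> ?char k = num k / den k \<and> norm (num k - exp (S k)) \<le> \<eta> k \<and> norm (den k - 1) \<le> \<eta> k" ..
  have ev: "eventually (\<lambda>k. ?char k = num k / den k \<and> norm (num k - exp (S k)) \<le> \<eta> k \<and> norm (den k - 1) \<le> \<eta> k) sequentially"
    using m0_ev m0_2 \<alpha>_large by eventually_elim (rule nd[rule_format], auto)
  have "(\<lambda>k. num k - exp (S k)) \<longlonglongrightarrow> 0"
    by (rule Lim_null_comparison[OF _ \<eta>0]) (use ev in \<open>auto elim: eventually_mono\<close>)
  from tendsto_add[OF this tendsto_exp[OF S]] have num: "num \<longlonglongrightarrow> exp (of_real (- (t\<^sup>2 / 2 * \<sigma>2)))" by simp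
  have "(\<lambda>k. den k - 1) \<longlonglongrightarrow> 0"
    by (rule Lim_null_comparison[OF _ \<eta>0]) (use ev in \<open>auto elim: eventually_mono\<close>)
  from tendsto_add[OF this tendsto_const[of 1]] have den: "den \<longlonglongrightarrow> 1" by simp
  have "(\<lambda>k. num k / den k) \<longlonglongrightarrow> exp (of_real (- (t\<^sup>2 / 2 * \<sigma>2))) / 1"
    by (rule tendsto_divide[OF num den]) simp
  then have "?char \<longlonglongrightarrow> exp (of_real (- (t\<^sup>2 / 2 * \<sigma>2))) / 1"
    by (rule Lim_transform_eventually) (use ev in \<open>auto elim: eventually_mono\<close>)
  then show ?thesis unfolding s_def \<sigma>2_def by (simp only: exp_of_real div_by_1)
qed

theorem theorem6p5:
  fixes V :: "real ^ 'd::finite \<Rightarrow> real" and \<theta> :: "nat \<Rightarrow> real"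
    and \<gamma> \<delta> \<rho> :: real and n :: "nat \<Rightarrow> nat" and L :: "nat \<Rightarrow> real"
  assumes "\<delta> > 0" and "\<And>x. V x = norm x powr \<delta>"
    and "\<gamma> > 0" and "\<And>j. j \<ge> 1 \<Longrightarrow> \<theta> j = real j powr \<gamma>"
    and "(1 + \<gamma>) * (1 + \<gamma> / 2) < real CARD('d) / \<delta>" and "real CARD('d) / \<delta> < \<gamma> + 2"
    and "ennreal \<rho> > critical_density \<theta> V"
    and "\<And>k. L k > 0"
    and "filterlim n at_top sequentially" and "filterlim L at_top sequentially"
    and "\<And>k. real (n k) = \<rho> * L k ^ CARD('d)"
  shows "weak_conv_m
    (\<lambda>k. distr (partition_measure \<theta> V (L k) (n k)) borel
       (\<lambda>l. (real (occupation 0 l) - (\<rho> - critical_density_L \<theta> V (L k)) * L k ^ CARD('d))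
             / L k powr (\<delta> * (1 + \<gamma> / 2))))
    (distr std_normal_distribution borel
       (\<lambda>z. sqrt (Gamma (\<gamma> + 2) *
              (\<Sum>\<^sub>\<infinity>x\<in>-{0 :: int ^ 'd}. 1 / norm (lattice_point x) powr (\<delta> * (\<gamma> + 2)))) * z))"
proof (rule levy_continuity)
  have lower: "\<delta> * (1 + \<gamma>) * (1 + \<gamma> / 2) < real CARD('d)"
    using assms(1,5) by (simp add: pos_less_divide_eq mult_ac)
  have upper: "real CARD('d) < \<delta> * (\<gamma> + 2)"
    using assms(1,6) by (simp add: pos_divide_less_eq mult_ac)
  define \<sigma>2 where "\<sigma>2 = Gamma (\<gamma> + 2) * (\<Sum>\<^sub>\<infinity>x\<in>-{0 :: int ^ 'd}. 1 / norm (lattice_point x) powr (\<delta> * (\<gamma> + 2)))"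
  have \<sigma>2: "\<sigma>2 \<ge> 0"
    unfolding \<sigma>2_def using assms(3)
    by (intro mult_nonneg_nonneg infsum_nonneg less_imp_le[OF Gamma_real_pos]) auto
  have \<sigma>2_eq: "\<sigma>2 = Gamma (\<gamma> + 2) * (\<Sum>\<^sub>\<infinity>x\<in>-{0 :: int ^ 'd}. norm (lattice_point x) powr (- (\<delta> * (\<gamma> + 2))))"
    by (simp only: \<sigma>2_def powr_minus_divide)
  interpret std: real_distribution std_normal_distribution
    by (rule real_dist_normal_dist)
  show "real_distribution (distr std_normal_distribution borel
     (\<lambda>z. sqrt (Gamma (\<gamma> + 2) * (\<Sum>\<^sub>\<infinity>x\<in>-{0 :: int ^ 'd}. 1 / norm (lattice_point x) powr (\<delta> * (\<gamma> + 2)))) * z))"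
    by (rule std.real_distribution_distr) simp
  show "real_distribution (distr (partition_measure \<theta> V (L k) (n k)) borel
       (\<lambda>l. (real (occupation 0 l) - (\<rho> - critical_density_L \<theta> V (L k)) * L k ^ CARD('d))
             / L k powr (\<delta> * (1 + \<gamma> / 2))))" for k
    by (rule real_distribution_occupation_law[OF assms(1-4) upper assms(8)])
  fix t :: real
  have "char (distr std_normal_distribution borel (\<lambda>z. sqrt \<sigma>2 * z)) t = char std_normal_distribution (t * sqrt \<sigma>2)"
    unfolding char_def by (subst integral_distr) (simp_all add: mult.assoc)
  also have "\<dots> = of_real (exp (- (t\<^sup>2 / 2 * \<sigma>2)))"
    unfolding char_std_normal_distribution using \<sigma>2 by (simp add: power_mult_distrib)
  finally have limit: "char (distr std_normal_distribution borel (\<lambda>z. sqrt \<sigma>2 * z)) t = of_real (exp (- (t\<^sup>2 / 2 * \<sigma>2)))" .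
  show "(\<lambda>k. char (distr (partition_measure \<theta> V (L k) (n k)) borel
       (\<lambda>l. (real (occupation 0 l) - (\<rho> - critical_density_L \<theta> V (L k)) * L k ^ CARD('d))
             / L k powr (\<delta> * (1 + \<gamma> / 2)))) t)
    \<longlonglongrightarrow> char (distr std_normal_distribution borel
     (\<lambda>z. sqrt (Gamma (\<gamma> + 2) * (\<Sum>\<^sub>\<infinity>x\<in>-{0 :: int ^ 'd}. 1 / norm (lattice_point x) powr (\<delta> * (\<gamma> + 2)))) * z)) t"
    unfolding \<sigma>2_def[symmetric] limit unfolding \<sigma>2_eq
    by (rule occupation_char_tendsto[OF assms(1-4) lower upper assms(7,8,10,11)])
qed

end
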